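(* Let $N\ge 1$ and let $\mathcal{H}$ be either the Hardy space $H^2(B_N)$ or a weighted Bergman space $A^2_s(B_N)$ with $s>-1$. Let $\phi_1,\ldots,\phi_m$ be analytic self-maps of $B_N$ and $c_1,\ldots,c_m$ complex numbers such that $C_{\phi_1},\ldots,C_{\phi_m}$ are bounded on $\mathcal{H}$ and $c_1C_{\phi_1}+\cdots+c_mC_{\phi_m}$ is compact on $\mathcal{H}$. If $\zeta\in\partial B_N$ and $\phi_j$ has finite angular derivative at $\zeta$ for some $j\in\{1,\ldots,m\}$, then $$\sum_{\substack{1\le l\le m\\ \phi_l(\zeta)=\phi_j(\zeta)\\ d_{\phi_l}(\zeta)=d_{\phi_j}(\zeta)}} c_l=0.$$
   Context: $B_N$ is the open unit ball of $\mathbb{C}^N$, $\partial B_N$ the unit sphere, $\langle\cdot,\cdot\rangle$ the standard Hermitian inner product, $\sigma$ normalized Lebesgue measure on $\partial B_N$, $\nu$ normalized Lebesgue volume measure on $B_N$. $H^2(B_N)$ is the Hilbert space of holomorphic $f$ on $B_N$ with $\|f\|_2^2=\sup_{0<r<1}\int_{\partial B_N}|f(r\zeta)|^2\,d\sigma(\zeta)<\infty$. For $s>-1$, $A^2_s(B_N)$ is the Hilbert space of holomorphic $f$ on $B_N$ with $\|f\|_{2,s}^2=\int_{B_N}|f(z)|^2 w_s(z)\,d\nu(z)<\infty$, where $w_s(z)=\frac{\Gamma(N+s+1)}{\Gamma(N+1)\Gamma(s+1)}(1-|z|^2)^s$. For an analytic map $\phi:B_N\to B_N$, $C_\phi f=f\circ\phi$.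 For $\zeta\in\partial B_N$, $$d_\phi(\zeta)=\liminf_{z\to\zeta}\frac{1-|\phi(z)|}{1-|z|}\in(0,\infty],$$ where $z$ tends to $\zeta$ unrestrictedly in $B_N$, and $\phi(\zeta):=\lim_{r\to1^-}\phi(r\zeta)$ is the radial limit, which exists and lies in $\partial B_N$ whenever $d_\phi(\zeta)<\infty$ (Julia–Carathéodory theorem in $B_N$). Finite angular derivative: a function $f:B_N\to\mathbb{C}$ has restricted limit $L$ at $\zeta\in\partial B_N$ if $\lim_{t\to1}f(\Gamma(t))=L$ for every curve $\Gamma:[0,1)\to B_N$ with $\Gamma(t)\to\zeta$ such that, writing $\gamma(t)=\langle\Gamma(t),\zeta\rangle\zeta$, one has $\lim_{t\to1}\frac{|\Gamma(t)-\gamma(t)|^2}{1-|\gamma(t)|^2}=0$ and $\frac{|\gamma(t)-\zeta|}{1-|\gamma(t)|}\le M<\infty$ for all $0\le t<1$ and some $M$. The map $\phi$ has finite angular derivative at $\zeta$ if there is $\eta\in\partial B_N$ such that $\frac{\langle\eta-\phi(z),\eta\rangle}{\langle\zeta-z,\zeta\rangle}$ has a (finite) restricted limit at $\zeta$. By the Julia–Carathéodory theorem in $B_N$ this is equivalent to $d_\phi(\zeta)<\infty$. *)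

theory Defs
  imports "HOL-Analysis.Analysis"
begin

definition hinner :: "complex ^ 'n \<Rightarrow> complex ^ 'n \<Rightarrow> complex" where
  "hinner z w = (\<Sum>i\<in>UNIV. z $ i * cnj (w $ i))"

abbreviation unit_ball :: "(complex ^ 'n) set" where
  "unit_ball \<equiv> ball 0 1"

abbreviation unit_sphere :: "(complex ^ 'n) set" where
  "unit_sphere \<equiv> sphere 0 1"

text \<open>Holomorphy in several variables: complex Frechet differentiability at every point,
  i.e. the real derivative exists and is complex linear.\<close>

definition holomorphic_on_ball :: "(complex ^ 'n \<Rightarrow> complex) \<Rightarrow> bool" where
  "holomorphic_on_ball f \<longleftrightarrow>
     (\<forall>z\<in>unit_ball. \<exists>D. (f has_derivative D) (at z) \<and> (\<forall>c v. D (c *s v) = c * D v))"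

definition analytic_self_map :: "(complex ^ 'n \<Rightarrow> complex ^ 'n) \<Rightarrow> bool" where
  "analytic_self_map \<phi> \<longleftrightarrow>
     (\<forall>i. holomorphic_on_ball (\<lambda>z. \<phi> z $ i)) \<and> \<phi> ` unit_ball \<subseteq> unit_ball"

definition nu :: "(complex ^ 'n) measure" where
  "nu = uniform_measure lborel unit_ball"

text \<open>Normalized surface measure is the image of normalized volume on the ball under radial
  projection: the measure of a Borel set of the sphere is the normalized volume of the cone
  over it.\<close>

definition sigma_sphere :: "(complex ^ 'n) measure" where
  "sigma_sphere = distr nu borel (\<lambda>z. z /\<^sub>R norm z)"

text \<open>Elements of the function spaces are represented by total functions whose values off the
  ball are irrelevant: neither membership nor the norms depend on them.\<close>

definition hardy_sqnorm :: "(complex ^ 'n \<Rightarrow> complex) \<Rightarrow> ennreal" where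
  "hardy_sqnorm f =
     (SUP r\<in>{0<..<1::real}. \<integral>\<^sup>+\<zeta>\<in>unit_sphere. ennreal ((cmod (f (r *\<^sub>R \<zeta>)))\<^sup>2) \<partial>sigma_sphere)"

definition hardy_space :: "(complex ^ 'n \<Rightarrow> complex) set" where
  "hardy_space = {f. holomorphic_on_ball f \<and> hardy_sqnorm f < \<infinity>}"

definition hardy_norm :: "(complex ^ 'n \<Rightarrow> complex) \<Rightarrow> real" where
  "hardy_norm f = sqrt (enn2real (hardy_sqnorm f))"

definition bergman_weight :: "real \<Rightarrow> complex ^ 'n \<Rightarrow> real" where
  "bergman_weight s z =
     Gamma (real CARD('n) + s + 1) / (Gamma (real CARD('n) + 1) * Gamma (s + 1))
       * (1 - (norm z)\<^sup>2) powr s"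

definition bergman_sqnorm :: "real \<Rightarrow> (complex ^ 'n \<Rightarrow> complex) \<Rightarrow> ennreal" where
  "bergman_sqnorm s f =
     (\<integral>\<^sup>+z\<in>unit_ball. ennreal ((cmod (f z))\<^sup>2 * bergman_weight s z) \<partial>nu)"

definition bergman_space :: "real \<Rightarrow> (complex ^ 'n \<Rightarrow> complex) set" where
  "bergman_space s = {f. holomorphic_on_ball f \<and> bergman_sqnorm s f < \<infinity>}"

definition bergman_norm :: "real \<Rightarrow> (complex ^ 'n \<Rightarrow> complex) \<Rightarrow> real" where
  "bergman_norm s f = sqrt (enn2real (bergman_sqnorm s f))"

definition comp_op :: "('a \<Rightarrow> 'a) \<Rightarrow> ('a \<Rightarrow> complex) \<Rightarrow> 'a \<Rightarrow> complex" where
  "comp_op \<phi> f = f \<circ> \<phi>"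

definition bounded_operator ::
  "('a \<Rightarrow> complex) set \<Rightarrow> (('a \<Rightarrow> complex) \<Rightarrow> real) \<Rightarrow> (('a \<Rightarrow> complex) \<Rightarrow> 'a \<Rightarrow> complex) \<Rightarrow> bool"
where
  "bounded_operator H nrm T \<longleftrightarrow>
     (\<forall>f\<in>H. T f \<in> H) \<and> (\<exists>C. \<forall>f\<in>H. nrm (T f) \<le> C * nrm f)"

definition compact_operator ::
  "('a \<Rightarrow> complex) set \<Rightarrow> (('a \<Rightarrow> complex) \<Rightarrow> real) \<Rightarrow> (('a \<Rightarrow> complex) \<Rightarrow> 'a \<Rightarrow> complex) \<Rightarrow> bool"
where
  "compact_operator H nrm T \<longleftrightarrow>
     (\<forall>f\<in>H. T f \<in> H) \<and>
     (\<forall>F :: nat \<Rightarrow> 'a \<Rightarrow> complex.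
        (\<forall>n. F n \<in> H) \<and> (\<exists>M. \<forall>n. nrm (F n) \<le> M) \<longrightarrow>
        (\<exists>g\<in>H. \<exists>k :: nat \<Rightarrow> nat. strict_mono k \<and>
           (\<lambda>n. nrm (\<lambda>z. T (F (k n)) z - g z)) \<longlonglongrightarrow> 0))"

definition dil_coeff :: "(complex ^ 'n \<Rightarrow> complex ^ 'n) \<Rightarrow> complex ^ 'n \<Rightarrow> ereal" where
  "dil_coeff \<phi> \<zeta> =
     Liminf (at \<zeta> within unit_ball) (\<lambda>z. ereal ((1 - norm (\<phi> z)) / (1 - norm z)))"

text \<open>Unspecified when the radial limit does not exist; it does exist whenever
  \<open>dil_coeff \<phi> \<zeta> < \<infinity>\<close>.\<close>

definition radial_limit :: "(complex ^ 'n \<Rightarrow> complex ^ 'n) \<Rightarrow> complex ^ 'n \<Rightarrow> complex ^ 'n" where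
  "radial_limit \<phi> \<zeta> = Lim (at_left (1::real)) (\<lambda>r. \<phi> (r *\<^sub>R \<zeta>))"

definition restricted_curve :: "(real \<Rightarrow> complex ^ 'n) \<Rightarrow> complex ^ 'n \<Rightarrow> bool" where
  "restricted_curve \<Gamma> \<zeta> \<longleftrightarrow>
     continuous_on {0..<1} \<Gamma> \<and> \<Gamma> ` {0..<1} \<subseteq> unit_ball \<and> (\<Gamma> \<longlongrightarrow> \<zeta>) (at_left 1) \<and>
     (let \<gamma> = (\<lambda>t. hinner (\<Gamma> t) \<zeta> *s \<zeta>) in
       ((\<lambda>t. (norm (\<Gamma> t - \<gamma> t))\<^sup>2 / (1 - (norm (\<gamma> t))\<^sup>2)) \<longlongrightarrow> 0) (at_left 1) \<and>
       (\<exists>M. \<forall>t\<in>{0..<1}. norm (\<gamma> t - \<zeta>) / (1 - norm (\<gamma> t)) \<le> M))"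

definition has_restricted_limit ::
  "(complex ^ 'n \<Rightarrow> complex) \<Rightarrow> complex \<Rightarrow> complex ^ 'n \<Rightarrow> bool" where
  "has_restricted_limit f L \<zeta> \<longleftrightarrow>
     (\<forall>\<Gamma>. restricted_curve \<Gamma> \<zeta> \<longrightarrow> ((\<lambda>t. f (\<Gamma> t)) \<longlongrightarrow> L) (at_left 1))"

definition finite_angular_derivative ::
  "(complex ^ 'n \<Rightarrow> complex ^ 'n) \<Rightarrow> complex ^ 'n \<Rightarrow> bool" where
  "finite_angular_derivative \<phi> \<zeta> \<longleftrightarrow>
     (\<exists>\<eta>\<in>unit_sphere. \<exists>L.
        has_restricted_limit (\<lambda>z. hinner (\<eta> - \<phi> z) \<eta> / hinner (\<zeta> - z) \<zeta>) L \<zeta>)"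

end

theory Submission
  imports Defs "HOL-Complex_Analysis.Conformal_Mappings" "HOL-Computational_Algebra.Polynomial"
begin

text \<open>Let \<open>N\<close> be the dimension and put \<open>\<beta> = N\<close> for the Hardy space, \<open>\<beta> = N + 1 + s\<close> for the
  Bergman space. Point evaluation at \<open>w\<close> is bounded by a constant times \<open>(1 - |w|)\<^bsup>-\<beta>/2\<^esup>\<close>, and for a
  unit vector \<open>\<eta>\<close> and a natural number \<open>p > \<beta>/2\<close> the functions
  \<open>f\<^sub>\<epsilon>(z) = \<epsilon>\<^bsup>p - \<beta>/2\<^esup> / (1 + \<epsilon> - \<langle>z, \<eta>\<rangle>)\<^bsup>p\<^esup>\<close> are bounded in norm and tend to 0 pointwise as
  \<open>\<epsilon> \<rightarrow> 0\<close>. So if \<open>T = \<Sum> c\<^sub>l C\<^bsub>\<phi>\<^sub>l\<^esub>\<close> is compact, then \<open>(1 - r)\<^bsup>\<beta>/2\<^esup> (T f\<^sub>\<epsilon>)(r \<zeta>) \<rightarrow> 0\<close> along a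
  sequence \<open>r \<rightarrow> 1\<close> with \<open>\<epsilon> = \<tau> (1 - r)\<close>, for each fixed \<open>\<tau> > 0\<close>. Take \<open>\<eta> = \<phi>\<^sub>j(\<zeta>)\<close>. By the
  Julia-Caratheodory theorem the same quantity tends to \<open>\<tau>\<^bsup>p - \<beta>/2\<^esup> \<Sum> c\<^sub>l / (\<tau> + d\<^sub>l)\<^bsup>p\<^esup>\<close>, summed over
  the \<open>l\<close> with \<open>d\<^sub>l < \<infinity>\<close> and \<open>\<phi>\<^sub>l(\<zeta>) = \<eta>\<close>; the other terms vanish in the limit. This rational
  function of \<open>\<tau>\<close> is therefore zero, which forces the coefficients of each pole to cancel.\<close>

section \<open>The Schwarz-Pick inequality on the ball\<close>

text \<open>The free scale \<tau> is what separates the terms with the same radial limit: one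
  normalised kernel per radius gives a single linear relation among the coefficients, while letting
  \<tau> run over the positive axis gives a rational function with poles at -d_l. The integer
  exponent \<open>p\<close> keeps it rational and avoids branches of a complex power, as \<beta>
  need not be an integer.

  There is no slack in the exponent: the evaluation bound must have exactly the power \<beta>/2 with
  which the test functions are normalised. This dictates the measure theory. A Euclidean ball of
  radius comparable to 1 - |w| has volume of order (1 - |w|)^(2N), too small for N > 1; averaging
  over a set that is longer in the directions complex orthogonal to w gives (1 - |w|)^(N+1). The
  same anisotropy governs the caps of points \<zeta> with |1 - <\<zeta>, \<eta>>| < t, whose measure
  is at most a constant times t^N. Surface measure is the image of volume, so spherical integrals
  are estimated as volumes of cones.\<close>

lemma Re_hinner: "Re (hinner z w) = z \<bullet> w"
  by (simp add: hinner_def inner_vec_def inner_complex_def)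

lemma hinner_add_left: "hinner (x + y) w = hinner x w + hinner y w"
  by (simp add: hinner_def sum.distrib algebra_simps)

lemma hinner_diff_left: "hinner (x - y) w = hinner x w - hinner y w"
  by (simp add: hinner_def sum_subtractf algebra_simps)

lemma hinner_smult_left: "hinner (c *s x) w = c * hinner x w"
  by (simp add: hinner_def sum_distrib_left algebra_simps)

lemma hinner_smult_right: "hinner x (c *s w) = cnj c * hinner x w"
  by (simp add: hinner_def sum_distrib_left algebra_simps)

lemma hinner_commute: "hinner x y = cnj (hinner y x)"
  by (simp add: hinner_def mult.commute)

lemma hinner_add_right: "hinner w (x + y) = hinner w x + hinner w y"
  by (simp add: hinner_def sum.distrib algebra_simps)

lemma hinner_diff_right: "hinner w (x - y) = hinner w x - hinner w y"
  by (simp add: hinner_def sum_subtractf algebra_simps)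

lemma scaleR_eq_smult: "r *\<^sub>R x = complex_of_real r *s x" for x :: "complex ^ 'n"
  unfolding vec_eq_iff by (simp add: scaleR_conv_of_real[where 'a = complex])

lemma hinner_scaleR_left: "hinner (r *\<^sub>R x) w = of_real r * hinner x w"
  by (simp add: scaleR_eq_smult hinner_smult_left)

lemma hinner_scaleR_right: "hinner x (r *\<^sub>R w) = of_real r * hinner x w"
  by (simp add: scaleR_eq_smult hinner_smult_right)

lemma hinner_self: "hinner x x = of_real ((norm x)\<^sup>2)"
proof -
  have "hinner x x = of_real (Re (hinner x x))"
    by (simp add: complex_eq_iff) (simp add: hinner_def)
  thus ?thesis by (simp add: Re_hinner power2_norm_eq_inner)
qed

lemma norm_vector_smult: "norm (c *s x) = cmod c * norm x" for x :: "complex ^ 'n"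
  by (simp add: norm_vec_def norm_mult L2_set_right_distrib)

text \<open>A unimodular factor \<open>c\<close> makes the Hermitian product real and nonnegative,
  and the real Cauchy-Schwarz inequality then bounds its real part.\<close>

lemma cmod_hinner_le: "cmod (hinner x y) \<le> norm x * norm y"
proof -
  define h where "h = hinner x y"
  define c where "c = (if h = 0 then 1 else cnj h / of_real (cmod h))"
  have c1: "cmod c = 1" by (auto simp: c_def norm_divide)
  have "c * h = of_real (cmod h)"
    by (auto simp: c_def complex_norm_square[symmetric] power2_eq_square mult.commute)
  hence "cmod h = Re (hinner (c *s x) y)" by (simp add: hinner_smult_left h_def)
  also have "\<dots> \<le> norm (c *s x) * norm y" unfolding Re_hinner by (rule norm_cauchy_schwarz)
  finally show ?thesis by (simp add: norm_vector_smult c1 h_def)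
qed

lemma norm_diff_sqr_unit:
  assumes "norm \<eta> = 1"
  shows "(norm (x - \<eta>))\<^sup>2 = (norm x)\<^sup>2 + 1 - 2 * Re (hinner x \<eta>)"
  using assms by (simp add: power2_norm_eq_inner Re_hinner inner_diff inner_commute norm_eq_1)

lemma continuous_on_hinner [continuous_intros]:
  "continuous_on S f \<Longrightarrow> continuous_on S (\<lambda>x. hinner (f x) w)"
  unfolding hinner_def by (intro continuous_intros)

lemma tendsto_hinner [tendsto_intros]:
  "(f \<longlongrightarrow> a) F \<Longrightarrow> (g \<longlongrightarrow> b) F \<Longrightarrow> ((\<lambda>x. hinner (f x) (g x)) \<longlongrightarrow> hinner a b) F"
  unfolding hinner_def by (intro tendsto_intros)

section \<open>Restriction of holomorphic functions to complex lines\<close>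

lemma holomorphic_on_ball_continuous:
  "holomorphic_on_ball f \<Longrightarrow> continuous_on unit_ball f"
  unfolding holomorphic_on_ball_def
  by (meson continuous_at_imp_continuous_on has_derivative_continuous)

lemma has_derivative_complex_line:
  "((\<lambda>l. a + l *s v) has_derivative (\<lambda>h. h *s v)) (at x)"
  for v :: "complex ^ 'n"
proof -
  have "bounded_linear (\<lambda>h. h *s v)"
    by (rule bounded_linear_intro[where K = "norm v"])
       (auto simp: vector_sadd_rdistrib norm_vector_smult scaleR_eq_smult vector_smult_assoc
         scaleR_conv_of_real[where 'a = complex])
  from bounded_linear_imp_has_derivative[OF this] show ?thesis
    by (auto intro!: derivative_eq_intros)
qed

text \<open>Complex linearity of the derivative \<open>D\<close> is what makes the slice complex
  differentiable, with derivative \<open>D v\<close>. One-variable theory enters the ball through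
  this.\<close>

lemma holomorphic_on_ball_slice:
  assumes f: "holomorphic_on_ball f" and S: "\<And>l. l \<in> S \<Longrightarrow> a + l *s v \<in> unit_ball"
  shows "(\<lambda>l. f (a + l *s v)) holomorphic_on S"
proof (rule holomorphic_onI)
  fix x assume "x \<in> S"
  then obtain D where D: "(f has_derivative D) (at (a + x *s v))" "\<And>c u. D (c *s u) = c * D u"
    using f S unfolding holomorphic_on_ball_def by blast
  have "((\<lambda>l. f (a + l *s v)) has_derivative (\<lambda>h. D (h *s v))) (at x)"
    using has_derivative_compose[OF has_derivative_complex_line D(1)] .
  hence "((\<lambda>l. f (a + l *s v)) has_field_derivative D v) (at x)"
    by (simp add: has_field_derivative_def D(2) mult_commute_abs)
  thus "(\<lambda>l. f (a + l *s v)) field_differentiable at x within S"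
    using field_differentiable_at_within field_differentiable_def by blast
qed

text \<open>With denominators restored it reads 1 - |m(x)|^2 = (1 - |x|^2)(1 - |b|^2) / |1 - cnj b
  x|^2 for the disc automorphism m(x) = (x - b)/(1 - cnj b x). It converts comparisons of |m| into
  comparisons of distances to the circle.\<close>

lemma moebius_identity:
  "(cmod (1 - cnj b * x))\<^sup>2 - (cmod (x - b))\<^sup>2 = (1 - (cmod x)\<^sup>2) * (1 - (cmod b)\<^sup>2)"
  unfolding cmod_power2 by (simp add: power2_eq_square algebra_simps)

lemma one_minus_cnj_mult_nz:
  assumes "cmod b < 1" "cmod x < 1"
  shows "1 - cnj b * x \<noteq> 0"
proof
  assume "1 - cnj b * x = 0"
  hence "cmod b * cmod x = 1" by (metis complex_mod_cnj norm_mult norm_one right_minus_eq)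
  moreover have "cmod b * cmod x < 1" using assms mult_strict_mono'[of "cmod b" 1 "cmod x" 1] by simp
  ultimately show False by simp
qed

lemma moebius_less_one:
  assumes "cmod b < 1" "cmod x < 1"
  shows "cmod ((x - b) / (1 - cnj b * x)) < 1"
proof -
  have "0 < (1 - (cmod x)\<^sup>2) * (1 - (cmod b)\<^sup>2)"
    using assms by (simp add: abs_square_less_1)
  hence "(cmod (x - b))\<^sup>2 < (cmod (1 - cnj b * x))\<^sup>2" using moebius_identity[of b x] by linarith
  hence "cmod (x - b) < cmod (1 - cnj b * x)" by (rule power_less_imp_less_base) simp
  thus ?thesis using one_minus_cnj_mult_nz[OF assms] by (simp add: norm_divide)
qed

lemma moebius_inverse:
  assumes "cmod b < 1" "cmod a < 1"
  defines "m \<equiv> (a - b) / (1 - cnj b * a)"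
  shows "(m + b) / (1 + cnj b * m) = a"
proof -
  have n: "1 - cnj b * a \<noteq> 0" "1 - cnj b * b \<noteq> 0" using one_minus_cnj_mult_nz assms by auto
  have e1: "m + b = a * (1 - cnj b * b) / (1 - cnj b * a)"
    using n unfolding m_def by (simp add: field_simps)
  have e2: "1 + cnj b * m = (1 - cnj b * b) / (1 - cnj b * a)"
    using n unfolding m_def by (simp add: field_simps)
  show ?thesis unfolding e1 e2 using n by simp
qed

text \<open>Schwarz's lemma for \<open>h\<close> between disc automorphisms: 0 goes to
  \<open>b\<close>, then to \<open>h b\<close>, then back to 0. The product form, free of quotients,
  is chosen because one of the two points is later sent to the boundary.\<close>

lemma Schwarz_Pick:
  assumes h: "h holomorphic_on ball 0 1" and h1: "\<And>z. cmod z < 1 \<Longrightarrow> cmod (h z) < 1"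
    and a: "cmod a < 1" and b: "cmod b < 1"
  shows "(cmod (1 - cnj (h b) * h a))\<^sup>2 * ((1 - (cmod a)\<^sup>2) * (1 - (cmod b)\<^sup>2))
      \<le> (cmod (1 - cnj b * a))\<^sup>2 * ((1 - (cmod (h a))\<^sup>2) * (1 - (cmod (h b))\<^sup>2))"
proof -
  define m where "m = (\<lambda>x. (x + b) / (1 + cnj b * x))"
  have m1: "cmod (m x) < 1" if "cmod x < 1" for x
    using moebius_less_one[of "-b" x] b that by (simp add: m_def)
  have mn: "1 + cnj b * x \<noteq> 0" if "cmod x < 1" for x
    using one_minus_cnj_mult_nz[of "-b" x] b that by simp
  have mhol: "m holomorphic_on ball 0 1"
    unfolding m_def using mn by (intro holomorphic_intros) auto
  define g where "g = (\<lambda>x. (h (m x) - h b) / (1 - cnj (h b) * h (m x)))"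
  have hm: "(\<lambda>x. h (m x)) holomorphic_on ball 0 1"
    using holomorphic_on_compose_gen[OF mhol h] m1 by (simp add: o_def image_subset_iff)
  have "g holomorphic_on ball 0 1"
    unfolding g_def using one_minus_cnj_mult_nz[OF h1[OF b] h1[OF m1]]
    by (intro holomorphic_intros hm) auto
  moreover have "g 0 = 0" by (simp add: g_def m_def)
  moreover have "cmod (g x) < 1" if "cmod x < 1" for x
    unfolding g_def using moebius_less_one[OF h1[OF b] h1[OF m1[OF that]]] .
  ultimately have "cmod (g ((a - b) / (1 - cnj b * a))) \<le> cmod ((a - b) / (1 - cnj b * a))"
    using Schwarz_Lemma(1) moebius_less_one[OF b a] by blast
  also have "m ((a - b) / (1 - cnj b * a)) = a"
    unfolding m_def using moebius_inverse[OF b a] .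
  hence "g ((a - b) / (1 - cnj b * a)) = (h a - h b) / (1 - cnj (h b) * h a)"
    by (simp add: g_def)
  finally have le: "cmod (h a - h b) / cmod (1 - cnj (h b) * h a) \<le> cmod (a - b) / cmod (1 - cnj b * a)"
    by (simp add: norm_divide)
  define A A' P P' where "A = cmod (1 - cnj b * a)" and "A' = cmod (1 - cnj (h b) * h a)"
    and "P = cmod (a - b)" and "P' = cmod (h a - h b)"
  have pos: "A > 0" "A' > 0"
    using one_minus_cnj_mult_nz[OF b a] one_minus_cnj_mult_nz[OF h1[OF b] h1[OF a]]
    by (auto simp: A_def A'_def)
  have "P' * A \<le> P * A'" using le pos by (simp add: A_def A'_def P_def P'_def field_simps)
  hence "(P' * A)\<^sup>2 \<le> (P * A')\<^sup>2" by (rule power_mono) (auto simp: P'_def A_def)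
  \<comment> \<open>Both sides are subtracted from A^2 A'^2, so that each bracket becomes a left
    side of \<open>moebius_identity\<close>.\<close>
  hence "A'\<^sup>2 * (A\<^sup>2 - P\<^sup>2) \<le> A\<^sup>2 * (A'\<^sup>2 - P'\<^sup>2)" by (simp add: algebra_simps power_mult_distrib)
  thus ?thesis unfolding A_def A'_def P_def P'_def moebius_identity .
qed

text \<open>The complex line through two points meets the ball in a disc, whose affine parametrisation
  by the unit disc preserves the quantities in the Schwarz-Pick inequality.\<close>

lemma Schwarz_Pick_ball:
  fixes F :: "complex ^ 'n \<Rightarrow> complex"
  assumes F: "holomorphic_on_ball F" and F1: "\<And>z. z \<in> unit_ball \<Longrightarrow> cmod (F z) < 1"
    and z: "z \<in> unit_ball" and w: "w \<in> unit_ball"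
  shows "(cmod (1 - cnj (F w) * F z))\<^sup>2 * ((1 - (norm z)\<^sup>2) * (1 - (norm w)\<^sup>2))
      \<le> (cmod (1 - hinner z w))\<^sup>2 * ((1 - (cmod (F z))\<^sup>2) * (1 - (cmod (F w))\<^sup>2))"
proof (cases "z = w")
  case True
  have "cnj (F w) * F w = of_real ((cmod (F w))\<^sup>2)" by (simp only: complex_norm_square mult.commute)
  hence "1 - cnj (F w) * F w = of_real (1 - (cmod (F w))\<^sup>2)" by simp
  moreover have "1 - hinner w w = of_real (1 - (norm w)\<^sup>2)" by (simp add: hinner_self)
  ultimately show ?thesis unfolding True by (simp only: norm_of_real power2_abs) (simp add: power2_eq_square)
next
  case False
  define e where "e = (1 / norm (z - w)) *\<^sub>R (z - w)"
  have ne: "norm e = 1" using False by (simp add: e_def)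
  hence he: "hinner e e = 1" by (simp add: hinner_self)
  \<comment> \<open>\<open>c\<close> is the foot of the perpendicular from the origin to the complex
    line. Since \<open>c\<close> and \<open>e\<close> are orthogonal, Hermitian products and norms
    on the line split into a constant and a one-variable part.\<close>
  define c where "c = w - hinner w e *s e"
  have ce: "hinner c e = 0" by (simp add: c_def hinner_diff_left hinner_smult_left he)
  hence ec: "hinner e c = 0" by (metis hinner_commute complex_cnj_zero)
  have prod: "hinner (c + x *s e) (c + y *s e) = of_real ((norm c)\<^sup>2) + x * cnj y" for x y
    by (simp add: hinner_add_left hinner_add_right hinner_smult_left hinner_smult_right ce ec he)
       (simp add: hinner_self)
  have nrm: "(norm (c + x *s e))\<^sup>2 = (norm c)\<^sup>2 + (cmod x)\<^sup>2" for x
  proof -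
    have "complex_of_real ((norm (c + x *s e))\<^sup>2) = of_real ((norm c)\<^sup>2 + (cmod x)\<^sup>2)"
      unfolding hinner_self[symmetric] prod by (simp add: complex_norm_square[symmetric] hinner_self)
    thus ?thesis by (simp only: of_real_eq_iff)
  qed
  define q where "q = hinner w e"
  define t where "t = q + of_real (norm (z - w))"
  have weq: "w = c + q *s e" by (simp add: c_def q_def)
  have "z = w + norm (z - w) *\<^sub>R e" using False by (simp add: e_def)
  hence zeq: "z = c + t *s e"
    by (simp add: weq[symmetric] t_def scaleR_eq_smult vector_sadd_rdistrib)
       (metis weq add.assoc)
  have lt1: "(norm x)\<^sup>2 < 1" if "x \<in> unit_ball" for x :: "complex^'n"
    using that by (simp add: abs_square_less_1)
  have c1: "(norm c)\<^sup>2 < 1" using nrm[of q] lt1[OF w] weq by (smt (verit) zero_le_power2)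
  define R where "R = sqrt (1 - (norm c)\<^sup>2)"
  have R: "R > 0" "R\<^sup>2 = 1 - (norm c)\<^sup>2" using c1 by (auto simp: R_def)
  have Rc: "complex_of_real R * of_real R = 1 - of_real ((norm c)\<^sup>2)" using R(2)
    by (metis of_real_1 of_real_diff of_real_mult power2_eq_square)
  define h where "h = (\<lambda>l. F (c + l *s (of_real R *s e)))"
  have inb: "c + (l * of_real R) *s e \<in> unit_ball" if "cmod l < 1" for l
  proof -
    have "(norm (c + (l * of_real R) *s e))\<^sup>2 = (norm c)\<^sup>2 + (cmod l)\<^sup>2 * R\<^sup>2"
      using R(1) by (simp add: nrm norm_mult power_mult_distrib)
    also have "\<dots> < (norm c)\<^sup>2 + 1 * R\<^sup>2"
      using that R(1) by (intro add_strict_left_mono mult_strict_right_mono) (simp_all only: abs_square_less_1 zero_less_power abs_norm_cancel)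
    also have "\<dots> = 1" by (simp add: R(2))
    finally show ?thesis by (simp add: abs_square_less_1)
  qed
  have hh: "h holomorphic_on ball 0 1" unfolding h_def
    by (rule holomorphic_on_ball_slice[OF F]) (use inb in \<open>auto\<close>)
  have h1: "cmod (h l) < 1" if "cmod l < 1" for l
    unfolding h_def using F1[OF inb[OF that]] by simp
  define a b where "a = t / of_real R" and "b = q / of_real R"
  have coords: "h a = F z" "h b = F w" using R(1) by (auto simp: h_def a_def b_def zeq[symmetric] weq[symmetric])
  have na: "1 - (cmod a)\<^sup>2 = (1 - (norm z)\<^sup>2) / R\<^sup>2"
    using R nrm[of t] by (simp add: a_def zeq[symmetric] norm_divide power_divide field_simps)
  have nb: "1 - (cmod b)\<^sup>2 = (1 - (norm w)\<^sup>2) / R\<^sup>2"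
    using R nrm[of q] by (simp add: b_def weq[symmetric] norm_divide power_divide field_simps)
  have "0 < 1 - (cmod a)\<^sup>2" "0 < 1 - (cmod b)\<^sup>2"
    unfolding na nb using lt1[OF z] lt1[OF w] R(1) by auto
  hence ab: "cmod a < 1" "cmod b < 1" by (auto simp: abs_square_less_1)
  have "1 - hinner z w = of_real R * of_real R * (1 - cnj b * a)"
  proof -
    have "hinner z w = of_real ((norm c)\<^sup>2) + t * cnj q"
      by (metis zeq weq prod)
    moreover have "of_real R * of_real R * (1 - cnj b * a) = of_real R * of_real R - cnj q * t"
      using R(1) by (simp add: a_def b_def field_simps)
    ultimately show ?thesis by (simp add: Rc)
  qed
  hence hz: "cmod (1 - hinner z w) = R\<^sup>2 * cmod (1 - cnj b * a)"
    using R(1) by (simp add: norm_mult power2_eq_square)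
  \<comment> \<open>The factor \<open>R^4\<close> clears the denominators of \<open>na\<close> and
    \<open>nb\<close> and matches the square of \<open>hz\<close>.\<close>
  have "(cmod (1 - cnj (h b) * h a))\<^sup>2 * ((1 - (cmod a)\<^sup>2) * (1 - (cmod b)\<^sup>2)) * R^4
      \<le> (cmod (1 - cnj b * a))\<^sup>2 * ((1 - (cmod (h a))\<^sup>2) * (1 - (cmod (h b))\<^sup>2)) * R^4"
    by (intro mult_right_mono Schwarz_Pick[OF hh h1 ab]) auto
  thus ?thesis unfolding coords na nb hz using R(1)
    by (simp add: power_mult_distrib mult_ac power4_eq_xxxx power2_eq_square)
qed

section \<open>The Julia-Caratheodory theorem along radii\<close>

lemma holomorphic_on_ball_hinner:
  fixes \<phi> :: "complex ^ 'a \<Rightarrow> complex ^ 'n"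
  assumes "\<And>i. holomorphic_on_ball (\<lambda>z. \<phi> z $ i)"
  shows "holomorphic_on_ball (\<lambda>z. hinner (\<phi> z) v)"
  unfolding holomorphic_on_ball_def
proof
  fix z :: "complex^'a" assume z: "z \<in> unit_ball"
  hence "\<forall>i. \<exists>D. ((\<lambda>z. \<phi> z $ i) has_derivative D) (at z) \<and> (\<forall>c v. D (c *s v) = c * D v)"
    using assms unfolding holomorphic_on_ball_def by blast
  then obtain D where D: "\<And>i. ((\<lambda>z. \<phi> z $ i) has_derivative D i) (at z)"
      "\<And>i c v. D i (c *s v) = c * D i v"
    by metis
  have "((\<lambda>z. hinner (\<phi> z) v) has_derivative (\<lambda>h. \<Sum>i\<in>UNIV. D i h * cnj (v $ i))) (at z)"
    unfolding hinner_def by (intro has_derivative_sum has_derivative_mult_left D)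
  moreover have "\<forall>c u. (\<Sum>i\<in>UNIV. D i (c *s u) * cnj (v $ i)) = c * (\<Sum>i\<in>UNIV. D i u * cnj (v $ i))"
    by (simp add: D(2) sum_distrib_left mult.assoc)
  ultimately show "\<exists>D. ((\<lambda>z. hinner (\<phi> z) v) has_derivative D) (at z) \<and> (\<forall>c v. D (c *s v) = c * D v)"
    by blast
qed

section \<open>Dilation coefficients along radii\<close>

lemma analytic_self_map_norm_less:
  "analytic_self_map \<phi> \<Longrightarrow> norm z < 1 \<Longrightarrow> norm (\<phi> z) < 1"
  unfolding analytic_self_map_def image_subset_iff by (metis mem_ball_0)

lemma filterlim_radial:
  fixes \<zeta> :: "complex ^ 'n"
  assumes "norm \<zeta> = 1"
  shows "filterlim (\<lambda>r. r *\<^sub>R \<zeta>) (at \<zeta> within unit_ball) (at_left 1)"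
  unfolding filterlim_at
proof
  have "eventually (\<lambda>r. r \<in> {0<..<1::real}) (at_left 1)"
    by (rule eventually_at_leftI[of 0]) auto
  thus "\<forall>\<^sub>F r in at_left 1. r *\<^sub>R \<zeta> \<in> unit_ball \<and> r *\<^sub>R \<zeta> \<noteq> \<zeta>"
  proof eventually_elim
    case (elim r)
    hence nr: "norm (r *\<^sub>R \<zeta>) = r" using assms by simp
    have "r *\<^sub>R \<zeta> \<noteq> \<zeta>"
    proof
      assume "r *\<^sub>R \<zeta> = \<zeta>"
      thus False using nr elim assms by simp
    qed
    thus ?case using nr elim by simp
  qed
  have "((\<lambda>r. r *\<^sub>R \<zeta>) \<longlongrightarrow> 1 *\<^sub>R \<zeta>) (at_left 1)" by (intro tendsto_intros)
  thus "((\<lambda>r. r *\<^sub>R \<zeta>) \<longlongrightarrow> \<zeta>) (at_left 1)" by simp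
qed

text \<open>A lower limit over unrestricted approach yields lower bounds on radii at once. It yields
  no upper bounds there; those come from \<open>Julia_radial\<close>.\<close>

lemma dil_coeff_less_imp_eventually:
  assumes "ereal y < dil_coeff \<phi> \<zeta>" and "norm \<zeta> = 1"
  shows "\<forall>\<^sub>F r in at_left 1. y < (1 - norm (\<phi> (r *\<^sub>R \<zeta>))) / (1 - r)"
proof -
  have "\<forall>\<^sub>F z in at \<zeta> within unit_ball. ereal y < ereal ((1 - norm (\<phi> z)) / (1 - norm z))"
    using assms(1) unfolding dil_coeff_def by (auto dest: less_LiminfD)
  hence "\<forall>\<^sub>F r in at_left 1. ereal y < ereal ((1 - norm (\<phi> (r *\<^sub>R \<zeta>))) / (1 - norm (r *\<^sub>R \<zeta>)))"
    using filterlim_radial[OF assms(2)] by (auto simp: filterlim_iff)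
  moreover have "eventually (\<lambda>r. r \<in> {0<..<1::real}) (at_left 1)"
    by (rule eventually_at_leftI[of 0]) auto
  ultimately show ?thesis by eventually_elim (use assms(2) in simp)
qed

lemma dil_coeff_nonneg:
  assumes "analytic_self_map \<phi>"
  shows "0 \<le> dil_coeff \<phi> \<zeta>"
  unfolding dil_coeff_def
proof (rule Liminf_bounded)
  have "0 \<le> ereal ((1 - norm (\<phi> z)) / (1 - norm z))" if "z \<in> unit_ball" for z
    using analytic_self_map_norm_less[OF assms, of z] that by simp
  thus "\<forall>\<^sub>F z in at \<zeta> within unit_ball. 0 \<le> ereal ((1 - norm (\<phi> z)) / (1 - norm z))"
    unfolding eventually_at by (intro exI[of _ 1]) simp
qed

text \<open>The radius to \<zeta> is itself a restricted curve, and along it the modulus of the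
  quotient dominates (1 - |\<phi>|)/(1 - r), since |<\<phi>, \<eta>>| \<le> |\<phi>|. The latter
  therefore stays bounded, and the lower limit is finite.\<close>

lemma finite_angular_derivative_imp_dil_coeff:
  assumes fad: "finite_angular_derivative \<phi> \<zeta>" and \<zeta>: "norm \<zeta> = 1"
  shows "dil_coeff \<phi> \<zeta> < \<infinity>"
proof -
  obtain \<eta> L where \<eta>: "norm \<eta> = 1" and
    lim: "has_restricted_limit (\<lambda>z. hinner (\<eta> - \<phi> z) \<eta> / hinner (\<zeta> - z) \<zeta>) L \<zeta>"
    using fad unfolding finite_angular_derivative_def by auto
  have h1: "hinner \<zeta> \<zeta> = 1" "hinner \<eta> \<eta> = 1" using \<zeta> \<eta> by (auto simp: hinner_self)
  have curve: "restricted_curve (\<lambda>t. t *\<^sub>R \<zeta>) \<zeta>"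
    unfolding restricted_curve_def Let_def
  proof (intro conjI)
    \<comment> \<open>On the radius the projection \<gamma> equals \<Gamma>, so the first quotient
      vanishes and the second equals 1.\<close>
    have e: "hinner (t *\<^sub>R \<zeta>) \<zeta> *s \<zeta> = t *\<^sub>R \<zeta>" for t
      unfolding hinner_scaleR_left h1 by (simp add: scaleR_eq_smult)
    show "continuous_on {0..<1} (\<lambda>t. t *\<^sub>R \<zeta>)" by (intro continuous_intros)
    show "(\<lambda>t. t *\<^sub>R \<zeta>) ` {0..<1} \<subseteq> unit_ball" using \<zeta> by auto
    show "((\<lambda>t. t *\<^sub>R \<zeta>) \<longlongrightarrow> \<zeta>) (at_left 1)"
      using filterlim_radial[OF \<zeta>] unfolding filterlim_at by blast
    show "((\<lambda>t. (norm (t *\<^sub>R \<zeta> - hinner (t *\<^sub>R \<zeta>) \<zeta> *s \<zeta>))\<^sup>2 / (1 - (norm (hinner (t *\<^sub>R \<zeta>) \<zeta> *s \<zeta>))\<^sup>2))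
       \<longlongrightarrow> 0) (at_left 1)" unfolding e by simp
    show "\<exists>M. \<forall>t\<in>{0..<1}. norm (hinner (t *\<^sub>R \<zeta>) \<zeta> *s \<zeta> - \<zeta>) / (1 - norm (hinner (t *\<^sub>R \<zeta>) \<zeta> *s \<zeta>)) \<le> M"
    proof (intro exI ballI)
      fix t :: real assume t: "t \<in> {0..<1}"
      have "t *\<^sub>R \<zeta> - \<zeta> = (t - 1) *\<^sub>R \<zeta>" by (simp add: algebra_simps)
      hence "norm (t *\<^sub>R \<zeta> - \<zeta>) = 1 - t" using t \<zeta> by simp
      thus "norm (hinner (t *\<^sub>R \<zeta>) \<zeta> *s \<zeta> - \<zeta>) / (1 - norm (hinner (t *\<^sub>R \<zeta>) \<zeta> *s \<zeta>)) \<le> 1"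
        unfolding e using t \<zeta> by simp
    qed
  qed
  hence "((\<lambda>t. hinner (\<eta> - \<phi> (t *\<^sub>R \<zeta>)) \<eta> / hinner (\<zeta> - t *\<^sub>R \<zeta>) \<zeta>) \<longlongrightarrow> L) (at_left 1)"
    using lim unfolding has_restricted_limit_def by blast
  hence "((\<lambda>t. cmod (hinner (\<eta> - \<phi> (t *\<^sub>R \<zeta>)) \<eta> / hinner (\<zeta> - t *\<^sub>R \<zeta>) \<zeta>)) \<longlongrightarrow> cmod L) (at_left 1)"
    by (rule tendsto_norm)
  hence ev: "\<forall>\<^sub>F t in at_left 1. cmod (hinner (\<eta> - \<phi> (t *\<^sub>R \<zeta>)) \<eta> / hinner (\<zeta> - t *\<^sub>R \<zeta>) \<zeta>) < cmod L + 1"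
    by (rule order_tendstoD) simp
  have evr: "eventually (\<lambda>r. r \<in> {0<..<1::real}) (at_left 1)"
    by (rule eventually_at_leftI[of 0]) auto
  have ev2: "\<forall>\<^sub>F t in at_left 1. (1 - norm (\<phi> (t *\<^sub>R \<zeta>))) / (1 - t) < cmod L + 1"
    using ev evr
  proof eventually_elim
    case (elim t)
    have "hinner (\<zeta> - t *\<^sub>R \<zeta>) \<zeta> = of_real (1 - t)"
      by (simp add: hinner_diff_left hinner_scaleR_left h1)
    hence "cmod (hinner (\<eta> - \<phi> (t *\<^sub>R \<zeta>)) \<eta>) / (1 - t) < cmod L + 1"
      using elim by (simp add: norm_divide del: of_real_diff)
    moreover have "1 - norm (\<phi> (t *\<^sub>R \<zeta>)) \<le> cmod (hinner (\<eta> - \<phi> (t *\<^sub>R \<zeta>)) \<eta>)"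
      using cmod_hinner_le[of "\<phi> (t *\<^sub>R \<zeta>)" \<eta>] norm_triangle_ineq2[of 1 "hinner (\<phi> (t *\<^sub>R \<zeta>)) \<eta>"] \<eta>
      by (simp add: hinner_diff_left h1)
    hence "(1 - norm (\<phi> (t *\<^sub>R \<zeta>))) / (1 - t) \<le> cmod (hinner (\<eta> - \<phi> (t *\<^sub>R \<zeta>)) \<eta>) / (1 - t)"
      using elim by (intro divide_right_mono) auto
    ultimately show ?case by linarith
  qed
  show ?thesis
  proof (rule ccontr)
    assume "\<not> dil_coeff \<phi> \<zeta> < \<infinity>"
    hence "ereal (cmod L + 1) < dil_coeff \<phi> \<zeta>" by simp
    from dil_coeff_less_imp_eventually[OF this \<zeta>] ev2 have "\<forall>\<^sub>F t in at_left (1::real). False"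
      by eventually_elim linarith
    thus False by simp
  qed
qed

text \<open>If no such point existed for some n, the quotient would be at least d + 1/(n+1) near
  \<zeta>, and so would its lower limit. The points may approach \<zeta> in any manner.\<close>

lemma dil_coeff_sequence:
  assumes "dil_coeff \<phi> \<zeta> = ereal d"
  obtains z where "\<And>n. z n \<in> unit_ball" "z \<longlonglongrightarrow> \<zeta>"
    "\<And>n. (1 - norm (\<phi> (z n))) / (1 - norm (z n)) < d + 1 / real (Suc n)"
proof -
  have "\<exists>x. x \<in> unit_ball \<and> dist x \<zeta> < 1 / real (Suc n) \<and>
      (1 - norm (\<phi> x)) / (1 - norm x) < d + 1 / real (Suc n)" for n
  proof (rule ccontr)
    assume neg: "\<not> ?thesis"
    have "\<forall>\<^sub>F x in at \<zeta> within unit_ball. ereal (d + 1 / real (Suc n)) \<le> ereal ((1 - norm (\<phi> x)) / (1 - norm x))"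
      unfolding eventually_at
    proof (intro exI[of _ "1 / real (Suc n)"] conjI ballI impI)
      fix x assume "x \<in> unit_ball" "x \<noteq> \<zeta> \<and> dist x \<zeta> < 1 / real (Suc n)"
      hence "\<not> (1 - norm (\<phi> x)) / (1 - norm x) < d + 1 / real (Suc n)" using neg by blast
      thus "ereal (d + 1 / real (Suc n)) \<le> ereal ((1 - norm (\<phi> x)) / (1 - norm x))" by simp
    qed simp
    hence "ereal (d + 1 / real (Suc n)) \<le> dil_coeff \<phi> \<zeta>"
      unfolding dil_coeff_def by (rule Liminf_bounded)
    thus False using assms by simp
  qed
  hence "\<forall>n. \<exists>x. x \<in> unit_ball \<and> dist x \<zeta> < 1 / real (Suc n) \<and>
      (1 - norm (\<phi> x)) / (1 - norm x) < d + 1 / real (Suc n)" by blast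
  from choice[OF this] obtain z where z: "\<And>n. z n \<in> unit_ball" "\<And>n. dist (z n) \<zeta> < 1 / real (Suc n)"
      "\<And>n. (1 - norm (\<phi> (z n))) / (1 - norm (z n)) < d + 1 / real (Suc n)" by blast
  have "(\<lambda>n. dist (z n) \<zeta>) \<longlonglongrightarrow> 0"
  proof (rule tendsto_sandwich[OF _ _ tendsto_const])
    show "\<forall>\<^sub>F n in sequentially. 0 \<le> dist (z n) \<zeta>" by simp
    show "\<forall>\<^sub>F n in sequentially. dist (z n) \<zeta> \<le> 1 / real (Suc n)"
      using z(2) by (intro always_eventually allI less_imp_le)
    show "(\<lambda>n. 1 / real (Suc n)) \<longlonglongrightarrow> 0"
      using LIMSEQ_inverse_real_of_nat by (simp only: inverse_eq_divide)
  qed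
  hence "z \<longlonglongrightarrow> \<zeta>" by (rule tendsto_dist_iff[THEN iffD2])
  from that[OF z(1) this z(3)] show thesis .
qed

text \<open>Julia's lemma at the points of a radius. Schwarz-Pick is applied between r\<zeta> and
  points \<open>y n\<close> that realise the lower limit, and n tends to infinity. The resulting
  bound 2d(1 - r)/(1 + r) for |1 - <\<phi>(r\<zeta>), \<eta>>| is asymptotically d(1 - r), which is
  the sharpness needed to identify the limit of the difference quotient.\<close>

lemma Julia_radial:
  fixes \<phi> :: "complex ^ 'n \<Rightarrow> complex ^ 'n"
  assumes \<phi>: "analytic_self_map \<phi>" and \<zeta>: "norm \<zeta> = 1" and d: "dil_coeff \<phi> \<zeta> = ereal d"
  obtains \<eta> where "norm \<eta> = 1"
    "\<And>r. 0 < r \<Longrightarrow> r < 1 \<Longrightarrow> cmod (1 - hinner (\<phi> (r *\<^sub>R \<zeta>)) \<eta>) * (1 + r) \<le> 2 * d * (1 - r)"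
proof -
  have d0: "d \<ge> 0" using dil_coeff_nonneg[OF \<phi>, of \<zeta>] d by simp
  note self = analytic_self_map_norm_less[OF \<phi>]
  obtain z where z: "\<And>n. z n \<in> unit_ball" "z \<longlonglongrightarrow> \<zeta>"
    and zq: "\<And>n. (1 - norm (\<phi> (z n))) / (1 - norm (z n)) < d + 1 / real (Suc n)"
    using dil_coeff_sequence[OF d] by blast
  \<comment> \<open>The boundary value \<eta> is found as a cluster point of the images;
    \<open>nulim\<close> will put it on the sphere.\<close>
  have "compact (cball (0::complex^'n) 1)" by simp
  moreover have "\<forall>n. \<phi> (z n) \<in> cball 0 1" using self z(1) by (auto intro: less_imp_le)
  ultimately obtain \<eta> k where k: "strict_mono (k::nat\<Rightarrow>nat)" and lim\<eta>: "((\<lambda>n. \<phi> (z n)) \<circ> k) \<longlonglongrightarrow> \<eta>"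
    unfolding compact_def by metis
  define y where "y = (\<lambda>n. z (k n))"
  define u where "u = (\<lambda>n. \<phi> (y n))"
  have y1: "norm (y n) < 1" for n using z(1)[of "k n"] by (simp add: y_def)
  have u1: "norm (u n) < 1" for n using self[OF y1] by (simp add: u_def)
  have ylim: "y \<longlonglongrightarrow> \<zeta>" unfolding y_def using LIMSEQ_subseq_LIMSEQ[OF z(2) k] by (simp add: o_def)
  have ulim: "u \<longlonglongrightarrow> \<eta>" using lim\<eta> by (simp add: u_def y_def o_def)
  define q where "q = (\<lambda>n. d + 1 / real (Suc (k n)))"
  have "(\<lambda>n. 1 / real (Suc n)) \<longlonglongrightarrow> 0" using LIMSEQ_inverse_real_of_nat by (simp add: inverse_eq_divide)
  hence "(\<lambda>n. 1 / real (Suc (k n))) \<longlonglongrightarrow> 0" using LIMSEQ_subseq_LIMSEQ[OF _ k] by (fastforce simp: o_def)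
  hence qlim: "q \<longlonglongrightarrow> d" unfolding q_def using tendsto_add[OF tendsto_const, of _ 0 sequentially d] by simp
  have uq: "1 - norm (u n) \<le> q n * (1 - norm (y n))" for n
    using zq[of "k n"] y1[of n] unfolding u_def y_def q_def by (simp add: divide_less_eq)
  have nylim: "(\<lambda>n. norm (y n)) \<longlonglongrightarrow> 1" using tendsto_norm[OF ylim] \<zeta> by simp
  have nulim: "(\<lambda>n. norm (u n)) \<longlonglongrightarrow> 1"
  proof (rule tendsto_sandwich)
    have "(\<lambda>n. 1 - q n * (1 - norm (y n))) \<longlonglongrightarrow> 1 - d * (1 - 1)"
      by (intro tendsto_intros qlim nylim)
    thus "(\<lambda>n. 1 - q n * (1 - norm (y n))) \<longlonglongrightarrow> 1" by simp
    show "\<forall>\<^sub>F n in sequentially. 1 - q n * (1 - norm (y n)) \<le> norm (u n)"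
      using uq by (intro always_eventually allI) (simp add: algebra_simps)
    show "\<forall>\<^sub>F n in sequentially. norm (u n) \<le> 1" using u1 by (intro always_eventually) (auto intro: less_imp_le)
  qed simp
  have \<eta>: "norm \<eta> = 1" using LIMSEQ_unique[OF tendsto_norm[OF ulim] nulim] .
  \<comment> \<open>Projecting on the direction of \<open>u n\<close> itself rather than on \<eta>
    gives |F(y n)| = |u n| exactly, so that \<open>uq\<close> controls 1 - |F(y n)|^2. If
    \<open>u n\<close> = 0 then 1/0 = 0 gives \<open>v n\<close> = 0, and \<open>v1\<close> and
    \<open>uv\<close> still hold.\<close>
  define v where "v = (\<lambda>n. (1 / norm (u n)) *\<^sub>R u n)"
  have vlim: "v \<longlonglongrightarrow> \<eta>"
  proof -
    have "v \<longlonglongrightarrow> (1 / 1) *\<^sub>R \<eta>" unfolding v_def by (intro tendsto_intros nulim ulim) simp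
    thus ?thesis by simp
  qed
  have v1: "norm (v n) \<le> 1" for n by (simp add: v_def)
  have uv: "hinner (u n) (v n) = of_real (norm (u n))" for n
    by (simp add: v_def hinner_scaleR_right hinner_self power2_eq_square)
  have main: "cmod (1 - hinner (\<phi> (r *\<^sub>R \<zeta>)) \<eta>) * (1 + r) \<le> 2 * d * (1 - r)" if r: "0 < r" "r < 1" for r
  proof -
    define x where "x = \<phi> (r *\<^sub>R \<zeta>)"
    have rz: "norm (r *\<^sub>R \<zeta>) < 1" using r \<zeta> by simp
    have x1: "norm x < 1" using self[OF rz] by (simp add: x_def)
    have sp: "(cmod (1 - of_real (norm (u n)) * hinner x (v n)))\<^sup>2 * (1 - r\<^sup>2) * (1 + norm (y n))
        \<le> (cmod (1 - hinner (r *\<^sub>R \<zeta>) (y n)))\<^sup>2 * (1 - (cmod (hinner x (v n)))\<^sup>2) * (2 * q n)" for n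
    proof -
      define F where "F = (\<lambda>z. hinner (\<phi> z) (v n))"
      have F: "holomorphic_on_ball F"
        unfolding F_def using \<phi> by (intro holomorphic_on_ball_hinner) (simp add: analytic_self_map_def)
      have F1: "cmod (F z) < 1" if "z \<in> unit_ball" for z
      proof -
        have "cmod (F z) \<le> norm (\<phi> z) * norm (v n)" unfolding F_def by (rule cmod_hinner_le)
        also have "\<dots> \<le> norm (\<phi> z)" using v1 by (simp add: mult_left_le)
        also have "\<dots> < 1" using self that by simp
        finally show ?thesis .
      qed
      have Fy: "F (y n) = of_real (norm (u n))" unfolding F_def using uv by (simp add: u_def)
      have Fx: "F (r *\<^sub>R \<zeta>) = hinner x (v n)" by (simp add: F_def x_def)
      have nr: "norm (r *\<^sub>R \<zeta>) = r" using r \<zeta> by simp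
      have "(cmod (1 - cnj (F (y n)) * F (r *\<^sub>R \<zeta>)))\<^sup>2 * ((1 - (norm (r *\<^sub>R \<zeta>))\<^sup>2) * (1 - (norm (y n))\<^sup>2))
         \<le> (cmod (1 - hinner (r *\<^sub>R \<zeta>) (y n)))\<^sup>2 * ((1 - (cmod (F (r *\<^sub>R \<zeta>)))\<^sup>2) * (1 - (cmod (F (y n)))\<^sup>2))"
        by (rule Schwarz_Pick_ball[OF F F1]) (use rz y1 in auto)
      hence 1: "(cmod (1 - of_real (norm (u n)) * hinner x (v n)))\<^sup>2 * ((1 - r\<^sup>2) * (1 - (norm (y n))\<^sup>2))
         \<le> (cmod (1 - hinner (r *\<^sub>R \<zeta>) (y n)))\<^sup>2 * ((1 - (cmod (hinner x (v n)))\<^sup>2) * (1 - (norm (u n))\<^sup>2))"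
        unfolding Fy Fx nr by simp
      have "1 - (norm (u n))\<^sup>2 = (1 - norm (u n)) * (1 + norm (u n))" by (simp add: power2_eq_square algebra_simps)
      also have "\<dots> \<le> (q n * (1 - norm (y n))) * 2"
        using uq[of n] u1[of n] by (intro mult_mono) auto
      finally have 2: "1 - (norm (u n))\<^sup>2 \<le> (1 - norm (y n)) * (2 * q n)" by (simp add: mult_ac)
      have 3: "0 \<le> (cmod (1 - hinner (r *\<^sub>R \<zeta>) (y n)))\<^sup>2 * (1 - (cmod (hinner x (v n)))\<^sup>2)"
        using F1[of "r *\<^sub>R \<zeta>"] rz Fx by (intro mult_nonneg_nonneg) (auto simp: abs_square_le_1 less_imp_le)
      \<comment> \<open>Without splitting off and cancelling 1 - |y n|, which tends to 0, the
        inequality would only say 0 \<le> 0 in the limit.\<close>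
      have "((cmod (1 - of_real (norm (u n)) * hinner x (v n)))\<^sup>2 * (1 - r\<^sup>2) * (1 + norm (y n))) * (1 - norm (y n))
        = (cmod (1 - of_real (norm (u n)) * hinner x (v n)))\<^sup>2 * ((1 - r\<^sup>2) * (1 - (norm (y n))\<^sup>2))"
        by (simp add: power2_eq_square algebra_simps)
      also have "\<dots> \<le> ((cmod (1 - hinner (r *\<^sub>R \<zeta>) (y n)))\<^sup>2 * (1 - (cmod (hinner x (v n)))\<^sup>2)) * (1 - (norm (u n))\<^sup>2)"
        using 1 by (simp add: mult.assoc)
      also have "\<dots> \<le> ((cmod (1 - hinner (r *\<^sub>R \<zeta>) (y n)))\<^sup>2 * (1 - (cmod (hinner x (v n)))\<^sup>2)) * ((1 - norm (y n)) * (2 * q n))"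
        by (rule mult_left_mono[OF 2 3])
      also have "\<dots> = ((cmod (1 - hinner (r *\<^sub>R \<zeta>) (y n)))\<^sup>2 * (1 - (cmod (hinner x (v n)))\<^sup>2) * (2 * q n)) * (1 - norm (y n))"
        by simp
      finally show ?thesis by (rule mult_right_le_imp_le) (use y1[of n] in simp)
    qed
    define a where "a = hinner x \<eta>"
    have "(\<lambda>n. (cmod (1 - of_real (norm (u n)) * hinner x (v n)))\<^sup>2 * (1 - r\<^sup>2) * (1 + norm (y n)))
        \<longlonglongrightarrow> (cmod (1 - of_real 1 * hinner x \<eta>))\<^sup>2 * (1 - r\<^sup>2) * (1 + 1)"
      by (intro tendsto_intros nulim vlim nylim)
    moreover have "(\<lambda>n. (cmod (1 - hinner (r *\<^sub>R \<zeta>) (y n)))\<^sup>2 * (1 - (cmod (hinner x (v n)))\<^sup>2) * (2 * q n))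
        \<longlonglongrightarrow> (cmod (1 - hinner (r *\<^sub>R \<zeta>) \<zeta>))\<^sup>2 * (1 - (cmod (hinner x \<eta>))\<^sup>2) * (2 * d)"
      by (intro tendsto_intros vlim ylim qlim)
    ultimately have "(cmod (1 - of_real 1 * hinner x \<eta>))\<^sup>2 * (1 - r\<^sup>2) * (1 + 1)
        \<le> (cmod (1 - hinner (r *\<^sub>R \<zeta>) \<zeta>))\<^sup>2 * (1 - (cmod (hinner x \<eta>))\<^sup>2) * (2 * d)"
      by (rule LIMSEQ_le) (use sp in blast)
    moreover have "1 - hinner (r *\<^sub>R \<zeta>) \<zeta> = of_real (1 - r)" using \<zeta> by (simp add: hinner_scaleR_left hinner_self)
    hence "cmod (1 - hinner (r *\<^sub>R \<zeta>) \<zeta>) = 1 - r" using r by (simp only: norm_of_real abs_of_pos diff_gt_0_iff_gt)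
    ultimately have le: "(cmod (1 - a))\<^sup>2 * (1 - r\<^sup>2) * (1 + 1) \<le> (1 - r)\<^sup>2 * (1 - (cmod a)\<^sup>2) * (2 * d)"
      by (simp only: a_def of_real_1 mult_1_left)
    have alg: "A * (1 - r\<^sup>2) * (1 + 1) = (A * (1 + r)) * (2 * (1 - r))"
       "(1 - r)\<^sup>2 * B * (2 * d) = (d * (1 - r) * B) * (2 * (1 - r))" for A B :: real
      by (simp_all add: power2_eq_square algebra_simps)
    have "((cmod (1 - a))\<^sup>2 * (1 + r)) * (2 * (1 - r)) \<le> (d * (1 - r) * (1 - (cmod a)\<^sup>2)) * (2 * (1 - r))"
      using le unfolding alg .
    hence 4: "(cmod (1 - a))\<^sup>2 * (1 + r) \<le> d * (1 - r) * (1 - (cmod a)\<^sup>2)"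
      by (rule mult_right_le_imp_le) (use r in simp)
    \<comment> \<open>The bound 1 - |a|^2 \<le> 2|1 - a| lets one factor |1 - a| be cancelled, which
      turns Julia's quadratic inequality into a linear one.\<close>
    have "cmod a \<le> 1" using cmod_hinner_le[of x \<eta>] x1 \<eta> by (simp add: a_def)
    moreover have "1 - cmod a \<le> cmod (1 - a)" using norm_triangle_ineq2[of 1 a] by simp
    ultimately have "1 - (cmod a)\<^sup>2 \<le> cmod (1 - a) * 2"
    proof -
      assume le: "cmod a \<le> 1" "1 - cmod a \<le> cmod (1 - a)"
      have "1 - (cmod a)\<^sup>2 = (1 - cmod a) * (1 + cmod a)" by (simp add: power2_eq_square algebra_simps)
      also have "\<dots> \<le> cmod (1 - a) * 2" using le by (intro mult_mono) auto
      finally show ?thesis .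
    qed
    hence "d * (1 - r) * (1 - (cmod a)\<^sup>2) \<le> d * (1 - r) * (cmod (1 - a) * 2)"
      using d0 r by (intro mult_left_mono) auto
    with 4 have 5: "cmod (1 - a) * (cmod (1 - a) * (1 + r)) \<le> cmod (1 - a) * (2 * d * (1 - r))"
      by (simp only: power2_eq_square mult_ac)
    have "cmod (1 - a) * (1 + r) \<le> 2 * d * (1 - r)"
    proof (cases "cmod (1 - a) = 0")
      case True thus ?thesis using d0 r by simp
    next
      case False thus ?thesis using 5 mult_le_cancel_left_pos[of "cmod (1-a)"] by simp
    qed
    thus ?thesis by (simp add: a_def x_def)
  qed
  show thesis using that[OF \<eta> main] .
qed

text \<open>Let q be the difference quotient. Julia's lemma gives limsup |q| \<le> d, and Re q \<ge>
  (1 - |\<phi>|)/(1 - r) gives liminf Re q \<ge> d because d is a lower limit. Hence |q - d|^2 =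
  |q|^2 - 2d Re q + d^2 tends to 0. Convergence to \<eta> follows from |\<phi>(r\<zeta>) - \<eta>|^2
  \<le> 2(1 - r) Re q.\<close>

lemma Julia_Caratheodory_radial:
  fixes \<phi> :: "complex ^ 'n \<Rightarrow> complex ^ 'n"
  assumes \<phi>: "analytic_self_map \<phi>" and \<zeta>: "norm \<zeta> = 1" and d: "dil_coeff \<phi> \<zeta> = ereal d"
  obtains \<eta> where "norm \<eta> = 1" "((\<lambda>r. \<phi> (r *\<^sub>R \<zeta>)) \<longlongrightarrow> \<eta>) (at_left 1)"
    "((\<lambda>r. (1 - hinner (\<phi> (r *\<^sub>R \<zeta>)) \<eta>) / of_real (1 - r)) \<longlongrightarrow> of_real d) (at_left 1)"
proof -
  have d0: "d \<ge> 0" using dil_coeff_nonneg[OF \<phi>, of \<zeta>] d by simp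
  note self = analytic_self_map_norm_less[OF \<phi>]
  obtain \<eta> where \<eta>: "norm \<eta> = 1" and
    J: "\<And>r. 0 < r \<Longrightarrow> r < 1 \<Longrightarrow> cmod (1 - hinner (\<phi> (r *\<^sub>R \<zeta>)) \<eta>) * (1 + r) \<le> 2 * d * (1 - r)"
    using Julia_radial[OF assms] by blast
  define a where "a = (\<lambda>r. hinner (\<phi> (r *\<^sub>R \<zeta>)) \<eta>)"
  define q where "q = (\<lambda>r. (1 - a r) / of_real (1 - r))"
  have evr: "eventually (\<lambda>r. r \<in> {0<..<1::real}) (at_left 1)"
    by (rule eventually_at_leftI[of 0]) auto
  have qle: "cmod (q r) \<le> 2 * d / (1 + r)" if "r \<in> {0<..<1}" for r
  proof -
    have "cmod (q r) = cmod (1 - a r) / (1 - r)" using that by (simp add: q_def norm_divide del: of_real_diff)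
    moreover have "cmod (1 - a r) * (1 + r) \<le> 2 * d * (1 - r)" using J[of r] that by (simp add: a_def)
    ultimately show ?thesis using that by (simp add: pos_divide_le_eq pos_le_divide_eq)
  qed
  have qge: "(1 - norm (\<phi> (r *\<^sub>R \<zeta>))) / (1 - r) \<le> Re (q r)" if "r \<in> {0<..<1}" for r
  proof -
    have "Re (a r) \<le> norm (\<phi> (r *\<^sub>R \<zeta>))"
      using complex_Re_le_cmod[of "a r"] cmod_hinner_le[of "\<phi> (r *\<^sub>R \<zeta>)" \<eta>] \<eta> by (simp add: a_def)
    hence "(1 - norm (\<phi> (r *\<^sub>R \<zeta>))) / (1 - r) \<le> (1 - Re (a r)) / (1 - r)"
      using that by (intro divide_right_mono) auto
    also have "\<dots> = Re (q r)" by (simp add: q_def Re_divide_of_real del: of_real_diff)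
    finally show ?thesis .
  qed
  have blim: "((\<lambda>r. 2 * d / (1 + r)) \<longlongrightarrow> d) (at_left 1)"
  proof -
    have "((\<lambda>r. 2 * d / (1 + r)) \<longlongrightarrow> 2 * d / (1 + 1)) (at_left 1)" by (intro tendsto_intros) auto
    thus ?thesis by simp
  qed
  have Relim: "((\<lambda>r. Re (q r)) \<longlongrightarrow> d) (at_left 1)"
  proof (rule order_tendstoI)
    fix y assume "y < d"
    hence "ereal y < dil_coeff \<phi> \<zeta>" using d by simp
    from dil_coeff_less_imp_eventually[OF this \<zeta>] evr
    show "\<forall>\<^sub>F r in at_left 1. y < Re (q r)" by eventually_elim (use qge in fastforce)
  next
    fix y assume "d < y"
    from order_tendstoD(2)[OF blim this] evr
    show "\<forall>\<^sub>F r in at_left 1. Re (q r) < y"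
    proof eventually_elim
      case (elim r)
      thus ?case using qle[of r] complex_Re_le_cmod[of "q r"] by simp
    qed
  qed
  have qlim: "(q \<longlongrightarrow> of_real d) (at_left 1)"
  proof -
    have "((\<lambda>r. (cmod (q r - of_real d))\<^sup>2) \<longlongrightarrow> 0) (at_left 1)"
    proof (rule tendsto_sandwich)
      show "\<forall>\<^sub>F r in at_left 1. 0 \<le> (cmod (q r - of_real d))\<^sup>2" by simp
      show "\<forall>\<^sub>F r in at_left 1. (cmod (q r - of_real d))\<^sup>2 \<le> (2 * d / (1 + r))\<^sup>2 - 2 * d * Re (q r) + d\<^sup>2"
        using evr
      proof eventually_elim
        case (elim r)
        have "(cmod (q r - of_real d))\<^sup>2 = (cmod (q r))\<^sup>2 - 2 * d * Re (q r) + d\<^sup>2"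
          unfolding cmod_power2 by (simp add: power2_eq_square algebra_simps)
        moreover have "(cmod (q r))\<^sup>2 \<le> (2 * d / (1 + r))\<^sup>2" using qle[OF elim] by (intro power_mono) auto
        ultimately show ?case by simp
      qed
      have "((\<lambda>r. (2 * d / (1 + r))\<^sup>2 - 2 * d * Re (q r) + d\<^sup>2) \<longlongrightarrow> d\<^sup>2 - 2 * d * d + d\<^sup>2) (at_left 1)"
        by (intro tendsto_intros blim Relim)
      thus "((\<lambda>r. (2 * d / (1 + r))\<^sup>2 - 2 * d * Re (q r) + d\<^sup>2) \<longlongrightarrow> 0) (at_left 1)"
        by (simp add: power2_eq_square)
    qed simp
    hence "((\<lambda>r. sqrt ((cmod (q r - of_real d))\<^sup>2)) \<longlongrightarrow> sqrt 0) (at_left 1)" by (rule tendsto_real_sqrt)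
    hence "((\<lambda>r. cmod (q r - of_real d)) \<longlongrightarrow> 0) (at_left 1)" by simp
    from LIM_zero_cancel[OF tendsto_norm_zero_cancel[OF this]] show ?thesis .
  qed
  have "((\<lambda>r. (norm (\<phi> (r *\<^sub>R \<zeta>) - \<eta>))\<^sup>2) \<longlongrightarrow> 0) (at_left 1)"
  proof (rule tendsto_sandwich)
    show "\<forall>\<^sub>F r in at_left 1. 0 \<le> (norm (\<phi> (r *\<^sub>R \<zeta>) - \<eta>))\<^sup>2" by simp
    show "\<forall>\<^sub>F r in at_left 1. (norm (\<phi> (r *\<^sub>R \<zeta>) - \<eta>))\<^sup>2 \<le> 2 * (Re (q r) * (1 - r))"
      using evr
    proof eventually_elim
      case (elim r)
      have "norm (\<phi> (r *\<^sub>R \<zeta>)) < 1" using self[of "r *\<^sub>R \<zeta>"] elim \<zeta> by simp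
      hence "(norm (\<phi> (r *\<^sub>R \<zeta>)))\<^sup>2 \<le> 1" by (simp add: abs_square_le_1)
      hence "(norm (\<phi> (r *\<^sub>R \<zeta>) - \<eta>))\<^sup>2 \<le> 2 * (1 - Re (a r))"
        using norm_diff_sqr_unit[OF \<eta>, of "\<phi> (r *\<^sub>R \<zeta>)"] by (simp add: a_def)
      also have "1 - Re (a r) = Re (q r) * (1 - r)"
        using elim by (simp add: q_def Re_divide_of_real del: of_real_diff)
      finally show ?case .
    qed
    have "((\<lambda>r. 2 * (Re (q r) * (1 - r))) \<longlongrightarrow> 2 * (d * (1 - 1))) (at_left 1)"
      by (intro tendsto_intros Relim)
    thus "((\<lambda>r. 2 * (Re (q r) * (1 - r))) \<longlongrightarrow> 0) (at_left 1)" by simp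
  qed simp
  hence "((\<lambda>r. sqrt ((norm (\<phi> (r *\<^sub>R \<zeta>) - \<eta>))\<^sup>2)) \<longlongrightarrow> sqrt 0) (at_left 1)" by (rule tendsto_real_sqrt)
  hence "((\<lambda>r. norm (\<phi> (r *\<^sub>R \<zeta>) - \<eta>)) \<longlongrightarrow> 0) (at_left 1)" by simp
  from LIM_zero_cancel[OF tendsto_norm_zero_cancel[OF this]]
  show thesis by (rule that[OF \<eta> _ qlim[unfolded q_def a_def]])
qed

section \<open>Lebesgue measure: isometries and polar coordinates\<close>

lemma nn_integral_lborel_translate:
  fixes f :: "'a::euclidean_space \<Rightarrow> ennreal"
  assumes [measurable]: "f \<in> borel_measurable borel"
  shows "(\<integral>\<^sup>+x. f (c + x) \<partial>lborel) = (\<integral>\<^sup>+x. f x \<partial>lborel)"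
proof -
  have "(\<integral>\<^sup>+x. f x \<partial>lborel) = (\<integral>\<^sup>+x. f x \<partial>distr lborel borel ((+) c))"
    by (simp add: lborel_distr_plus)
  also have "\<dots> = (\<integral>\<^sup>+x. f (c + x) \<partial>lborel)" by (subst nn_integral_distr) auto
  finally show ?thesis ..
qed

lemma nn_integral_lborel_scale:
  fixes f :: "'a::euclidean_space \<Rightarrow> ennreal"
  assumes [measurable]: "f \<in> borel_measurable borel" and "c > 0"
  shows "ennreal (c ^ DIM('a)) * (\<integral>\<^sup>+x. f (c *\<^sub>R x) \<partial>lborel) = (\<integral>\<^sup>+x. f x \<partial>lborel)"
proof -
  have "(\<integral>\<^sup>+x. f x \<partial>lborel) = (\<integral>\<^sup>+x. f x \<partial>density (distr lborel borel (\<lambda>x. 0 + c *\<^sub>R x)) (\<lambda>_. ennreal (\<bar>c\<bar> ^ DIM('a))))"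
    using lborel_affine[of c "0::'a"] \<open>c > 0\<close> by simp
  also have "\<dots> = ennreal (c ^ DIM('a)) * (\<integral>\<^sup>+x. f (c *\<^sub>R x) \<partial>lborel)"
    using \<open>c > 0\<close> by (simp add: nn_integral_density nn_integral_distr nn_integral_cmult)
  finally show ?thesis ..
qed

lemma emeasure_lborel_ball_pos_finite:
  fixes a :: "'a::euclidean_space" and r :: real
  assumes "0 < r"
  shows "0 < emeasure lborel (ball a r)" "emeasure lborel (ball a r) < \<infinity>"
proof -
  have "emeasure lborel (ball a r) \<noteq> 0"
    using negligible_iff_null_sets[of "ball a r"] open_not_negligible[of "ball a r"] assms
    by (auto simp: null_sets_completion_iff null_sets_def)
  thus "0 < emeasure lborel (ball a r)" by (simp add: zero_less_iff_neq_zero)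
  show "emeasure lborel (ball a r) < \<infinity>" by (rule emeasure_bounded_finite) simp
qed

text \<open>Uniqueness of translation-invariant measures, by Fubini: for the image \<open>\<mu>\<close> of Lebesgue
  measure \<open>m\<close> and the unit ball \<open>B\<close>, two translations give \<open>\<mu> A * m B = m A * \<mu> (- B)\<close>.\<close>

lemma nn_integral_lborel_isometry:
  fixes U :: "'a::euclidean_space \<Rightarrow> 'a" and f :: "'a \<Rightarrow> ennreal"
  assumes U: "linear U" and nU: "\<And>x. norm (U x) = norm x"
    and f[measurable]: "f \<in> borel_measurable borel"
  shows "(\<integral>\<^sup>+x. f (U x) \<partial>lborel) = (\<integral>\<^sup>+x. f x \<partial>lborel)"
proof -
  have [measurable]: "U \<in> borel_measurable borel"
    using linear_continuous_on[of U UNIV] U linear_conv_bounded_linear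
    by (intro borel_measurable_continuous_onI) blast
  have "inj U" using U nU by (simp add: linear_injective_0) (metis norm_eq_zero)
  hence "surj U" using linear_injective_imp_surjective U by blast
  then obtain V where V: "\<And>x. U (V x) = x" by (metis surjD)
  define B where "B = ball (0::'a) 1"
  have [measurable]: "B \<in> sets borel" by (simp add: B_def)
  define m where "m = emeasure lborel B"
  have m: "0 < m" "m < \<infinity>" using emeasure_lborel_ball_pos_finite[of 1 "0::'a"] by (auto simp: m_def B_def)
  have ball: "(\<integral>\<^sup>+x. indicator B (y - U x) \<partial>lborel) = m" for y
  proof -
    have "norm (y - U x) = norm (- V y + x)" for x
    proof -
      have "y - U x = U (V y - x)" by (simp add: linear_diff[OF U] V)
      thus ?thesis by (simp add: nU norm_minus_commute)
    qed
    hence "indicator B (y - U x) = (indicator B (- V y + x) :: ennreal)" for x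
      by (simp add: B_def indicator_def)
    hence "(\<integral>\<^sup>+x. indicator B (y - U x) \<partial>lborel) = (\<integral>\<^sup>+x. indicator B (- V y + x) \<partial>lborel)" by simp
    also have "\<dots> = (\<integral>\<^sup>+x. indicator B x \<partial>lborel)" by (rule nn_integral_lborel_translate) simp
    finally show ?thesis by (simp add: m_def)
  qed
  have "(\<integral>\<^sup>+x. f (U x) \<partial>lborel) * m = (\<integral>\<^sup>+y. (\<integral>\<^sup>+x. f (U x) \<partial>lborel) * indicator B y \<partial>lborel)"
    by (simp add: nn_integral_cmult m_def)
  also have "\<dots> = (\<integral>\<^sup>+y. (\<integral>\<^sup>+x. f (U x + y) * indicator B y \<partial>lborel) \<partial>lborel)"
  proof (rule nn_integral_cong)
    fix y :: 'a
    have "(\<integral>\<^sup>+x. f (U x) \<partial>lborel) = (\<integral>\<^sup>+x. f (U (V y + x)) \<partial>lborel)"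
      by (rule nn_integral_lborel_translate[symmetric]) simp
    thus "(\<integral>\<^sup>+x. f (U x) \<partial>lborel) * indicator B y = (\<integral>\<^sup>+x. f (U x + y) * indicator B y \<partial>lborel)"
      by (simp add: linear_add[OF U] V add.commute nn_integral_multc)
  qed
  also have "\<dots> = (\<integral>\<^sup>+x. (\<integral>\<^sup>+y. f (U x + y) * indicator B y \<partial>lborel) \<partial>lborel)"
    by (rule lborel_pair.Fubini') simp
  also have "\<dots> = (\<integral>\<^sup>+x. (\<integral>\<^sup>+y. f y * indicator B (y - U x) \<partial>lborel) \<partial>lborel)"
  proof (rule nn_integral_cong)
    fix x :: 'a
    show "(\<integral>\<^sup>+y. f (U x + y) * indicator B y \<partial>lborel) = (\<integral>\<^sup>+y. f y * indicator B (y - U x) \<partial>lborel)"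
      using nn_integral_lborel_translate[of "\<lambda>y. f y * indicator B (y - U x)" "U x"] by simp
  qed
  also have "\<dots> = (\<integral>\<^sup>+y. (\<integral>\<^sup>+x. f y * indicator B (y - U x) \<partial>lborel) \<partial>lborel)"
    by (rule lborel_pair.Fubini') simp
  also have "\<dots> = (\<integral>\<^sup>+y. f y * m \<partial>lborel)"
    by (intro nn_integral_cong) (simp add: nn_integral_cmult ball)
  also have "\<dots> = (\<integral>\<^sup>+y. f y \<partial>lborel) * m" by (simp add: nn_integral_multc)
  finally show ?thesis using m by (auto simp: ennreal_mult_cancel_left mult.commute[of _ m])
qed

text \<open>The layer-cake form of 1/a^n. In the polar formula it evaluates the integral over an
  auxiliary dilation parameter; in the cap estimate it is read backwards, trading a negative power
  for an integral over t.\<close>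

lemma nn_integral_inverse_power_greaterThan:
  fixes a :: real and n :: nat
  assumes "a > 0" "n > 0"
  shows "(\<integral>\<^sup>+t. ennreal (indicator {a<..} t * (real n / t ^ Suc n)) \<partial>lborel) = ennreal (1 / a ^ n)"
proof -
  have "(\<integral>\<^sup>+t. ennreal (indicator {a<..} t * (real n / t ^ Suc n)) \<partial>lborel)
      = (\<integral>\<^sup>+t. ennreal (real n / t ^ Suc n) * indicator {a..} t \<partial>lborel)"
    by (rule nn_integral_cong_AE, rule AE_mp[OF AE_lborel_singleton[of a]], rule AE_I2)
       (simp split: split_indicator)
  also have "\<dots> = ennreal (0 - (- inverse (a ^ n)))"
  proof (rule nn_integral_FTC_atLeast)
    fix x :: real assume "a \<le> x"
    hence x: "x > 0" using assms by linarith
    obtain k where n: "n = Suc k" using assms(2) by (cases n) auto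
    have "((\<lambda>t. - inverse (t ^ n)) has_real_derivative
        - (- (inverse (x ^ n) * (real n * x ^ (n - Suc 0)) * inverse (x ^ n)))) (at x)"
      by (rule DERIV_minus[OF DERIV_inverse'[OF DERIV_pow]]) (use x in simp)
    moreover have "- (- (inverse (x * y) * (c * y) * inverse (x * y))) = c / (x * (x * y))" if "y \<noteq> 0" for y c :: real
      using x that by (simp add: divide_simps)
    from this[of "x ^ k" "real n"]
    have "- (- (inverse (x ^ n) * (real n * x ^ (n - Suc 0)) * inverse (x ^ n))) = real n / x ^ Suc n"
      using x by (simp add: n)
    ultimately show "((\<lambda>t. - inverse (t ^ n)) has_real_derivative real n / x ^ Suc n) (at x)"
      by (simp only:)
    show "0 \<le> real n / x ^ Suc n" using x by simp
  next
    have "((\<lambda>t::real. inverse (t ^ n)) \<longlongrightarrow> 0) at_top"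
      by (intro tendsto_inverse_0_at_top filterlim_pow_at_top assms(2) filterlim_ident)
    from tendsto_minus[OF this] show "((\<lambda>t::real. - inverse (t ^ n)) \<longlongrightarrow> 0) at_top"
      by (simp only: minus_zero)
  qed simp
  finally show ?thesis by (simp add: inverse_eq_divide)
qed

text \<open>The inner integral over the ball stands for the spherical mean at radius r, since only
  z/|z| enters. Put r = |z| t and then y = t z: the point r z/|z| becomes y, and the remaining
  integral of D/t^(D+1) over t > |y| cancels |y|^D.\<close>

lemma nn_integral_polar:
  fixes h :: "'a::euclidean_space \<Rightarrow> ennreal"
  assumes h[measurable]: "h \<in> borel_measurable borel"
  shows "(\<integral>\<^sup>+z. h z * indicator (ball 0 1) z \<partial>lborel) =
    (\<integral>\<^sup>+r. ennreal (indicator {0<..<1} r * (real DIM('a) * r ^ (DIM('a) - 1))) *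
       (\<integral>\<^sup>+z. h (r *\<^sub>R (z /\<^sub>R norm z)) * indicator (ball 0 1) z \<partial>lborel) \<partial>lborel)"
    (is "?L = ?R")
proof -
  define D where "D = DIM('a)"
  have D: "D > 0" by (simp add: D_def)
  define F where "F = (\<lambda>r. indicator {0<..<1} r * (real D * r ^ (D - 1)))"
  have F0: "F r \<ge> 0" for r by (auto simp: F_def indicator_def)
  have [measurable]: "F \<in> borel_measurable borel" by (simp add: F_def)
  define B where "B = (indicator (ball (0::'a) 1) :: 'a \<Rightarrow> ennreal)"
  have [measurable]: "B \<in> borel_measurable borel" unfolding B_def by (rule borel_measurable_indicator) simp
  have "?R = (\<integral>\<^sup>+r. (\<integral>\<^sup>+z. ennreal (F r) * (h (r *\<^sub>R (z /\<^sub>R norm z)) * B z) \<partial>lborel) \<partial>lborel)"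
    unfolding F_def D_def B_def[symmetric]
    by (intro nn_integral_cong nn_integral_cmult[symmetric]) simp
  also have "\<dots> = (\<integral>\<^sup>+z. (\<integral>\<^sup>+r. ennreal (F r) * (h (r *\<^sub>R (z /\<^sub>R norm z)) * B z) \<partial>lborel) \<partial>lborel)"
    by (rule lborel_pair.Fubini') simp
  also have "\<dots> = (\<integral>\<^sup>+z. (\<integral>\<^sup>+t. ennreal (norm z) * (ennreal (F (norm z * t)) * (h (t *\<^sub>R z) * B z)) \<partial>lborel) \<partial>lborel)"
  proof (rule nn_integral_cong_AE, rule AE_mp[OF AE_lborel_singleton[of 0]], intro AE_I2 impI)
    fix z :: 'a assume z: "z \<noteq> 0"
    hence [simp]: "norm z * t * inverse (norm z) = t" for t by simp
    have "(\<integral>\<^sup>+r. ennreal (F r) * (h (r *\<^sub>R (z /\<^sub>R norm z)) * B z) \<partial>lborel)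
      = norm z * (\<integral>\<^sup>+t. ennreal (F (0 + norm z * t)) * (h ((0 + norm z * t) *\<^sub>R (z /\<^sub>R norm z)) * B z) \<partial>lborel)"
      using z by (subst nn_integral_real_affine[of _ "norm z" 0]) auto
    also have "\<dots> = (\<integral>\<^sup>+t. ennreal (norm z) * (ennreal (F (norm z * t)) * (h (t *\<^sub>R z) * B z)) \<partial>lborel)"
      using z by (simp add: nn_integral_cmult)
    finally show "(\<integral>\<^sup>+r. ennreal (F r) * (h (r *\<^sub>R (z /\<^sub>R norm z)) * B z) \<partial>lborel)
      = (\<integral>\<^sup>+t. ennreal (norm z) * (ennreal (F (norm z * t)) * (h (t *\<^sub>R z) * B z)) \<partial>lborel)" .
  qed
  also have "\<dots> = (\<integral>\<^sup>+t. (\<integral>\<^sup>+z. ennreal (norm z) * (ennreal (F (norm z * t)) * (h (t *\<^sub>R z) * B z)) \<partial>lborel) \<partial>lborel)"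
    by (rule lborel_pair.Fubini') simp
  \<comment> \<open>The substitution y = t z exchanges the two constraints: |z| < 1 becomes t > |y|,
    and |z| t < 1 becomes |y| < 1. The weight |z| D (|z| t)^(D-1), divided by the Jacobian t^D, is D
    |y|^D / t^(D+1).\<close>
  also have "\<dots> = (\<integral>\<^sup>+t. (\<integral>\<^sup>+y. ennreal (indicator {norm y<..} t * (real D / t ^ Suc D)) *
      (ennreal (norm y ^ D) * (indicator (- {0}) y * (h y * B y))) \<partial>lborel) \<partial>lborel)"
  proof (rule nn_integral_cong)
    fix t :: real
    show "(\<integral>\<^sup>+z. ennreal (norm z) * (ennreal (F (norm z * t)) * (h (t *\<^sub>R z) * B z)) \<partial>lborel)
      = (\<integral>\<^sup>+y. ennreal (indicator {norm y<..} t * (real D / t ^ Suc D)) *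
      (ennreal (norm y ^ D) * (indicator (- {0}) y * (h y * B y))) \<partial>lborel)"
    proof (cases "t > 0")
      case False
      have "F (norm z * t) = 0" for z :: 'a
        using False by (auto simp: F_def indicator_def not_less mult_less_0_iff zero_less_mult_iff)
      moreover have "indicator {norm y<..} t = (0::real)" for y :: 'a using False
        by (auto simp: indicator_def not_less) (meson dual_order.trans norm_ge_zero)
      ultimately show ?thesis by simp
    next
      case t: True
      define K where "K = (\<lambda>y. ennreal (indicator {norm y<..} t * (real D / t ^ Suc D)) *
        (ennreal (norm y ^ D) * (indicator (- {0}) y * (h y * B y))))"
      have [measurable]: "K \<in> borel_measurable borel"
        unfolding K_def by (simp add: indicator_def[of "{_<..}"])
      have pt: "ennreal (norm z) * (ennreal (F (norm z * t)) * (h (t *\<^sub>R z) * B z)) = ennreal (t ^ D) * K (t *\<^sub>R z)" for z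
      proof (cases "z \<noteq> 0 \<and> norm z < 1 \<and> t * norm z < 1")
        case True
        have "norm (t *\<^sub>R z) < t" using t True by simp
        hence 1: "K (t *\<^sub>R z) = ennreal (real D / t ^ Suc D) * (ennreal ((t * norm z) ^ D) * h (t *\<^sub>R z))"
          using t True by (simp add: K_def B_def)
        have 2: "F (norm z * t) = real D * (norm z * t) ^ (D - 1)" using True t
          by (simp add: F_def mult.commute)
        obtain k where k: "D = Suc k" using D by (cases D) auto
        have "norm z * (real D * (norm z * t) ^ (D - 1)) = t ^ D * (real D / t ^ Suc D * (t * norm z) ^ D)"
          using t by (simp add: k field_simps)
        hence "ennreal (norm z) * ennreal (real D * (norm z * t) ^ (D - 1)) = ennreal (t ^ D) * (ennreal (real D / t ^ Suc D) * ennreal ((t * norm z) ^ D))"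
          using t by (simp add: ennreal_mult[symmetric])
        thus ?thesis unfolding 1 2 using True by (simp add: B_def mult.assoc[symmetric])
      next
        case False
        show ?thesis
        proof (cases "z = 0")
          case True thus ?thesis by (simp add: K_def)
        next
          case False2: False
          hence "B z = 0 \<or> F (norm z * t) = 0" using False
            by (auto simp: B_def F_def indicator_def mult.commute)
          moreover have "indicator {norm (t *\<^sub>R z)<..} t = (0::real) \<or> B (t *\<^sub>R z) = 0"
            using False False2 t by (auto simp: indicator_def B_def)
          ultimately show ?thesis by (auto simp: K_def)
        qed
      qed
      have "(\<integral>\<^sup>+z. ennreal (norm z) * (ennreal (F (norm z * t)) * (h (t *\<^sub>R z) * B z)) \<partial>lborel)
         = ennreal (t ^ D) * (\<integral>\<^sup>+z. K (t *\<^sub>R z) \<partial>lborel)"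
        unfolding pt by (simp add: nn_integral_cmult)
      also have "\<dots> = (\<integral>\<^sup>+y. K y \<partial>lborel)" unfolding D_def
        by (rule nn_integral_lborel_scale) (use t in auto)
      finally show ?thesis by (simp add: K_def)
    qed
  qed
  also have "\<dots> = (\<integral>\<^sup>+y. (\<integral>\<^sup>+t. ennreal (indicator {norm y<..} t * (real D / t ^ Suc D)) *
      (ennreal (norm y ^ D) * (indicator (- {0}) y * (h y * B y))) \<partial>lborel) \<partial>lborel)"
    by (rule lborel_pair.Fubini') (simp add: indicator_def[of "{_<..}"])
  also have "\<dots> = (\<integral>\<^sup>+y. h y * B y \<partial>lborel)"
  proof (rule nn_integral_cong_AE, rule AE_mp[OF AE_lborel_singleton[of 0]], intro AE_I2 impI)
    fix y :: 'a assume y: "y \<noteq> 0"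
    have "(\<integral>\<^sup>+t. ennreal (indicator {norm y<..} t * (real D / t ^ Suc D)) *
      (ennreal (norm y ^ D) * (indicator (- {0}) y * (h y * B y))) \<partial>lborel)
     = ennreal (1 / norm y ^ D) * (ennreal (norm y ^ D) * (h y * B y))"
      using nn_integral_inverse_power_greaterThan[of "norm y" D] y D
      by (subst nn_integral_multc) (auto simp del: power_Suc)
    also have "ennreal (1 / norm y ^ D) * ennreal (norm y ^ D) = 1"
      using y by (simp add: ennreal_mult[symmetric])
    hence "ennreal (1 / norm y ^ D) * (ennreal (norm y ^ D) * (h y * B y)) = h y * B y"
      by (metis mult.assoc mult_1)
    finally show "(\<integral>\<^sup>+t. ennreal (indicator {norm y<..} t * (real D / t ^ Suc D)) *
      (ennreal (norm y ^ D) * (indicator (- {0}) y * (h y * B y))) \<partial>lborel) = h y * B y" .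
  qed
  finally show ?thesis by (simp add: B_def)
qed

text \<open>A multiplication by a phase followed by a complex Householder reflection that exchanges
  \<eta> with a unimodular multiple of the k-th basis vector. Volume estimates around an arbitrary
  \<eta> thereby reduce to boxes in coordinates.\<close>

lemma exists_isometry_hinner_coordinate:
  fixes \<eta> :: "complex ^ 'n"
  assumes \<eta>: "norm \<eta> = 1"
  obtains V :: "complex ^ 'n \<Rightarrow> complex ^ 'n" where "linear V" "\<And>x. norm (V x) = norm x"
    "\<And>x. hinner (V x) \<eta> = x $ k"
proof -
  \<comment> \<open>The reflection in \<open>u\<close> exchanges \<eta> and \<open>y\<close> only if
    their Hermitian product is real; the phase \<omega> arranges this.\<close>
  define \<omega> where "\<omega> = (if \<eta> $ k = 0 then 1 else \<eta> $ k / of_real (cmod (\<eta> $ k)))"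
  have \<omega>1: "cmod \<omega> = 1" by (simp add: \<omega>_def norm_divide)
  hence \<omega>\<omega>: "\<omega> * cnj \<omega> = 1" by (simp add: complex_norm_square[symmetric])
  define e where "e = (axis k 1 :: complex ^ 'n)"
  define y where "y = \<omega> *s e"
  define u where "u = \<eta> - y"
  have he: "hinner x e = x $ k" for x
    by (simp add: e_def hinner_def axis_def if_distrib[of cnj] if_distrib[of "\<lambda>t. _ * t"] cong: if_cong)
  have hy: "hinner x y = cnj \<omega> * x $ k" for x by (simp add: y_def hinner_smult_right he)
  have \<eta>y: "hinner \<eta> y = of_real (cmod (\<eta> $ k))"
    by (auto simp: hy \<omega>_def complex_norm_square[symmetric] power2_eq_square mult.commute)
  have yy: "hinner y y = 1" using \<omega>\<omega> by (simp add: hy) (simp add: y_def e_def axis_def mult.commute)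
  have \<eta>\<eta>: "hinner \<eta> \<eta> = 1" using \<eta> by (simp add: hinner_self)
  have y\<eta>: "hinner y \<eta> = of_real (cmod (\<eta> $ k))" using \<eta>y by (subst hinner_commute) simp
  have uu: "of_real ((norm u)\<^sup>2) = 2 * hinner u \<eta>"
    unfolding hinner_self[symmetric]
    by (simp add: u_def hinner_diff_left hinner_diff_right \<eta>\<eta> yy \<eta>y y\<eta>)
  define U where "U = (\<lambda>x. x - (2 * hinner x u / of_real ((norm u)\<^sup>2)) *s u)"
  have U\<eta>: "hinner (U x) \<eta> = hinner x y" for x
  proof (cases "u = 0")
    case True thus ?thesis by (simp add: U_def u_def)
  next
    case False
    hence "complex_of_real ((norm u)\<^sup>2) \<noteq> 0" by simp
    hence "hinner u \<eta> \<noteq> 0" unfolding uu by simp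
    hence "hinner (U x) \<eta> = hinner x \<eta> - hinner x u"
      unfolding U_def hinner_diff_left hinner_smult_left uu by simp
    thus ?thesis by (simp add: u_def hinner_diff_right)
  qed
  have nU: "norm (U x) = norm x" for x
  proof (cases "u = 0")
    case True thus ?thesis by (simp add: U_def)
  next
    case False
    define n where "n = complex_of_real ((norm u)\<^sup>2)"
    have n: "n \<noteq> 0" "cnj n = n" "hinner u u = n" using False by (auto simp: n_def hinner_self)
    define c where "c = hinner x u"
    have ux: "hinner u x = cnj c" unfolding c_def by (rule hinner_commute)
    have "hinner (U x) (U x) = hinner x x - cnj (2 * c / n) * c - (2 * c / n) * cnj c + (2 * c / n) * cnj (2 * c / n) * n"
      unfolding U_def n_def[symmetric]
      by (simp add: hinner_diff_left hinner_diff_right hinner_smult_left hinner_smult_right n ux c_def[symmetric]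
           algebra_simps)
    also have "\<dots> = hinner x x" using n by (simp add: field_simps)
    finally have "(norm (U x))\<^sup>2 = (norm x)\<^sup>2" unfolding hinner_self by (simp only: of_real_eq_iff)
    thus ?thesis by simp
  qed
  have linU: "linear U"
    unfolding U_def by (rule linearI)
      (auto simp: hinner_add_left hinner_scaleR_left vec_eq_iff add_divide_distrib algebra_simps scaleR_conv_of_real[where 'a = complex])
  show thesis
  proof (rule that[of "\<lambda>x. U (\<omega> *s x)"])
    have "linear (\<lambda>x. \<omega> *s x)"
      by (rule linearI) (auto simp: vec_eq_iff algebra_simps scaleR_conv_of_real[where 'a = complex])
    from linear_compose[OF this linU] show "linear (\<lambda>x. U (\<omega> *s x))" by (simp add: o_def)
    show "norm (U (\<omega> *s x)) = norm x" for x by (simp add: nU norm_vector_smult \<omega>1)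
    show "hinner (U (\<omega> *s x)) \<eta> = x $ k" for x
      using \<omega>\<omega> by (simp add: U\<eta> hy mult.assoc[symmetric] mult.commute[of "cnj \<omega>"])
  qed
qed

section \<open>Volumes of coordinate boxes\<close>

lemma prod_Basis_complex_vec:
  fixes f :: "complex ^ 'n \<Rightarrow> 'b::comm_monoid_mult"
  shows "(\<Prod>b\<in>Basis. f b) = (\<Prod>i\<in>UNIV. f (axis i 1) * f (axis i \<i>))"
proof -
  have "(\<Prod>b\<in>Basis. f b) = (\<Prod>i\<in>UNIV. \<Prod>b\<in>{axis i 1, axis i \<i>}. f b)"
    unfolding Basis_vec_def Basis_complex_def
    by (subst prod.UNION_disjoint[symmetric]) (auto simp: axis_eq_axis intro!: prod.cong)
  also have "\<dots> = (\<Prod>i\<in>UNIV. f (axis i 1) * f (axis i \<i>))"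
    by (intro prod.cong) (auto simp: axis_eq_axis)
  finally show ?thesis .
qed

text \<open>Real and imaginary bounds are kept apart because the box around a cap has half-width 1
  in the real direction of one coordinate and half-width t in its imaginary direction.\<close>

lemma emeasure_complex_box:
  fixes A B :: "'n::finite \<Rightarrow> real"
  assumes "\<And>i. A i \<ge> 0" "\<And>i. B i \<ge> 0"
  shows "{v :: complex ^ 'n. \<forall>i. \<bar>Re (v $ i)\<bar> \<le> A i \<and> \<bar>Im (v $ i)\<bar> \<le> B i} \<in> sets borel"
    and "emeasure lborel {v :: complex ^ 'n. \<forall>i. \<bar>Re (v $ i)\<bar> \<le> A i \<and> \<bar>Im (v $ i)\<bar> \<le> B i}
      = ennreal (\<Prod>i\<in>UNIV. (2 * A i) * (2 * B i))"
proof -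
  define u where "u = (\<chi> i. Complex (A i) (B i))"
  have iu: "v \<bullet> axis i 1 = Re (v $ i)" "v \<bullet> axis i \<i> = Im (v $ i)" for v :: "complex^'n" and i
    by (auto simp: inner_axis inner_complex_def)
  have bas: "(\<forall>b\<in>Basis. P b) \<longleftrightarrow> (\<forall>i. P (axis i 1) \<and> P (axis i \<i>))" for P :: "complex^'n \<Rightarrow> bool"
    by (auto simp: Basis_vec_def Basis_complex_def)
  have eq: "{v :: complex ^ 'n. \<forall>i. \<bar>Re (v $ i)\<bar> \<le> A i \<and> \<bar>Im (v $ i)\<bar> \<le> B i} = cbox (- u) u"
    unfolding cbox_def bas by (auto simp: iu u_def abs_le_iff) (metis minus_le_iff)+
  show "{v :: complex ^ 'n. \<forall>i. \<bar>Re (v $ i)\<bar> \<le> A i \<and> \<bar>Im (v $ i)\<bar> \<le> B i} \<in> sets borel"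
    unfolding eq by simp
  have "\<forall>b\<in>Basis. - u \<bullet> b \<le> u \<bullet> b" unfolding bas using assms by (simp add: iu u_def)
  hence "emeasure lborel (cbox (- u) u) = ennreal (\<Prod>b\<in>Basis. (u - - u) \<bullet> b)"
    by (intro emeasure_lborel_cbox) blast
  also have "(\<Prod>b\<in>Basis. (u - - u) \<bullet> b) = (\<Prod>i\<in>UNIV. (2 * A i) * (2 * B i))"
    unfolding prod_Basis_complex_vec by (intro prod.cong) (auto simp: inner_add_left iu u_def)
  finally show "emeasure lborel {v :: complex ^ 'n. \<forall>i. \<bar>Re (v $ i)\<bar> \<le> A i \<and> \<bar>Im (v $ i)\<bar> \<le> B i}
      = ennreal (\<Prod>i\<in>UNIV. (2 * A i) * (2 * B i))" unfolding eq .
qed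

section \<open>Sphere means of the test functions\<close>

lemma measurable_hinner [measurable]:
  "(\<lambda>z. hinner z \<eta>) \<in> borel_measurable borel"
  by (intro borel_measurable_continuous_onI continuous_intros)

lemma nn_integral_nu:
  fixes h :: "complex ^ 'n \<Rightarrow> ennreal"
  assumes "h \<in> borel_measurable borel"
  shows "(\<integral>\<^sup>+z. h z \<partial>nu) = (\<integral>\<^sup>+z. h z * indicator unit_ball z \<partial>lborel) / emeasure lborel (unit_ball :: (complex ^ 'n) set)"
  unfolding nu_def by (rule nn_integral_uniform_measure) (use assms in auto)

lemma sets_nu [simp, measurable_cong]: "sets nu = sets borel"
  by (simp add: nu_def)

lemma emeasure_nu_UNIV: "emeasure (nu :: (complex ^ 'n) measure) UNIV = 1"
proof -
  have "integral\<^sup>N (nu :: (complex ^ 'n) measure) (\<lambda>z. 1) = 1"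
    using emeasure_lborel_ball_pos_finite[of 1 "0::complex^'n"]
    by (subst nn_integral_nu) (auto simp: ennreal_divide_self)
  thus ?thesis by (simp add: nu_def)
qed

lemma finite_measure_nu: "finite_measure nu"
  by (rule finite_measureI) (simp add: emeasure_nu_UNIV nu_def[THEN arg_cong[where f = space]])

lemma nn_integral_nu_isometry:
  fixes U :: "complex ^ 'n \<Rightarrow> complex ^ 'n" and h :: "complex ^ 'n \<Rightarrow> ennreal"
  assumes U: "linear U" "\<And>x. norm (U x) = norm x" and h[measurable]: "h \<in> borel_measurable borel"
  shows "(\<integral>\<^sup>+z. h (U z) \<partial>nu) = (\<integral>\<^sup>+z. h z \<partial>nu)"
proof -
  have [measurable]: "U \<in> borel_measurable borel"
    using linear_continuous_on[of U UNIV] U linear_conv_bounded_linear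
    by (intro borel_measurable_continuous_onI) blast
  have [measurable]: "unit_ball \<in> sets (borel :: (complex^'n) measure)" by simp
  have i: "indicator unit_ball (U z) = (indicator unit_ball z :: ennreal)" for z
    using U(2)[of z] by (simp add: indicator_def)
  have "(\<integral>\<^sup>+z. h (U z) * indicator unit_ball z \<partial>lborel) = (\<integral>\<^sup>+z. h z * indicator unit_ball z \<partial>lborel)"
    using nn_integral_lborel_isometry[OF U, of "\<lambda>z. h z * indicator unit_ball z"] by (simp add: i)
  thus ?thesis by (simp add: nn_integral_nu)
qed

lemma nn_integral_nu_polar:
  fixes h :: "complex ^ 'n \<Rightarrow> ennreal"
  assumes h[measurable]: "h \<in> borel_measurable borel"
  shows "(\<integral>\<^sup>+z. h z \<partial>nu) =
    (\<integral>\<^sup>+r. ennreal (indicator {0<..<1} r * (real (2 * CARD('n)) * r ^ (2 * CARD('n) - 1))) *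
       (\<integral>\<^sup>+z. h (r *\<^sub>R (z /\<^sub>R norm z)) \<partial>nu) \<partial>lborel)"
proof -
  have [measurable]: "unit_ball \<in> sets (borel :: (complex^'n) measure)" by simp
  define m where "m = emeasure lborel (unit_ball :: (complex ^ 'n) set)"
  have D: "DIM(complex ^ 'n) = 2 * CARD('n)" by simp
  define F where "F = (\<lambda>r. ennreal (indicator {0<..<1} r * (real (2 * CARD('n)) * r ^ (2 * CARD('n) - 1))))"
  have [measurable]: "F \<in> borel_measurable borel" unfolding F_def by measurable
  have "(\<integral>\<^sup>+r. F r * (\<integral>\<^sup>+z. h (r *\<^sub>R (z /\<^sub>R norm z)) \<partial>nu) \<partial>lborel)
      = (\<integral>\<^sup>+r. (F r * (\<integral>\<^sup>+z. h (r *\<^sub>R (z /\<^sub>R norm z)) * indicator unit_ball z \<partial>lborel)) * inverse m \<partial>lborel)"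
    by (simp add: nn_integral_nu m_def divide_ennreal_def mult.assoc)
  also have "\<dots> = (\<integral>\<^sup>+r. F r * (\<integral>\<^sup>+z. h (r *\<^sub>R (z /\<^sub>R norm z)) * indicator unit_ball z \<partial>lborel) \<partial>lborel) * inverse m"
    by (rule nn_integral_multc) measurable
  also have "\<dots> = (\<integral>\<^sup>+z. h z \<partial>nu)"
    using nn_integral_polar[OF h] unfolding nn_integral_nu[OF h] D F_def m_def divide_ennreal_def by simp
  finally show ?thesis unfolding F_def ..
qed

text \<open>Radial projection lands on the sphere except at z = 0, where division by the norm gives
  0; that point is null.\<close>

lemma sphere_nn_integral_eq:
  fixes h :: "complex ^ 'n \<Rightarrow> ennreal"
  assumes h[measurable]: "h \<in> borel_measurable borel"
  shows "(\<integral>\<^sup>+\<zeta>\<in>unit_sphere. h \<zeta> \<partial>sigma_sphere) = (\<integral>\<^sup>+z. h (z /\<^sub>R norm z) \<partial>nu)"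
proof -
  have [measurable]: "unit_ball \<in> sets (borel :: (complex^'n) measure)"
    "unit_sphere \<in> sets (borel :: (complex^'n) measure)" by simp_all
  have "(\<integral>\<^sup>+\<zeta>\<in>unit_sphere. h \<zeta> \<partial>sigma_sphere) = (\<integral>\<^sup>+z. h (z /\<^sub>R norm z) * indicator unit_sphere (z /\<^sub>R norm z) \<partial>nu)"
    unfolding sigma_sphere_def by (subst nn_integral_distr) auto
  also have "\<dots> = (\<integral>\<^sup>+z. h (z /\<^sub>R norm z) * indicator unit_sphere (z /\<^sub>R norm z) * indicator unit_ball z \<partial>lborel)
      / emeasure lborel (unit_ball :: (complex ^ 'n) set)"
    by (rule nn_integral_nu) simp
  also have "(\<integral>\<^sup>+z. h (z /\<^sub>R norm z) * indicator unit_sphere (z /\<^sub>R norm z) * indicator unit_ball z \<partial>lborel)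
     = (\<integral>\<^sup>+z. h (z /\<^sub>R norm z) * indicator unit_ball z \<partial>lborel)"
    by (rule nn_integral_cong_AE, rule AE_mp[OF AE_lborel_singleton[of 0]], rule AE_I2) simp
  finally show ?thesis by (simp add: nn_integral_nu)
qed

text \<open>By isometry invariance the direction \<eta> becomes a coordinate k. Inside the ball the
  cone over the cap then satisfies |Im z_k| \<le> t, while |z_i|^2 \<le> |z|^2 - |z_k|^2 \<le> 2t
  for i \<noteq> k. Each coordinate of the enclosing box thus contributes area of order t, and the
  volume is of order t^N.\<close>

lemma nu_cap_le:
  obtains K where "K \<ge> 0" "\<And>\<eta> :: complex ^ 'n. \<And>t. norm \<eta> = 1 \<Longrightarrow> t > 0 \<Longrightarrow>
    emeasure nu {z. cmod (1 - hinner (z /\<^sub>R norm z) \<eta>) < t} \<le> ennreal (K * t ^ CARD('n))"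
proof -
  define N where "N = CARD('n)"
  have N: "N > 0" by (simp add: N_def)
  define m where "m = measure lborel (unit_ball :: (complex ^ 'n) set)"
  have em: "emeasure lborel (unit_ball :: (complex ^ 'n) set) = ennreal m"
    using emeasure_lborel_ball_pos_finite[of 1 "0::complex^'n"] by (simp add: m_def emeasure_eq_ennreal_measure)
  have m: "m > 0" using emeasure_lborel_ball_pos_finite(1)[of 1 "0::complex^'n"] em by (simp add: ennreal_less_zero_iff)
  \<comment> \<open>The k-th coordinate contributes 2 * 2t to the volume of the box and every other
    one (2 sqrt(2t))^2 = 8t; \<open>m\<close> is the volume of the ball.\<close>
  define K where "K = 4 * 8 ^ (N - 1) / m"
  show thesis
  proof (rule that[of K])
    show "K \<ge> 0" using m by (simp add: K_def)
    fix \<eta> :: "complex ^ 'n" and t :: real assume \<eta>: "norm \<eta> = 1" and t: "t > 0"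
    obtain k :: 'n where True by blast
    obtain V where V: "linear V" "\<And>x. norm (V x) = norm x" "\<And>x. hinner (V x) \<eta> = x $ k"
      using exists_isometry_hinner_coordinate[OF \<eta>] by blast
    define A where "A = {z. cmod (1 - hinner (z /\<^sub>R norm z) \<eta>) < t}"
    have A[measurable]: "A \<in> sets borel" unfolding A_def by measurable
    define a b where "a = (\<lambda>i::'n. if i = k then 1 else sqrt (2 * t))"
      and "b = (\<lambda>i::'n. if i = k then t else sqrt (2 * t))"
    define Q where "Q = {v :: complex ^ 'n. \<forall>i. \<bar>Re (v $ i)\<bar> \<le> a i \<and> \<bar>Im (v $ i)\<bar> \<le> b i}"
    have ab: "\<And>i. a i \<ge> 0" "\<And>i. b i \<ge> 0" using t by (auto simp: a_def b_def)
    note Q = emeasure_complex_box[of a b, OF ab, folded Q_def]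
    have sub: "z \<in> Q" if z: "V z \<in> A" "z \<in> unit_ball" for z
    proof (cases "z = 0")
      case True thus ?thesis using ab by (simp add: Q_def)
    next
      case False
      define \<rho> where "\<rho> = norm z"
      have \<rho>: "\<rho> > 0" "\<rho> \<le> 1" using False z(2) by (auto simp: \<rho>_def)
      define c where "c = z $ k"
      have c\<rho>: "cmod c \<le> \<rho>" unfolding c_def \<rho>_def by (rule Finite_Cartesian_Product.norm_nth_le)
      have "cmod (1 - c / of_real \<rho>) < t"
        using z(1) unfolding A_def by (simp add: V(2,3) hinner_scaleR_left c_def \<rho>_def inverse_eq_divide field_simps)
      \<comment> \<open>Multiplication by \<rho> = |z| returns from the projected point to z itself,
        and \<rho> \<le> 1 preserves the bound \<open>t\<close>.\<close>
      moreover have "of_real \<rho> - c = of_real \<rho> * (1 - c / of_real \<rho>)" using \<rho> by (simp add: field_simps)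
      hence "cmod (of_real \<rho> - c) = \<rho> * cmod (1 - c / of_real \<rho>)" using \<rho> by (simp add: norm_mult)
      ultimately have 1: "cmod (of_real \<rho> - c) \<le> t"
        using \<rho> mult_mono[of \<rho> 1 "cmod (1 - c / of_real \<rho>)" t] by simp
      have "\<bar>Re c\<bar> \<le> 1" using abs_Re_le_cmod[of c] c\<rho> \<rho> by linarith
      moreover have "\<bar>Im c\<bar> \<le> t" using abs_Im_le_cmod[of "of_real \<rho> - c"] 1 by simp
      moreover have "cmod (z $ i) \<le> sqrt (2 * t)" if i: "i \<noteq> k" for i
      proof (rule real_le_rsqrt)
        have "(cmod (z $ i))\<^sup>2 + (cmod c)\<^sup>2 = (\<Sum>j\<in>{i, k}. (cmod (z $ j))\<^sup>2)" using i by (simp add: c_def)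
        also have "\<dots> \<le> (\<Sum>j\<in>UNIV. (cmod (z $ j))\<^sup>2)" by (rule sum_mono2) auto
        also have "\<dots> = \<rho>\<^sup>2" by (simp add: \<rho>_def norm_vec_def L2_set_def sum_nonneg)
        finally have "(cmod (z $ i))\<^sup>2 \<le> (\<rho> - cmod c) * (\<rho> + cmod c)" by (simp add: power2_eq_square algebra_simps)
        also have "\<dots> \<le> t * 2"
          using c\<rho> \<rho> 1 norm_triangle_ineq2[of "of_real \<rho>" c] t by (intro mult_mono) auto
        finally show "(cmod (z $ i))\<^sup>2 \<le> 2 * t" by simp
      qed
      ultimately show ?thesis unfolding Q_def a_def b_def c_def
        using abs_Re_le_cmod abs_Im_le_cmod order_trans by auto blast+
    qed
    have "emeasure nu A = (\<integral>\<^sup>+z. indicator A (V z) \<partial>nu)"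
      using nn_integral_nu_isometry[OF V(1,2), of "indicator A"] by (simp add: nn_integral_indicator)
    also have "\<dots> = (\<integral>\<^sup>+z. indicator A (V z) * indicator unit_ball z \<partial>lborel) / ennreal m"
    proof -
      have [measurable]: "V \<in> borel_measurable borel"
        using linear_continuous_on[of V UNIV] V(1) linear_conv_bounded_linear
        by (intro borel_measurable_continuous_onI) blast
      show ?thesis unfolding em[symmetric] by (rule nn_integral_nu) simp
    qed
    also have "\<dots> \<le> (\<integral>\<^sup>+z. indicator Q z \<partial>lborel) / ennreal m"
      by (intro divide_right_mono_ennreal nn_integral_mono) (use sub in \<open>auto simp: indicator_def\<close>)
    also have "(\<integral>\<^sup>+z. indicator Q z \<partial>lborel) = ennreal (\<Prod>i\<in>UNIV. (2 * a i) * (2 * b i))"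
      using Q by simp
    also have "(\<Prod>i\<in>UNIV. (2 * a i) * (2 * b i)) = (2 * a k) * (2 * b k) * (\<Prod>i\<in>UNIV - {k}. (2 * a i) * (2 * b i))"
      by (simp add: prod.remove)
    also have "(\<Prod>i\<in>UNIV - {k}. (2 * a i) * (2 * b i)) = (\<Prod>i\<in>UNIV - {k}. 8 * t)"
      using t by (intro prod.cong) (auto simp: a_def b_def)
    also have "\<dots> = (8 * t) ^ (N - 1)" by (simp add: N_def card_Diff_singleton)
    also have "(2 * a k) * (2 * b k) * (8 * t) ^ (N - 1) = 4 * 8 ^ (N - 1) * t ^ N"
      using N by (cases N) (simp_all add: a_def b_def power_mult_distrib)
    also have "ennreal (4 * 8 ^ (N - 1) * t ^ N) / ennreal m = ennreal (K * t ^ N)"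
      using m t by (simp add: divide_ennreal K_def)
    finally show "emeasure nu {z. cmod (1 - hinner (z /\<^sub>R norm z) \<eta>) < t} \<le> ennreal (K * t ^ CARD('n))"
      unfolding A_def N_def .
  qed
qed

text \<open>Layer cake and Fubini reduce the integral to the measures of the sets {x < t -
  \<epsilon>}, which are at most K t^N. The integral of t^N / t^(q+1) over t > \<epsilon> converges
  because q > N.\<close>

lemma nn_integral_inverse_power_le:
  fixes x :: "'a \<Rightarrow> real" and K \<epsilon> :: real and N q :: nat
  assumes "sigma_finite_measure M" and x[measurable]: "x \<in> borel_measurable M" and x0: "\<And>z. x z \<ge> 0"
    and cap: "\<And>t. t > 0 \<Longrightarrow> emeasure M {z \<in> space M. x z < t} \<le> ennreal (K * t ^ N)"
    and K: "K \<ge> 0" and \<epsilon>: "\<epsilon> > 0" and q: "N < q"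
  shows "(\<integral>\<^sup>+z. ennreal (1 / (\<epsilon> + x z) ^ q) \<partial>M) \<le> ennreal (K * real q / real (q - N) / \<epsilon> ^ (q - N))"
proof -
  interpret sigma_finite_measure M by fact
  interpret pair_sigma_finite M lborel ..
  have "(\<integral>\<^sup>+z. ennreal (1 / (\<epsilon> + x z) ^ q) \<partial>M)
      = (\<integral>\<^sup>+z. (\<integral>\<^sup>+t. ennreal (indicator {\<epsilon> + x z<..} t * (real q / t ^ Suc q)) \<partial>lborel) \<partial>M)"
    by (intro nn_integral_cong nn_integral_inverse_power_greaterThan[symmetric]) (use \<epsilon> x0 q in \<open>auto intro: add_pos_nonneg\<close>)
  also have "\<dots> = (\<integral>\<^sup>+t. (\<integral>\<^sup>+z. ennreal (indicator {\<epsilon> + x z<..} t * (real q / t ^ Suc q)) \<partial>M) \<partial>lborel)"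
    by (rule Fubini'[symmetric]) (simp add: indicator_def greaterThan_def)
  also have "\<dots> \<le> (\<integral>\<^sup>+t. ennreal (K * real q / real (q - N)) * ennreal (indicator {\<epsilon><..} t * (real (q - N) / t ^ Suc (q - N))) \<partial>lborel)"
  proof (rule nn_integral_mono)
    fix t :: real
    show "(\<integral>\<^sup>+z. ennreal (indicator {\<epsilon> + x z<..} t * (real q / t ^ Suc q)) \<partial>M)
       \<le> ennreal (K * real q / real (q - N)) * ennreal (indicator {\<epsilon><..} t * (real (q - N) / t ^ Suc (q - N)))"
    proof (cases "t > \<epsilon>")
      case False
      hence "indicator {\<epsilon> + x z<..} t = (0::real)" for z using x0[of z] by (auto simp: indicator_def)
      thus ?thesis by simp
    next
      case True
      have t: "t > 0" using True \<epsilon> by linarith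
      have "(\<integral>\<^sup>+z. ennreal (indicator {\<epsilon> + x z<..} t * (real q / t ^ Suc q)) \<partial>M)
         = (\<integral>\<^sup>+z. ennreal (real q / t ^ Suc q) * indicator {z \<in> space M. x z < t - \<epsilon>} z \<partial>M)"
        by (intro nn_integral_cong) (auto simp: indicator_def)
      also have "\<dots> = ennreal (real q / t ^ Suc q) * emeasure M {z \<in> space M. x z < t - \<epsilon>}"
        by (rule nn_integral_cmult_indicator) simp
      also have "\<dots> \<le> ennreal (real q / t ^ Suc q) * ennreal (K * (t - \<epsilon>) ^ N)"
        using True by (intro mult_left_mono cap) auto
      \<comment> \<open>Enlarging t - \<epsilon> to t costs only a constant and brings the
        t-integral back to the layer-cake formula, now with exponent q - N.\<close>
      also have "\<dots> \<le> ennreal (real q / t ^ Suc q) * ennreal (K * t ^ N)"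
        using True \<epsilon> K by (intro mult_left_mono ennreal_leI power_mono) auto
      also have "\<dots> = ennreal (real q / t ^ Suc q * (K * t ^ N))" using t K by (intro ennreal_mult[symmetric]) auto
      also have "real q / t ^ Suc q * (K * t ^ N) = K * real q / real (q - N) * (real (q - N) / t ^ Suc (q - N))"
      proof -
        have "t ^ Suc q = t ^ Suc (q - N) * t ^ N" using q by (simp add: power_add[symmetric])
        thus ?thesis using t q by simp
      qed
      also have "ennreal \<dots> = ennreal (K * real q / real (q - N)) * ennreal (real (q - N) / t ^ Suc (q - N))"
        using K t by (intro ennreal_mult) auto
      finally show ?thesis using True by simp
    qed
  qed
  also have "\<dots> = ennreal (K * real q / real (q - N)) * ennreal (1 / \<epsilon> ^ (q - N))"
    using nn_integral_inverse_power_greaterThan[OF \<epsilon>, of "q - N"] q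
    by (subst nn_integral_cmult) (simp_all del: power_Suc of_nat_diff)
  also have "\<dots> = ennreal (K * real q / real (q - N) / \<epsilon> ^ (q - N))"
    using K \<epsilon> by (simp add: ennreal_mult[symmetric])
  finally show ?thesis .
qed

text \<open>On the sphere of radius r the denominator is bounded below by a multiple of \<epsilon> +
  (1 - r) + |1 - a| with a = <z/|z|, \<eta>>: the distance 1 - r to the sphere merges with
  \<epsilon>, and the cap estimate applies. The hypothesis on p is the convergence condition N < q
  for q = 2p.\<close>

lemma test_function_sphere_mean:
  assumes p: "CARD('n) < 2 * p"
  obtains C where "C \<ge> 0" "\<And>(\<eta> :: complex ^ 'n) \<epsilon> r. norm \<eta> = 1 \<Longrightarrow> \<epsilon> > 0 \<Longrightarrow> 0 < r \<Longrightarrow> r < 1 \<Longrightarrow>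
    (\<integral>\<^sup>+z. ennreal ((cmod (1 / (1 + of_real \<epsilon> - hinner (r *\<^sub>R (z /\<^sub>R norm z)) \<eta>) ^ p))\<^sup>2) \<partial>nu)
      \<le> ennreal (C / (\<epsilon> + (1 - r)) ^ (2 * p - CARD('n)))"
proof -
  obtain K where K: "K \<ge> 0" "\<And>\<eta> :: complex ^ 'n. \<And>t. norm \<eta> = 1 \<Longrightarrow> t > 0 \<Longrightarrow>
    emeasure nu {z. cmod (1 - hinner (z /\<^sub>R norm z) \<eta>) < t} \<le> ennreal (K * t ^ CARD('n))"
    using nu_cap_le by blast
  define q where "q = 2 * p"
  define C where "C = 4 ^ q * (K * real q / real (q - CARD('n)))"
  show thesis
  proof (rule that[of C])
    show "C \<ge> 0" using K(1) by (simp add: C_def)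
    fix \<eta> :: "complex ^ 'n" and \<epsilon> r :: real assume \<eta>: "norm \<eta> = 1" and \<epsilon>: "\<epsilon> > 0" and r: "0 < r" "r < 1"
    define \<epsilon>' where "\<epsilon>' = \<epsilon> + (1 - r)"
    have \<epsilon>': "\<epsilon>' > 0" using \<epsilon> r by (simp add: \<epsilon>'_def)
    define x where "x = (\<lambda>z. cmod (1 - hinner (z /\<^sub>R norm z) \<eta>))"
    have pt: "(cmod (1 / (1 + of_real \<epsilon> - hinner (r *\<^sub>R (z /\<^sub>R norm z)) \<eta>) ^ p))\<^sup>2 \<le> 4 ^ q * (1 / (\<epsilon>' + x z) ^ q)" for z
    proof -
      define a where "a = hinner (z /\<^sub>R norm z) \<eta>"
      have "cmod a \<le> norm (z /\<^sub>R norm z) * norm \<eta>" unfolding a_def by (rule cmod_hinner_le)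
      also have "\<dots> \<le> 1" using \<eta> by (cases "z = 0") simp_all
      finally have a1: "cmod a \<le> 1" .
      define w where "w = 1 + of_real \<epsilon> - of_real r * a"
      have "cmod (1 + of_real \<epsilon>) \<le> cmod w + cmod (of_real r * a)"
        using norm_triangle_ineq[of w "of_real r * a"] by (simp add: w_def)
      moreover have "cmod (1 + of_real \<epsilon>) = 1 + \<epsilon>"
        using \<epsilon> norm_of_real[of "1 + \<epsilon>", where 'a = complex] by simp
      moreover have "cmod (of_real r * a) \<le> r" using a1 r by (simp add: norm_mult mult_left_le)
      ultimately have w1: "\<epsilon>' \<le> cmod w" by (simp add: \<epsilon>'_def)
      have "1 - a = w - (of_real \<epsilon> + of_real (1 - r) * a)" by (simp add: w_def algebra_simps)
      hence "cmod (1 - a) \<le> cmod w + cmod (of_real \<epsilon> + of_real (1 - r) * a)" by (metis norm_triangle_ineq4)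
      also have "cmod (of_real \<epsilon> + of_real (1 - r) * a) \<le> cmod (of_real \<epsilon>) + cmod (of_real (1 - r) * a)"
        by (rule norm_triangle_ineq)
      also have "cmod (of_real \<epsilon>) = \<epsilon>" using \<epsilon> by simp
      also have "cmod (of_real (1 - r) * a) \<le> 1 - r" using a1 r by (simp add: norm_mult mult_left_le del: of_real_diff)
      finally have w2: "x z \<le> cmod w + \<epsilon>'" by (simp add: x_def a_def \<epsilon>'_def)
      \<comment> \<open>From \<epsilon>' \<le> |w| and x \<le> |w| + \<epsilon>' one gets
        \<epsilon>' + x \<le> 3|w|; the constant is rounded up to 4.\<close>
      have w3: "(\<epsilon>' + x z) / 4 \<le> cmod w" using w1 w2 \<epsilon>' by simp
      have pos: "0 < \<epsilon>' + x z" using \<epsilon>' by (simp add: x_def add_pos_nonneg)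
      have "(cmod (1 / w ^ p))\<^sup>2 = 1 / (cmod w) ^ q"
        by (simp add: norm_divide norm_power q_def power_mult[symmetric] mult.commute power_divide)
      also have "\<dots> \<le> 1 / ((\<epsilon>' + x z) / 4) ^ q" using w3 pos w1 \<epsilon>' by (intro divide_left_mono power_mono mult_pos_pos zero_less_power) auto
      also have "\<dots> = 4 ^ q * (1 / (\<epsilon>' + x z) ^ q)" by (simp add: power_divide)
      finally show ?thesis unfolding w_def a_def hinner_scaleR_left[of r] .
    qed
    have [measurable]: "x \<in> borel_measurable borel" unfolding x_def by measurable
    interpret nu: finite_measure nu by (rule finite_measure_nu)
    have "(\<integral>\<^sup>+z. ennreal ((cmod (1 / (1 + of_real \<epsilon> - hinner (r *\<^sub>R (z /\<^sub>R norm z)) \<eta>) ^ p))\<^sup>2) \<partial>nu)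
       \<le> (\<integral>\<^sup>+z. ennreal (4 ^ q) * ennreal (1 / (\<epsilon>' + x z) ^ q) \<partial>nu)"
    proof (rule nn_integral_mono)
      fix z :: "complex^'n"
      have "\<epsilon>' + x z \<ge> 0" using \<epsilon>' by (simp add: x_def)
      hence "ennreal (4 ^ q) * ennreal (1 / (\<epsilon>' + x z) ^ q) = ennreal (4 ^ q * (1 / (\<epsilon>' + x z) ^ q))"
        by (intro ennreal_mult[symmetric]) auto
      thus "ennreal ((cmod (1 / (1 + of_real \<epsilon> - hinner (r *\<^sub>R (z /\<^sub>R norm z)) \<eta>) ^ p))\<^sup>2)
        \<le> ennreal (4 ^ q) * ennreal (1 / (\<epsilon>' + x z) ^ q)" using ennreal_leI[OF pt[of z]] by simp
    qed
    also have "\<dots> = ennreal (4 ^ q) * (\<integral>\<^sup>+z. ennreal (1 / (\<epsilon>' + x z) ^ q) \<partial>nu)"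
      by (rule nn_integral_cmult) simp
    also have "\<dots> \<le> ennreal (4 ^ q) * ennreal (K * real q / real (q - CARD('n)) / \<epsilon>' ^ (q - CARD('n)))"
    proof (intro mult_left_mono nn_integral_inverse_power_le)
      show "sigma_finite_measure nu" by unfold_locales
      show "emeasure nu {z \<in> space nu. x z < t} \<le> ennreal (K * t ^ CARD('n))" if "t > 0" for t
        using K(2)[OF \<eta> that] by (simp add: x_def nu_def)
    qed (use K \<epsilon>' p in \<open>auto simp: x_def q_def\<close>)
    also have "\<dots> = ennreal (C / \<epsilon>' ^ (q - CARD('n)))"
      using K(1) \<epsilon>' by (simp add: ennreal_mult[symmetric] C_def)
    finally show "(\<integral>\<^sup>+z. ennreal ((cmod (1 / (1 + of_real \<epsilon> - hinner (r *\<^sub>R (z /\<^sub>R norm z)) \<eta>) ^ p))\<^sup>2) \<partial>nu)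
      \<le> ennreal (C / (\<epsilon> + (1 - r)) ^ (2 * p - CARD('n)))" by (simp add: \<epsilon>'_def q_def)
  qed
qed

section \<open>Point evaluation by sub-mean values on non-isotropic balls\<close>

text \<open>The mean value property is applied to f^2 rather than to f; taking moduli then bounds
  |f(0)|^2 directly, with no Cauchy-Schwarz step.\<close>

lemma cmod_sqr_le_circle_mean:
  assumes f: "f holomorphic_on cball 0 1"
  shows "ennreal ((cmod (f 0))\<^sup>2) \<le> (\<integral>\<^sup>+t. ennreal ((cmod (f (cis (2 * pi * t))))\<^sup>2) * indicator {0..1} t \<partial>lborel)"
proof -
  define e where "e = (\<lambda>t::real. exp (2 * of_real pi * \<i> * of_real t))"
  have e: "e t = cis (2 * pi * t)" for t by (simp add: e_def cis_conv_exp mult_ac)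
  have en: "e t \<noteq> 0" "cmod (e t) = 1" for t unfolding e by simp_all
  define F where "F = (\<lambda>u. (f u)\<^sup>2)"
  have F: "F holomorphic_on cball 0 1" unfolding F_def by (intro holomorphic_intros f)
  have "((\<lambda>u. F u / (u - 0)) has_contour_integral (2 * of_real pi * \<i> * F 0)) (circlepath 0 1)"
    by (rule Cauchy_integral_circlepath_simple[OF F]) simp
  hence "((\<lambda>t. F (e t) / e t * (2 * of_real pi * \<i> * e t)) has_integral (2 * of_real pi * \<i> * F 0)) {0..1}"
    unfolding has_contour_integral vector_derivative_circlepath by (simp add: circlepath e_def)
  hence "((\<lambda>t. (2 * of_real pi * \<i>) * F (e t)) has_integral (2 * of_real pi * \<i>) * F 0) {0..1}"
    using en by (simp add: mult_ac)
  hence "((\<lambda>t. inverse (2 * of_real pi * \<i>) * ((2 * of_real pi * \<i>) * F (e t))) has_integral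
      inverse (2 * of_real pi * \<i>) * ((2 * of_real pi * \<i>) * F 0)) {0..1}"
    by (rule has_integral_mult_right)
  moreover have "inverse (2 * of_real pi * \<i>) * ((2 * of_real pi * \<i>) * z) = z" for z
    by (subst mult.assoc[symmetric], subst left_inverse) auto
  ultimately have I: "((\<lambda>t. F (e t)) has_integral F 0) {0..1}" by (simp only:)
  have "continuous_on {0..1} (\<lambda>t. F (e t))"
    by (rule continuous_on_compose2[OF holomorphic_on_imp_continuous_on[OF F]])
       (auto simp: en e_def intro!: continuous_intros)
  hence J: "(\<lambda>t. cmod (F (e t))) integrable_on {0..1}"
    by (intro integrable_continuous_interval continuous_intros)
  have "cmod (F 0) \<le> integral {0..1} (\<lambda>t. cmod (F (e t)))"
    using integral_norm_bound_integral[OF has_integral_integrable[OF I] J] integral_unique[OF I] by simp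
  hence "ennreal (cmod (F 0)) \<le> ennreal (integral {0..1} (\<lambda>t. cmod (F (e t))))" by (rule ennreal_leI)
  also have "\<dots> = (\<integral>\<^sup>+t. ennreal (cmod (F (e t))) * indicator {0..1} t \<partial>lborel)"
    by (rule nn_integral_has_integral_lebesgue'[symmetric]) (use J in \<open>auto simp: integrable_integral\<close>)
  finally show ?thesis by (simp add: F_def e norm_power)
qed

lemma continuous_smult_pair: "continuous_on UNIV (\<lambda>x. cis (2 * pi * fst x) *s (snd x :: complex ^ 'n))"
proof -
  have "(\<lambda>x. cis (2 * pi * fst x) *s (snd x :: complex ^ 'n)) = (\<lambda>x. \<chi> i. cis (2 * pi * fst x) * snd x $ i)"
    by (simp add: fun_eq_iff vec_eq_iff)
  moreover have "continuous_on UNIV (\<lambda>x. \<chi> i. cis (2 * pi * fst x) * (snd x :: complex ^ 'n) $ i)"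
    by (intro continuous_on_vec_lambda continuous_intros)
  ultimately show ?thesis by (simp only:)
qed

text \<open>Values off the ball are arbitrary, so measurability is available only after cutting down
  to a subset of the ball.\<close>

lemma holomorphic_on_ball_measurable:
  assumes "holomorphic_on_ball g" and "A \<in> sets borel" "A \<subseteq> unit_ball"
  shows "(\<lambda>z. ennreal ((cmod (g z))\<^sup>2) * indicator A z) \<in> borel_measurable borel"
proof -
  have "(\<lambda>z. indicator A z *\<^sub>R ((cmod (g z))\<^sup>2)) \<in> borel_measurable borel"
    using assms holomorphic_on_ball_continuous[OF assms(1)]
    by (intro borel_measurable_continuous_on_indicator continuous_intros) (auto intro: continuous_on_subset)
  hence "(\<lambda>z. ennreal (indicator A z *\<^sub>R ((cmod (g z))\<^sup>2))) \<in> borel_measurable borel" by measurable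
  moreover have "ennreal (indicator A z *\<^sub>R ((cmod (g z))\<^sup>2)) = ennreal ((cmod (g z))\<^sup>2) * indicator A z" for z
    by (simp split: split_indicator)
  ultimately show ?thesis by (simp only:)
qed

text \<open>For v in E the disc of points w + l v with |l| \<le> 1 lies in w + E, so the circle mean
  inequality holds on it. After integrating over v and exchanging the integrals, each angle leaves
  an integral over E composed with a rotation by a phase, which preserves both E and Lebesgue
  measure.\<close>

lemma sub_mean_value_balanced:
  fixes g :: "complex ^ 'n \<Rightarrow> complex"
  assumes g: "holomorphic_on_ball g" and E[measurable]: "E \<in> sets borel"
    and bal: "\<And>c v. v \<in> E \<Longrightarrow> cmod c \<le> 1 \<Longrightarrow> c *s v \<in> E"
    and wE: "\<And>v. v \<in> E \<Longrightarrow> w + v \<in> unit_ball"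
  shows "ennreal ((cmod (g w))\<^sup>2) * emeasure lborel E
    \<le> (\<integral>\<^sup>+v. ennreal ((cmod (g (w + v)))\<^sup>2) * indicator E v \<partial>lborel)"
proof -
  define G where "G = (\<lambda>z. ennreal ((cmod (g z))\<^sup>2) * indicator unit_ball z)"
  have [measurable]: "G \<in> borel_measurable borel"
    unfolding G_def by (rule holomorphic_on_ball_measurable[OF g]) auto
  define h where "h = (\<lambda>v. G (w + v) * indicator E v)"
  have [measurable]: "h \<in> borel_measurable borel" unfolding h_def by measurable
  have hE: "h v = ennreal ((cmod (g (w + v)))\<^sup>2) * indicator E v" for v
    using wE[of v] by (auto simp: h_def G_def indicator_def)
  define P where "P = (\<lambda>x. cis (2 * pi * fst x) *s (snd x :: complex ^ 'n))"
  have P: "P \<in> borel_measurable borel"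
    unfolding P_def by (rule borel_measurable_continuous_onI[OF continuous_smult_pair])
  hence [measurable]: "P \<in> (lborel \<Otimes>\<^sub>M lborel) \<rightarrow>\<^sub>M borel" by (simp add: lborel_prod)
  have "ennreal ((cmod (g w))\<^sup>2) * emeasure lborel E = (\<integral>\<^sup>+v. ennreal ((cmod (g w))\<^sup>2) * indicator E v \<partial>lborel)"
    by (simp add: nn_integral_cmult_indicator)
  also have "\<dots> \<le> (\<integral>\<^sup>+v. (\<integral>\<^sup>+t. h (P (t, v)) * indicator {0..1} t \<partial>lborel) \<partial>lborel)"
  proof (rule nn_integral_mono)
    fix v :: "complex ^ 'n"
    show "ennreal ((cmod (g w))\<^sup>2) * indicator E v \<le> (\<integral>\<^sup>+t. h (P (t, v)) * indicator {0..1} t \<partial>lborel)"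
    proof (cases "v \<in> E")
      case True
      have "(\<lambda>l. g (w + l *s v)) holomorphic_on cball 0 1"
        by (rule holomorphic_on_ball_slice[OF g]) (use wE bal True in auto)
      from cmod_sqr_le_circle_mean[OF this]
      have "ennreal ((cmod (g w))\<^sup>2) \<le> (\<integral>\<^sup>+t. ennreal ((cmod (g (w + cis (2 * pi * t) *s v)))\<^sup>2) * indicator {0..1} t \<partial>lborel)"
        by simp
      moreover have "h (P (t, v)) = ennreal ((cmod (g (w + cis (2 * pi * t) *s v)))\<^sup>2)" for t
        unfolding hE P_def using bal[OF True, of "cis (2 * pi * t)"] by simp
      ultimately show ?thesis using True by simp
    qed simp
  qed
  also have "\<dots> = (\<integral>\<^sup>+t. (\<integral>\<^sup>+v. h (P (t, v)) * indicator {0..1} t \<partial>lborel) \<partial>lborel)"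
    by (rule lborel_pair.Fubini') simp
  also have "\<dots> = (\<integral>\<^sup>+t. (\<integral>\<^sup>+v. h v \<partial>lborel) * indicator {0..1::real} t \<partial>lborel)"
  proof (rule nn_integral_cong)
    fix t :: real
    have lin: "linear (\<lambda>v :: complex ^ 'n. cis (2 * pi * t) *s v)"
      by (rule linearI) (auto simp: vec_eq_iff algebra_simps scaleR_conv_of_real[where 'a = complex])
    have "(\<lambda>v. P (t, v)) \<in> borel_measurable borel"
      unfolding P_def using lin linear_continuous_on linear_conv_bounded_linear
      by (intro borel_measurable_continuous_onI) auto
    hence [measurable]: "(\<lambda>v. h (P (t, v))) \<in> borel_measurable borel" by measurable
    have "(\<integral>\<^sup>+v. h (P (t, v)) \<partial>lborel) = (\<integral>\<^sup>+v. h v \<partial>lborel)"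
      using nn_integral_lborel_isometry[OF lin, of h] by (simp add: P_def norm_vector_smult)
    thus "(\<integral>\<^sup>+v. h (P (t, v)) * indicator {0..1} t \<partial>lborel) = (\<integral>\<^sup>+v. h v \<partial>lborel) * indicator {0..1} t"
      by (simp add: nn_integral_multc)
  qed
  also have "\<dots> = (\<integral>\<^sup>+v. h v \<partial>lborel)"
    by (subst nn_integral_cmult) auto
  finally show ?thesis by (simp only: hE)
qed

text \<open>The set has size \<delta> in the complex direction \<eta> and sqrt \<delta> in the N - 1
  complex directions orthogonal to it, hence volume of order \<delta>^2 \<delta>^(N-1). An inscribed
  box gives the lower bound once \<eta> is rotated to a coordinate.\<close>

lemma emeasure_nonisotropic_ball_ge:
  obtains c where "c > 0" "\<And>(\<eta> :: complex ^ 'n) \<delta>. norm \<eta> = 1 \<Longrightarrow> 0 < \<delta> \<Longrightarrow> \<delta> \<le> 1 \<Longrightarrow>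
    ennreal (c * \<delta> ^ Suc CARD('n)) \<le> emeasure lborel {v. cmod (hinner v \<eta>) < \<delta> / 4 \<and> norm v < sqrt \<delta> / 4}"
proof -
  define N where "N = CARD('n)"
  have N: "N > 0" by (simp add: N_def)
  \<comment> \<open>Chosen so that the box fits: |v_k| \<le> 2\<tau>\<delta> \<le> \<delta>/8, and
    summing over N coordinates gives |v| \<le> 2N\<tau> sqrt \<delta> = sqrt \<delta> / 8.\<close>
  define \<tau> where "\<tau> = 1 / (16 * real N)"
  have \<tau>: "\<tau> > 0" using N by (simp add: \<tau>_def)
  show thesis
  proof (rule that[of "(4 * \<tau>\<^sup>2) ^ N"])
    show "(4 * \<tau>\<^sup>2) ^ N > 0" using \<tau> by simp
    fix \<eta> :: "complex ^ 'n" and \<delta> :: real assume \<eta>: "norm \<eta> = 1" and \<delta>: "0 < \<delta>" "\<delta> \<le> 1"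
    obtain k :: 'n where True by blast
    obtain V where V: "linear V" "\<And>x. norm (V x) = norm x" "\<And>x. hinner (V x) \<eta> = x $ k"
      using exists_isometry_hinner_coordinate[OF \<eta>] by blast
    define E where "E = {v. cmod (hinner v \<eta>) < \<delta> / 4 \<and> norm v < sqrt \<delta> / 4}"
    have [measurable]: "E \<in> sets borel" unfolding E_def by measurable
    define s where "s = (\<lambda>i::'n. if i = k then \<tau> * \<delta> else \<tau> * sqrt \<delta>)"
    have s0: "s i \<ge> 0" for i using \<tau> \<delta> by (simp add: s_def)
    have \<delta>s: "\<delta> \<le> sqrt \<delta>" using \<delta> by (intro real_le_rsqrt) (simp add: power2_eq_square mult_left_le)
    have s1: "s i \<le> \<tau> * sqrt \<delta>" for i using \<tau> \<delta>s by (simp add: s_def)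
    define Q where "Q = {v :: complex ^ 'n. \<forall>i. \<bar>Re (v $ i)\<bar> \<le> s i \<and> \<bar>Im (v $ i)\<bar> \<le> s i}"
    note Q = emeasure_complex_box[of s s, OF s0 s0, folded Q_def]
    have sub: "V v \<in> E" if v: "v \<in> Q" for v
    proof -
      have c: "cmod (v $ i) \<le> 2 * s i" for i
        using cmod_le[of "v $ i"] v unfolding Q_def by (smt (verit) mem_Collect_eq)
      have "cmod (v $ k) \<le> 2 * (\<tau> * \<delta>)" using c[of k] by (simp add: s_def)
      also have "\<dots> < \<delta> / 4"
      proof -
        have "\<tau> \<le> 1 / 16" using N by (simp add: \<tau>_def divide_simps)
        hence "2 * (\<tau> * \<delta>) \<le> 2 * (1 / 16 * \<delta>)" using \<delta> by (intro mult_left_mono mult_right_mono) auto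
        thus ?thesis using \<delta> by simp
      qed
      finally have 1: "cmod (v $ k) < \<delta> / 4" .
      have "norm v \<le> (\<Sum>i\<in>UNIV. cmod (v $ i))" unfolding norm_vec_def by (rule L2_set_le_sum) simp
      also have "\<dots> \<le> (\<Sum>i\<in>(UNIV :: 'n set). 2 * (\<tau> * sqrt \<delta>))"
      proof (rule sum_mono)
        fix i show "cmod (v $ i) \<le> 2 * (\<tau> * sqrt \<delta>)" using c[of i] s1[of i] by linarith
      qed
      also have "\<dots> = sqrt \<delta> / 8" using N by (simp add: \<tau>_def N_def)
      also have "\<dots> < sqrt \<delta> / 4" using \<delta> by simp
      finally show ?thesis using 1 by (simp add: E_def V)
    qed
    have "(4 * \<tau>\<^sup>2) ^ N * \<delta> ^ Suc N = (2 * s k) * (2 * s k) * (4 * \<tau>\<^sup>2 * \<delta>) ^ (N - 1)"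
      using N by (cases N) (simp_all add: s_def power_mult_distrib power2_eq_square)
    also have "\<dots> = (2 * s k) * (2 * s k) * (\<Prod>i\<in>UNIV - {k}. (2 * s i) * (2 * s i))"
    proof -
      have "(\<Prod>i\<in>UNIV - {k}. (2 * s i) * (2 * s i)) = (\<Prod>i\<in>UNIV - {k}. 4 * \<tau>\<^sup>2 * \<delta>)"
        using \<delta> by (intro prod.cong) (auto simp: s_def power2_eq_square)
      also have "\<dots> = (4 * \<tau>\<^sup>2 * \<delta>) ^ (N - 1)" by (simp add: N_def card_Diff_singleton)
      finally show ?thesis by simp
    qed
    also have "\<dots> = (\<Prod>i\<in>UNIV. (2 * s i) * (2 * s i))" by (simp add: prod.remove)
    finally have "ennreal ((4 * \<tau>\<^sup>2) ^ N * \<delta> ^ Suc N) = emeasure lborel Q" using Q by simp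
    also have "\<dots> = (\<integral>\<^sup>+v. indicator Q v \<partial>lborel)" using Q by simp
    also have "\<dots> \<le> (\<integral>\<^sup>+v. indicator E (V v) \<partial>lborel)"
      by (intro nn_integral_mono) (use sub in \<open>auto simp: indicator_def\<close>)
    also have "\<dots> = emeasure lborel E"
      using nn_integral_lborel_isometry[OF V(1,2), of "indicator E"] by simp
    finally show "ennreal ((4 * \<tau>\<^sup>2) ^ N * \<delta> ^ Suc CARD('n)) \<le> emeasure lborel {v. cmod (hinner v \<eta>) < \<delta> / 4 \<and> norm v < sqrt \<delta> / 4}"
      unfolding E_def N_def .
  qed
qed

text \<open>Displacements orthogonal to w are of order sqrt \<delta> with \<delta> = 1 - |w|, but
  they enter |w + v|^2 only quadratically. So the nonisotropic ball around w stays in a shell whose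
  distance to the sphere is comparable to \<delta>. Keeping the shell in the bound lets the Hardy
  case use its thickness and the Bergman case the size of the weight on it.\<close>

lemma point_evaluation_annulus:
  obtains c where "c > 0" "\<And>(g :: complex ^ 'n \<Rightarrow> complex) w. holomorphic_on_ball g \<Longrightarrow> norm w < 1 \<Longrightarrow>
    ennreal (c * (1 - norm w) ^ Suc CARD('n) * (cmod (g w))\<^sup>2) \<le>
    (\<integral>\<^sup>+z. ennreal ((cmod (g z))\<^sup>2) *
       indicator {z. 1 - 5/4 * (1 - norm w) \<le> norm z \<and> norm z \<le> 1 - 7/16 * (1 - norm w)} z \<partial>nu)"
proof -
  obtain c where c: "c > 0" "\<And>(\<eta> :: complex ^ 'n) \<delta>. norm \<eta> = 1 \<Longrightarrow> 0 < \<delta> \<Longrightarrow> \<delta> \<le> 1 \<Longrightarrow>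
    ennreal (c * \<delta> ^ Suc CARD('n)) \<le> emeasure lborel {v. cmod (hinner v \<eta>) < \<delta> / 4 \<and> norm v < sqrt \<delta> / 4}"
    using emeasure_nonisotropic_ball_ge by blast
  define m where "m = measure lborel (unit_ball :: (complex ^ 'n) set)"
  have em: "emeasure lborel (unit_ball :: (complex ^ 'n) set) = ennreal m"
    using emeasure_lborel_ball_pos_finite[of 1 "0::complex^'n"] by (simp add: m_def emeasure_eq_ennreal_measure)
  have m: "m > 0" using emeasure_lborel_ball_pos_finite(1)[of 1 "0::complex^'n"] em by (simp add: ennreal_less_zero_iff)
  show thesis
  proof (rule that[of "c / m"])
    show "c / m > 0" using c m by simp
    fix g :: "complex ^ 'n \<Rightarrow> complex" and w :: "complex ^ 'n"
    assume g: "holomorphic_on_ball g" and w: "norm w < 1"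
    define \<delta> where "\<delta> = 1 - norm w"
    have \<delta>: "0 < \<delta>" "\<delta> \<le> 1" using w by (auto simp: \<delta>_def)
    \<comment> \<open>At the origin no direction is distinguished, and any unit vector serves as
      \<eta>.\<close>
    define \<eta> where "\<eta> = (if w = 0 then axis undefined 1 else w /\<^sub>R norm w)"
    have \<eta>: "norm \<eta> = 1" by (simp add: \<eta>_def)
    have w\<eta>: "w = norm w *\<^sub>R \<eta>" by (simp add: \<eta>_def)
    define E where "E = {v. cmod (hinner v \<eta>) < \<delta> / 4 \<and> norm v < sqrt \<delta> / 4}"
    have [measurable]: "E \<in> sets borel" unfolding E_def by measurable
    define A where "A = {z :: complex ^ 'n. 1 - 5/4 * \<delta> \<le> norm z \<and> norm z \<le> 1 - 7/16 * \<delta>}"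
    have [measurable]: "A \<in> sets borel" unfolding A_def by measurable
    have AB: "A \<subseteq> unit_ball" using \<delta> by (auto simp: A_def)
    have wA: "w + v \<in> A" if v: "v \<in> E" for v
    proof -
      define x where "x = Re (hinner v \<eta>)"
      have x: "x \<le> \<delta> / 4" using complex_Re_le_cmod[of "hinner v \<eta>"] v by (simp add: x_def E_def)
      have "(norm v)\<^sup>2 \<le> (sqrt \<delta> / 4)\<^sup>2" using v by (intro power_mono) (auto simp: E_def)
      hence v2: "(norm v)\<^sup>2 \<le> \<delta> / 16" using \<delta> by (simp add: power_divide)
      \<comment> \<open>The constant 7/16 is admissible by this expansion, with |v|^2 \<le>
        \<delta>/16 and Re <v, \<eta>> \<le> \<delta>/4. The constant 5/4 comes from |w + v| \<ge>
        |<w + v, \<eta>>| \<ge> |w| - \<delta>/4.\<close>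
      have "(norm (w + v))\<^sup>2 = (norm w)\<^sup>2 + (norm v)\<^sup>2 + 2 * (v \<bullet> w)"
        by (simp add: power2_norm_eq_inner inner_add inner_commute)
      also have "v \<bullet> w = (1 - \<delta>) * x"
        by (subst w\<eta>) (simp add: \<delta>_def x_def Re_hinner)
      also have "(norm w)\<^sup>2 + (norm v)\<^sup>2 + 2 * ((1 - \<delta>) * x) \<le> (1 - \<delta>)\<^sup>2 + \<delta> / 16 + 2 * ((1 - \<delta>) * (\<delta> / 4))"
        using v2 x \<delta> by (intro add_mono mult_left_mono) (auto simp: \<delta>_def)
      also have "\<dots> \<le> (1 - 7/16 * \<delta>)\<^sup>2"
      proof -
        have "0 \<le> \<delta> * (9/16 - \<delta> * (79/256))" using \<delta> by (intro mult_nonneg_nonneg) auto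
        moreover have "(1 - 7/16 * \<delta>)\<^sup>2 - ((1 - \<delta>)\<^sup>2 + \<delta> / 16 + 2 * ((1 - \<delta>) * (\<delta> / 4))) = \<delta> * (9/16 - \<delta> * (79/256))"
          by (simp add: power2_eq_square field_simps)
        ultimately show ?thesis by linarith
      qed
      finally have u: "norm (w + v) \<le> 1 - 7/16 * \<delta>" using \<delta> by (rule_tac power2_le_imp_le) auto
      have "hinner (w + v) \<eta> = of_real (norm w) + hinner v \<eta>"
        by (subst w\<eta>) (simp add: hinner_add_left hinner_scaleR_left hinner_self \<eta>)
      hence "norm w - cmod (hinner v \<eta>) \<le> cmod (hinner (w + v) \<eta>)"
        using norm_diff_ineq[of "of_real (norm w)" "hinner v \<eta>"] by simp
      hence "norm w - cmod (hinner v \<eta>) \<le> norm (w + v)" using cmod_hinner_le[of "w + v" \<eta>] \<eta> by simp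
      moreover have "cmod (hinner v \<eta>) < \<delta> / 4" using v by (simp add: E_def)
      ultimately have "1 - 5/4 * \<delta> \<le> norm (w + v)" unfolding \<delta>_def by argo
      thus ?thesis using u by (simp add: A_def)
    qed
    define h where "h = (\<lambda>z. ennreal ((cmod (g z))\<^sup>2) * indicator A z)"
    have [measurable]: "h \<in> borel_measurable borel"
      unfolding h_def by (rule holomorphic_on_ball_measurable[OF g _ AB]) simp
    have "ennreal (c * \<delta> ^ Suc CARD('n) * (cmod (g w))\<^sup>2) = ennreal ((cmod (g w))\<^sup>2) * ennreal (c * \<delta> ^ Suc CARD('n))"
      using c \<delta> by (subst ennreal_mult[symmetric]) (auto simp: mult_ac)
    also have "\<dots> \<le> ennreal ((cmod (g w))\<^sup>2) * emeasure lborel E"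
      unfolding E_def by (intro mult_left_mono c(2) \<eta> \<delta>) simp
    also have "\<dots> \<le> (\<integral>\<^sup>+v. ennreal ((cmod (g (w + v)))\<^sup>2) * indicator E v \<partial>lborel)"
    proof (rule sub_mean_value_balanced[OF g])
      show "c *s v \<in> E" if "v \<in> E" "cmod c \<le> 1" for c v
        using that mult_right_mono[of "cmod c" 1 "norm v"] mult_right_mono[of "cmod c" 1 "cmod (hinner v \<eta>)"]
        by (auto simp: E_def hinner_smult_left norm_mult norm_vector_smult)
      show "w + v \<in> unit_ball" if "v \<in> E" for v using wA[OF that] AB by blast
    qed simp
    also have "\<dots> \<le> (\<integral>\<^sup>+v. h (w + v) \<partial>lborel)"
      by (intro nn_integral_mono) (use wA in \<open>auto simp: h_def indicator_def\<close>)
    also have "\<dots> = (\<integral>\<^sup>+v. h v \<partial>lborel)" by (rule nn_integral_lborel_translate) simp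
    also have "\<dots> = (\<integral>\<^sup>+v. h v * indicator unit_ball v \<partial>lborel)"
      by (intro nn_integral_cong) (use AB in \<open>auto simp: h_def indicator_def\<close>)
    finally have "ennreal (c * \<delta> ^ Suc CARD('n) * (cmod (g w))\<^sup>2) / ennreal m
        \<le> (\<integral>\<^sup>+v. h v * indicator unit_ball v \<partial>lborel) / ennreal m"
      by (rule divide_right_mono_ennreal)
    also have "\<dots> = (\<integral>\<^sup>+z. h z \<partial>nu)" unfolding em[symmetric] by (rule nn_integral_nu[symmetric]) simp
    also have "ennreal (c * \<delta> ^ Suc CARD('n) * (cmod (g w))\<^sup>2) / ennreal m = ennreal (c / m * \<delta> ^ Suc CARD('n) * (cmod (g w))\<^sup>2)"
      using c m \<delta> by (subst divide_ennreal) auto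
    finally show "ennreal (c / m * (1 - norm w) ^ Suc CARD('n) * (cmod (g w))\<^sup>2) \<le>
      (\<integral>\<^sup>+z. ennreal ((cmod (g z))\<^sup>2) *
       indicator {z. 1 - 5/4 * (1 - norm w) \<le> norm z \<and> norm z \<le> 1 - 7/16 * (1 - norm w)} z \<partial>nu)"
      unfolding h_def A_def \<delta>_def .
  qed
qed

lemma nn_integral_nu_polar_sphere:
  fixes h :: "complex ^ 'n \<Rightarrow> ennreal"
  assumes h[measurable]: "h \<in> borel_measurable borel"
  shows "(\<integral>\<^sup>+z. h z \<partial>nu) =
    (\<integral>\<^sup>+r. ennreal (indicator {0<..<1} r * (real (2 * CARD('n)) * r ^ (2 * CARD('n) - 1))) *
       (\<integral>\<^sup>+\<zeta>\<in>unit_sphere. h (r *\<^sub>R \<zeta>) \<partial>sigma_sphere) \<partial>lborel)"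
  unfolding nn_integral_nu_polar[OF h]
  by (subst sphere_nn_integral_eq) simp_all

section \<open>Hardy and Bergman spaces\<close>

text \<open>The exponent of \<epsilon> offsets the growth of the kernel: when \<beta> < 2p, the
  squared norm of 1/(1 + \<epsilon> - <z, \<eta>>)^p is at most of order \<epsilon>^-(2p - \<beta>)
  in both kinds of space.\<close>

definition test_function :: "complex ^ 'n \<Rightarrow> real \<Rightarrow> nat \<Rightarrow> real \<Rightarrow> complex ^ 'n \<Rightarrow> complex" where
  "test_function \<eta> \<beta> p \<epsilon> z = of_real (\<epsilon> powr (real p - \<beta> / 2)) / (1 + of_real \<epsilon> - hinner z \<eta>) ^ p"

text \<open>The interface between the spaces and the compactness argument. Membership of differences
  lets the evaluation bound apply to an image minus the limit of the images; the last constant is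
  uniform in \<eta> and \<epsilon>.\<close>

locale evaluation_test_space =
  fixes H :: "(complex ^ 'n \<Rightarrow> complex) set" and nrm :: "(complex ^ 'n \<Rightarrow> complex) \<Rightarrow> real" and \<beta> :: real
  assumes diff_mem: "f \<in> H \<Longrightarrow> g \<in> H \<Longrightarrow> (\<lambda>z. f z - g z) \<in> H"
    and point_evaluation: "\<exists>C. \<forall>f\<in>H. \<forall>w. norm w < 1 \<longrightarrow> cmod (f w) * (1 - norm w) powr (\<beta> / 2) \<le> C * nrm f"
    and test_function_bounded: "\<beta> < 2 * real p \<Longrightarrow> \<exists>C. \<forall>\<eta> \<epsilon>. norm \<eta> = 1 \<longrightarrow> 0 < \<epsilon> \<longrightarrow>
      test_function \<eta> \<beta> p \<epsilon> \<in> H \<and> nrm (test_function \<eta> \<beta> p \<epsilon>) \<le> C"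

section \<open>Spherical means, of general functions and of the test functions\<close>

definition sphere_mean :: "(complex ^ 'n \<Rightarrow> complex) \<Rightarrow> real \<Rightarrow> ennreal" where
  "sphere_mean f r = (\<integral>\<^sup>+\<zeta>\<in>unit_sphere. ennreal ((cmod (f (r *\<^sub>R \<zeta>)))\<^sup>2) \<partial>sigma_sphere)"

lemma hardy_sqnorm_eq: "hardy_sqnorm f = (SUP r\<in>{0<..<1}. sphere_mean f r)"
  by (simp add: hardy_sqnorm_def sphere_mean_def)

lemma sets_sigma_sphere [simp, measurable_cong]: "sets sigma_sphere = sets borel"
  by (simp add: sigma_sphere_def)

lemma sphere_integrand_measurable:
  fixes f :: "complex ^ 'n \<Rightarrow> complex"
  assumes f: "holomorphic_on_ball f" and r: "0 < r" "r < 1"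
  shows "(\<lambda>\<zeta>. ennreal ((cmod (f (r *\<^sub>R \<zeta>)))\<^sup>2) * indicator unit_sphere \<zeta>) \<in> borel_measurable borel"
proof -
  define G where "G = (\<lambda>z. ennreal ((cmod (f z))\<^sup>2) * indicator unit_ball z)"
  have [measurable]: "G \<in> borel_measurable borel"
    unfolding G_def by (rule holomorphic_on_ball_measurable[OF f]) auto
  have [measurable]: "unit_sphere \<in> sets (borel :: (complex^'n) measure)" by simp
  have "ennreal ((cmod (f (r *\<^sub>R \<zeta>)))\<^sup>2) * indicator unit_sphere \<zeta> = G (r *\<^sub>R \<zeta>) * indicator unit_sphere \<zeta>" for \<zeta>
    using r by (auto simp: G_def indicator_def)
  moreover have "(\<lambda>\<zeta>. G (r *\<^sub>R \<zeta>) * indicator unit_sphere \<zeta>) \<in> borel_measurable borel" by measurable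
  ultimately show ?thesis by (simp only:)
qed

lemma sphere_mean_eq:
  fixes f :: "complex ^ 'n \<Rightarrow> complex"
  assumes f: "holomorphic_on_ball f" and r: "0 < r" "r < 1"
  shows "sphere_mean f r = (\<integral>\<^sup>+z. ennreal ((cmod (f (r *\<^sub>R (z /\<^sub>R norm z))))\<^sup>2) \<partial>nu)"
proof -
  define G where "G = (\<lambda>z. ennreal ((cmod (f z))\<^sup>2) * indicator unit_ball z)"
  have [measurable]: "G \<in> borel_measurable borel"
    unfolding G_def by (rule holomorphic_on_ball_measurable[OF f]) auto
  have "sphere_mean f r = (\<integral>\<^sup>+\<zeta>\<in>unit_sphere. G (r *\<^sub>R \<zeta>) \<partial>sigma_sphere)"
    unfolding sphere_mean_def by (intro nn_integral_cong) (use r in \<open>auto simp: G_def indicator_def\<close>)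
  also have "\<dots> = (\<integral>\<^sup>+z. G (r *\<^sub>R (z /\<^sub>R norm z)) \<partial>nu)"
    by (rule sphere_nn_integral_eq) simp
  also have "\<dots> = (\<integral>\<^sup>+z. ennreal ((cmod (f (r *\<^sub>R (z /\<^sub>R norm z))))\<^sup>2) \<partial>nu)"
  proof (rule nn_integral_cong)
    fix z :: "complex ^ 'n"
    have "norm (r *\<^sub>R (z /\<^sub>R norm z)) < 1" using r by (cases "z = 0") (auto simp: mult.assoc)
    thus "G (r *\<^sub>R (z /\<^sub>R norm z)) = ennreal ((cmod (f (r *\<^sub>R (z /\<^sub>R norm z))))\<^sup>2)"
      by (simp add: G_def indicator_def)
  qed
  finally show ?thesis .
qed

lemma cmod_diff_sqr_le: "(cmod (a - b))\<^sup>2 \<le> 2 * (cmod a)\<^sup>2 + 2 * (cmod b)\<^sup>2"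
proof -
  have "(cmod (a - b))\<^sup>2 \<le> (cmod a + cmod b)\<^sup>2" by (intro power_mono norm_triangle_ineq4) simp
  also have "\<dots> \<le> 2 * (cmod a)\<^sup>2 + 2 * (cmod b)\<^sup>2"
    using sum_squares_bound[of "cmod a" "cmod b"] by (simp add: power2_sum)
  finally show ?thesis .
qed

lemma holomorphic_on_ball_diff:
  assumes "holomorphic_on_ball f" "holomorphic_on_ball g"
  shows "holomorphic_on_ball (\<lambda>z. f z - g z)"
  unfolding holomorphic_on_ball_def
proof
  fix z :: "complex^'a" assume z: "z \<in> unit_ball"
  obtain D where D: "(f has_derivative D) (at z)" "\<And>c v. D (c *s v) = c * D v"
    using assms(1) z unfolding holomorphic_on_ball_def by blast
  obtain D' where D': "(g has_derivative D') (at z)" "\<And>c v. D' (c *s v) = c * D' v"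
    using assms(2) z unfolding holomorphic_on_ball_def by blast
  show "\<exists>D. ((\<lambda>z. f z - g z) has_derivative D) (at z) \<and> (\<forall>c v. D (c *s v) = c * D v)"
    using has_derivative_diff[OF D(1) D'(1)] D(2) D'(2)
    by (intro exI[of _ "\<lambda>h. D h - D' h"]) (simp add: right_diff_distrib)
qed

lemma test_function_nz:
  assumes "norm \<eta> = 1" "\<epsilon> > 0" "norm z \<le> 1"
  shows "1 + of_real \<epsilon> - hinner z \<eta> \<noteq> 0"
proof
  assume "1 + of_real \<epsilon> - hinner z \<eta> = 0"
  hence "hinner z \<eta> = of_real (1 + \<epsilon>)" by (simp add: algebra_simps)
  hence "cmod (hinner z \<eta>) = 1 + \<epsilon>" using assms(2) by (simp only: norm_of_real)
  thus False using cmod_hinner_le[of z \<eta>] assms by simp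
qed

lemma holomorphic_test_function:
  fixes \<eta> :: "complex ^ 'n"
  assumes \<eta>: "norm \<eta> = 1" and \<epsilon>: "\<epsilon> > 0"
  shows "holomorphic_on_ball (test_function \<eta> \<beta> p \<epsilon>)"
  unfolding holomorphic_on_ball_def
proof
  fix z :: "complex ^ 'n" assume z: "z \<in> unit_ball"
  define F where "F = (\<lambda>x::complex. of_real (\<epsilon> powr (real p - \<beta> / 2)) / (1 + of_real \<epsilon> - x) ^ p)"
  have "F holomorphic_on - {1 + of_real \<epsilon>}"
    unfolding F_def by (intro holomorphic_intros) auto
  moreover have "open (- {1 + complex_of_real \<epsilon>})" by auto
  moreover have "hinner z \<eta> \<in> - {1 + of_real \<epsilon>}"
    using test_function_nz[OF \<eta> \<epsilon>, of z] z by auto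
  ultimately obtain F' where F': "(F has_field_derivative F') (at (hinner z \<eta>))"
    using holomorphic_on_imp_differentiable_at field_differentiable_def by blast
  have "bounded_linear (\<lambda>z. hinner z \<eta>)"
    by (rule bounded_linear_intro[where K = "norm \<eta>"])
       (simp_all add: hinner_add_left hinner_scaleR_left cmod_hinner_le scaleR_conv_of_real[where 'a = complex])
  hence "((\<lambda>z. hinner z \<eta>) has_derivative (\<lambda>h. hinner h \<eta>)) (at z)" by (rule bounded_linear_imp_has_derivative)
  from has_derivative_compose[OF this F'[unfolded has_field_derivative_def]]
  have "(test_function \<eta> \<beta> p \<epsilon> has_derivative (\<lambda>h. F' * hinner h \<eta>)) (at z)"
    unfolding F_def test_function_def[abs_def] .
  thus "\<exists>D. (test_function \<eta> \<beta> p \<epsilon> has_derivative D) (at z) \<and> (\<forall>c v. D (c *s v) = c * D v)"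
    by (intro exI[of _ "\<lambda>h. F' * hinner h \<eta>"]) (simp add: hinner_smult_left)
qed

lemma sphere_mean_test_function:
  assumes p: "CARD('n) < 2 * p"
  obtains C where "C \<ge> 0" "\<And>(\<eta> :: complex ^ 'n) \<beta> \<epsilon> r. norm \<eta> = 1 \<Longrightarrow> \<epsilon> > 0 \<Longrightarrow> 0 < r \<Longrightarrow> r < 1 \<Longrightarrow>
    sphere_mean (test_function \<eta> \<beta> p \<epsilon>) r
      \<le> ennreal (\<epsilon> powr (2 * real p - \<beta>) * (C / (\<epsilon> + (1 - r)) ^ (2 * p - CARD('n))))"
proof -
  obtain C where C: "C \<ge> 0" "\<And>(\<eta> :: complex ^ 'n) \<epsilon> r. norm \<eta> = 1 \<Longrightarrow> \<epsilon> > 0 \<Longrightarrow> 0 < r \<Longrightarrow> r < 1 \<Longrightarrow>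
    (\<integral>\<^sup>+z. ennreal ((cmod (1 / (1 + of_real \<epsilon> - hinner (r *\<^sub>R (z /\<^sub>R norm z)) \<eta>) ^ p))\<^sup>2) \<partial>nu)
      \<le> ennreal (C / (\<epsilon> + (1 - r)) ^ (2 * p - CARD('n)))"
    using test_function_sphere_mean[OF p] by blast
  show thesis
  proof (rule that[OF C(1)])
    fix \<eta> :: "complex ^ 'n" and \<beta> \<epsilon> r :: real
    assume \<eta>: "norm \<eta> = 1" and \<epsilon>: "\<epsilon> > 0" and r: "0 < r" "r < 1"
    define k where "k = (\<lambda>z. 1 / (1 + of_real \<epsilon> - hinner (r *\<^sub>R (z /\<^sub>R norm z)) \<eta>) ^ p)"
    have [measurable]: "k \<in> borel_measurable borel" unfolding k_def by measurable
    have "(\<epsilon> powr (real p - \<beta> / 2))\<^sup>2 = \<epsilon> powr (2 * real p - \<beta>)"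
      using \<epsilon> by (simp add: power2_eq_square powr_add[symmetric])
    hence "(cmod (test_function \<eta> \<beta> p \<epsilon> (r *\<^sub>R (z /\<^sub>R norm z))))\<^sup>2 = \<epsilon> powr (2 * real p - \<beta>) * (cmod (k z))\<^sup>2" for z
      by (simp add: test_function_def k_def norm_divide power_divide)
    hence "sphere_mean (test_function \<eta> \<beta> p \<epsilon>) r = (\<integral>\<^sup>+z. ennreal (\<epsilon> powr (2 * real p - \<beta>)) * ennreal ((cmod (k z))\<^sup>2) \<partial>nu)"
      unfolding sphere_mean_eq[OF holomorphic_test_function[OF \<eta> \<epsilon>] r] by (simp add: ennreal_mult)
    also have "\<dots> = ennreal (\<epsilon> powr (2 * real p - \<beta>)) * (\<integral>\<^sup>+z. ennreal ((cmod (k z))\<^sup>2) \<partial>nu)"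
      by (rule nn_integral_cmult) simp
    also have "\<dots> \<le> ennreal (\<epsilon> powr (2 * real p - \<beta>)) * ennreal (C / (\<epsilon> + (1 - r)) ^ (2 * p - CARD('n)))"
      unfolding k_def by (intro mult_left_mono C(2) \<eta> \<epsilon> r) simp
    also have "\<dots> = ennreal (\<epsilon> powr (2 * real p - \<beta>) * (C / (\<epsilon> + (1 - r)) ^ (2 * p - CARD('n))))"
      using C(1) \<epsilon> r by (intro ennreal_mult[symmetric]) auto
    finally show "sphere_mean (test_function \<eta> \<beta> p \<epsilon>) r
      \<le> ennreal (\<epsilon> powr (2 * real p - \<beta>) * (C / (\<epsilon> + (1 - r)) ^ (2 * p - CARD('n))))" .
  qed
qed

section \<open>Verification of the interface for Hardy and Bergman spaces\<close>

lemma evaluation_bound_from_sqr: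
  assumes "c > 0" "\<delta> > 0" and S: "S < \<infinity>" and le: "ennreal (c * \<delta> powr \<beta> * x\<^sup>2) \<le> S" and x: "x \<ge> 0"
  shows "x * \<delta> powr (\<beta> / 2) \<le> 1 / sqrt c * sqrt (enn2real S)"
proof -
  have "c * \<delta> powr \<beta> * x\<^sup>2 \<le> enn2real S"
    using le S assms(1) by (subst (asm) ennreal_enn2real[symmetric, of S]) (auto simp: less_top[symmetric])
  moreover have "(\<delta> powr (\<beta> / 2))\<^sup>2 = \<delta> powr \<beta>" using assms(2) by (simp add: power2_eq_square powr_add[symmetric])
  ultimately have "(sqrt c * (x * \<delta> powr (\<beta> / 2)))\<^sup>2 \<le> enn2real S"
    using assms(1) by (simp add: power_mult_distrib mult_ac)
  hence "sqrt c * (x * \<delta> powr (\<beta> / 2)) \<le> sqrt (enn2real S)" by (rule real_le_rsqrt)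
  thus ?thesis using assms(1) by (simp add: field_simps)
qed

text \<open>For the evaluation bound the shell is integrated in polar coordinates: each spherical
  mean is at most the squared norm, and the thickness of the shell is at most \<delta>. This removes
  one factor from \<delta>^(N+1) and leaves \<beta> = N.\<close>

lemma hardy_evaluation_test_space:
  "evaluation_test_space (hardy_space :: (complex ^ 'n \<Rightarrow> complex) set) hardy_norm (real CARD('n))"
proof
  fix f g :: "complex ^ 'n \<Rightarrow> complex" assume "f \<in> hardy_space" "g \<in> hardy_space"
  hence f: "holomorphic_on_ball f" "hardy_sqnorm f < \<infinity>" and g: "holomorphic_on_ball g" "hardy_sqnorm g < \<infinity>"
    by (auto simp: hardy_space_def)
  have "sphere_mean (\<lambda>z. f z - g z) r \<le> 2 * hardy_sqnorm f + 2 * hardy_sqnorm g" if r: "r \<in> {0<..<1}" for r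
  proof -
    note [measurable] = sphere_integrand_measurable[OF f(1), of r] sphere_integrand_measurable[OF g(1), of r]
    have "sphere_mean (\<lambda>z. f z - g z) r \<le> (\<integral>\<^sup>+\<zeta>. 2 * (ennreal ((cmod (f (r *\<^sub>R \<zeta>)))\<^sup>2) * indicator unit_sphere \<zeta>)
        + 2 * (ennreal ((cmod (g (r *\<^sub>R \<zeta>)))\<^sup>2) * indicator unit_sphere \<zeta>) \<partial>sigma_sphere)"
      unfolding sphere_mean_def
    proof (rule nn_integral_mono)
      fix \<zeta> :: "complex ^ 'n"
      have "ennreal ((cmod (f (r *\<^sub>R \<zeta>) - g (r *\<^sub>R \<zeta>)))\<^sup>2) \<le> ennreal (2 * (cmod (f (r *\<^sub>R \<zeta>)))\<^sup>2 + 2 * (cmod (g (r *\<^sub>R \<zeta>)))\<^sup>2)"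
        by (intro ennreal_leI cmod_diff_sqr_le)
      also have "\<dots> = 2 * ennreal ((cmod (f (r *\<^sub>R \<zeta>)))\<^sup>2) + 2 * ennreal ((cmod (g (r *\<^sub>R \<zeta>)))\<^sup>2)"
        by (simp add: ennreal_mult)
      finally show "ennreal ((cmod (f (r *\<^sub>R \<zeta>) - g (r *\<^sub>R \<zeta>)))\<^sup>2) * indicator unit_sphere \<zeta>
         \<le> 2 * (ennreal ((cmod (f (r *\<^sub>R \<zeta>)))\<^sup>2) * indicator unit_sphere \<zeta>)
        + 2 * (ennreal ((cmod (g (r *\<^sub>R \<zeta>)))\<^sup>2) * indicator unit_sphere \<zeta>)"
        by (simp split: split_indicator)
    qed
    also have "\<dots> = 2 * sphere_mean f r + 2 * sphere_mean g r"
      unfolding sphere_mean_def using r sphere_integrand_measurable[OF f(1), of r] sphere_integrand_measurable[OF g(1), of r]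
      by (subst nn_integral_add) (simp_all add: nn_integral_cmult)
    also have "\<dots> \<le> 2 * hardy_sqnorm f + 2 * hardy_sqnorm g"
      unfolding hardy_sqnorm_eq using r by (intro add_mono mult_left_mono SUP_upper) auto
    finally show ?thesis .
  qed
  hence "hardy_sqnorm (\<lambda>z. f z - g z) \<le> 2 * hardy_sqnorm f + 2 * hardy_sqnorm g"
    unfolding hardy_sqnorm_eq[of "\<lambda>z. f z - g z"] by (rule SUP_least)
  also have "\<dots> < \<infinity>" using f(2) g(2) by (simp add: ennreal_mult_less_top)
  finally show "(\<lambda>z. f z - g z) \<in> hardy_space"
    using holomorphic_on_ball_diff[OF f(1) g(1)] by (simp add: hardy_space_def)
next
  obtain c where c: "c > 0" "\<And>(g :: complex ^ 'n \<Rightarrow> complex) w. holomorphic_on_ball g \<Longrightarrow> norm w < 1 \<Longrightarrow>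
    ennreal (c * (1 - norm w) ^ Suc CARD('n) * (cmod (g w))\<^sup>2) \<le>
    (\<integral>\<^sup>+z. ennreal ((cmod (g z))\<^sup>2) *
       indicator {z. 1 - 5/4 * (1 - norm w) \<le> norm z \<and> norm z \<le> 1 - 7/16 * (1 - norm w)} z \<partial>nu)"
    using point_evaluation_annulus by blast
  define N where "N = CARD('n)"
  have N: "N > 0" by (simp add: N_def)
  \<comment> \<open>2N bounds the radial density 2N r^(2N-1) of normalised volume.\<close>
  define c' where "c' = c / (2 * real N)"
  have c': "c' > 0" using c N by (simp add: c'_def)
  show "\<exists>C. \<forall>f\<in>hardy_space. \<forall>w::complex^'n. norm w < 1 \<longrightarrow> cmod (f w) * (1 - norm w) powr (real CARD('n) / 2) \<le> C * hardy_norm f"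
  proof (intro exI ballI allI impI)
    fix f :: "complex ^ 'n \<Rightarrow> complex" and w :: "complex ^ 'n" assume "f \<in> hardy_space" and w: "norm w < 1"
    hence f: "holomorphic_on_ball f" "hardy_sqnorm f < \<infinity>" by (auto simp: hardy_space_def)
    define \<delta> where "\<delta> = 1 - norm w"
    have \<delta>: "\<delta> > 0" using w by (simp add: \<delta>_def)
    define A where "A = {z :: complex ^ 'n. 1 - 5/4 * \<delta> \<le> norm z \<and> norm z \<le> 1 - 7/16 * \<delta>}"
    have [measurable]: "A \<in> sets borel" unfolding A_def by measurable
    have AB: "A \<subseteq> unit_ball" using \<delta> by (auto simp: A_def)
    define h where "h = (\<lambda>z. ennreal ((cmod (f z))\<^sup>2) * indicator A z)"
    have [measurable]: "h \<in> borel_measurable borel"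
      unfolding h_def by (rule holomorphic_on_ball_measurable[OF f(1) _ AB]) simp
    define I where "I = {1 - 5/4 * \<delta> .. 1 - 7/16 * \<delta>}"
    have "(\<integral>\<^sup>+z. h z \<partial>nu) = (\<integral>\<^sup>+r. ennreal (indicator {0<..<1} r * (real (2 * CARD('n)) * r ^ (2 * CARD('n) - 1))) *
       (\<integral>\<^sup>+\<zeta>\<in>unit_sphere. h (r *\<^sub>R \<zeta>) \<partial>sigma_sphere) \<partial>lborel)"
      by (rule nn_integral_nu_polar_sphere) simp
    also have "\<dots> \<le> (\<integral>\<^sup>+r. (ennreal (2 * real N) * hardy_sqnorm f) * indicator I r \<partial>lborel)"
    proof (rule nn_integral_mono)
      fix r :: real
      show "ennreal (indicator {0<..<1} r * (real (2 * CARD('n)) * r ^ (2 * CARD('n) - 1))) *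
         (\<integral>\<^sup>+\<zeta>\<in>unit_sphere. h (r *\<^sub>R \<zeta>) \<partial>sigma_sphere) \<le> (ennreal (2 * real N) * hardy_sqnorm f) * indicator I r"
      proof (cases "r \<in> {0<..<1}")
        case True
        have 1: "ennreal (indicator {0<..<1} r * (real (2 * CARD('n)) * r ^ (2 * CARD('n) - 1))) \<le> ennreal (2 * real N)"
          using True by (intro ennreal_leI) (auto simp: N_def mult_left_le power_le_one)
        have 2: "(\<integral>\<^sup>+\<zeta>\<in>unit_sphere. h (r *\<^sub>R \<zeta>) \<partial>sigma_sphere) \<le> hardy_sqnorm f * indicator I r"
        proof (cases "r \<in> I")
          case rI: True
          have "(\<integral>\<^sup>+\<zeta>\<in>unit_sphere. h (r *\<^sub>R \<zeta>) \<partial>sigma_sphere) \<le> sphere_mean f r"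
            unfolding sphere_mean_def by (intro nn_integral_mono) (auto simp: h_def indicator_def)
          also have "\<dots> \<le> hardy_sqnorm f" unfolding hardy_sqnorm_eq using True by (intro SUP_upper)
          finally show ?thesis using rI by simp
        next
          case rI: False
          have "h (r *\<^sub>R \<zeta>) * indicator unit_sphere \<zeta> = 0" for \<zeta>
            using rI True by (auto simp: h_def A_def I_def indicator_def)
          hence "(\<integral>\<^sup>+\<zeta>\<in>unit_sphere. h (r *\<^sub>R \<zeta>) \<partial>sigma_sphere) = (\<integral>\<^sup>+\<zeta>. 0 \<partial>(sigma_sphere :: (complex ^ 'n) measure))"
            by (simp only:)
          thus ?thesis by simp
        qed
        show ?thesis using mult_mono[OF 1 2] by (simp add: mult.assoc)
      qed simp
    qed
    also have "\<dots> = (ennreal (2 * real N) * hardy_sqnorm f) * emeasure lborel I"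
      unfolding I_def by (rule nn_integral_cmult_indicator) simp
    also have "\<dots> \<le> (ennreal (2 * real N) * hardy_sqnorm f) * ennreal \<delta>"
      unfolding I_def using \<delta> by (intro mult_left_mono) auto
    finally have "ennreal (c * \<delta> ^ Suc N * (cmod (f w))\<^sup>2) \<le> (ennreal (2 * real N) * hardy_sqnorm f) * ennreal \<delta>"
      using c(2)[OF f(1) w] unfolding h_def A_def \<delta>_def N_def by (rule order_trans[rotated])
    also have "\<dots> = ennreal (2 * real N * \<delta>) * hardy_sqnorm f"
      using \<delta> by (simp add: ennreal_mult mult_ac)
    also have "ennreal (c * \<delta> ^ Suc N * (cmod (f w))\<^sup>2) = ennreal (2 * real N * \<delta>) * ennreal (c' * \<delta> powr real N * (cmod (f w))\<^sup>2)"
      using \<delta> c c' N by (subst ennreal_mult[symmetric]) (auto simp: c'_def powr_realpow)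
    finally have "ennreal (c' * \<delta> powr real N * (cmod (f w))\<^sup>2) \<le> hardy_sqnorm f"
      using \<delta> N by (subst (asm) ennreal_mult_le_mult_iff) auto
    from evaluation_bound_from_sqr[OF c' \<delta> f(2) this]
    show "cmod (f w) * (1 - norm w) powr (real CARD('n) / 2) \<le> 1 / sqrt c' * hardy_norm f"
      by (simp add: hardy_norm_def \<delta>_def N_def)
  qed
next
  fix p :: nat assume "real CARD('n) < 2 * real p"
  hence p: "CARD('n) < 2 * p" by linarith
  obtain C where C: "C \<ge> 0" "\<And>(\<eta> :: complex ^ 'n) \<beta> \<epsilon> r. norm \<eta> = 1 \<Longrightarrow> \<epsilon> > 0 \<Longrightarrow> 0 < r \<Longrightarrow> r < 1 \<Longrightarrow>
    sphere_mean (test_function \<eta> \<beta> p \<epsilon>) r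
      \<le> ennreal (\<epsilon> powr (2 * real p - \<beta>) * (C / (\<epsilon> + (1 - r)) ^ (2 * p - CARD('n))))"
    using sphere_mean_test_function[OF p] by blast
  show "\<exists>C. \<forall>\<eta> \<epsilon>. norm (\<eta> :: complex ^ 'n) = 1 \<longrightarrow> 0 < \<epsilon> \<longrightarrow>
      test_function \<eta> (real CARD('n)) p \<epsilon> \<in> hardy_space \<and> hardy_norm (test_function \<eta> (real CARD('n)) p \<epsilon>) \<le> C"
  proof (intro exI allI impI)
    fix \<eta> :: "complex ^ 'n" and \<epsilon> :: real assume \<eta>: "norm \<eta> = 1" and \<epsilon>: "0 < \<epsilon>"
    have le: "hardy_sqnorm (test_function \<eta> (real CARD('n)) p \<epsilon>) \<le> ennreal C"
      unfolding hardy_sqnorm_eq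
    proof (rule SUP_least)
      fix r :: real assume r: "r \<in> {0<..<1}"
      define q where "q = 2 * p - CARD('n)"
      \<comment> \<open>The squared prefactor of the test function is exactly \<epsilon>^q, and
        \<epsilon> \<le> \<epsilon> + (1 - r) makes the bound uniform in r.\<close>
      have "2 * real p - real CARD('n) = real q" using p by (simp add: q_def)
      hence "\<epsilon> powr (2 * real p - real CARD('n)) = \<epsilon> ^ q" using \<epsilon> by (simp add: powr_realpow)
      moreover have "\<epsilon> ^ q \<le> (\<epsilon> + (1 - r)) ^ q" using \<epsilon> r by (intro power_mono) auto
      hence "\<epsilon> ^ q * (C / (\<epsilon> + (1 - r)) ^ q) \<le> C"
        using C(1) \<epsilon> r by (simp add: divide_le_eq mult.commute mult_left_mono)
      ultimately show "sphere_mean (test_function \<eta> (real CARD('n)) p \<epsilon>) r \<le> ennreal C"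
        using C(2)[OF \<eta> \<epsilon>, of r "real CARD('n)"] r unfolding q_def[symmetric]
        by (auto intro: order_trans ennreal_leI)
    qed
    hence "enn2real (hardy_sqnorm (test_function \<eta> (real CARD('n)) p \<epsilon>)) \<le> C"
      using C(1) by (rule enn2real_leI[rotated])
    thus "test_function \<eta> (real CARD('n)) p \<epsilon> \<in> hardy_space \<and> hardy_norm (test_function \<eta> (real CARD('n)) p \<epsilon>) \<le> sqrt C"
      using le holomorphic_test_function[OF \<eta> \<epsilon>] order_le_less_trans[OF le ennreal_less_top]
      by (simp add: hardy_space_def hardy_norm_def)
  qed
qed

text \<open>Split at t = \<epsilon>. Below it the denominator is at least \<epsilon>^q, and t^s is
  integrable at 0 because s > -1; above it the denominator is at least t^q, and t^(s-q) is
  integrable at infinity because q > s + 1. Both parts scale as \<epsilon>^(s+1-q).\<close>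

lemma nn_integral_powr_quotient_le:
  fixes s q \<epsilon> :: real
  assumes s: "s > -1" and q: "q > s + 1" and \<epsilon>: "\<epsilon> > 0"
  shows "(\<integral>\<^sup>+t. ennreal (indicator {0<..} t * (t powr s / (\<epsilon> + t) powr q)) \<partial>lborel)
    \<le> ennreal ((1 / (s + 1) + 1 / (q - s - 1)) * \<epsilon> powr (s + 1 - q))"
proof -
  have "(\<integral>\<^sup>+t. ennreal (indicator {0<..} t * (t powr s / (\<epsilon> + t) powr q)) \<partial>lborel)
     \<le> (\<integral>\<^sup>+t. ennreal (\<epsilon> powr (- q)) * (ennreal (t powr s) * indicator {0..\<epsilon>} t) + ennreal (t powr (s - q)) * indicator {\<epsilon>..} t \<partial>lborel)"
  proof (rule nn_integral_mono)
    fix t :: real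
    show "ennreal (indicator {0<..} t * (t powr s / (\<epsilon> + t) powr q))
      \<le> ennreal (\<epsilon> powr (- q)) * (ennreal (t powr s) * indicator {0..\<epsilon>} t) + ennreal (t powr (s - q)) * indicator {\<epsilon>..} t"
    proof (cases "t > 0")
      case t: True
      show ?thesis
      proof (cases "t \<le> \<epsilon>")
        case True
        have "\<epsilon> powr q \<le> (\<epsilon> + t) powr q" using t \<epsilon> q s by (intro powr_mono2) auto
        hence "t powr s / (\<epsilon> + t) powr q \<le> t powr s / \<epsilon> powr q" using \<epsilon> t by (intro divide_left_mono mult_pos_pos) auto
        also have "\<dots> = \<epsilon> powr (- q) * t powr s" by (simp add: powr_minus divide_inverse mult.commute)
        finally have "ennreal (t powr s / (\<epsilon> + t) powr q) \<le> ennreal (\<epsilon> powr (- q)) * ennreal (t powr s)"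
          by (subst ennreal_mult[symmetric]) (auto intro: ennreal_leI)
        thus ?thesis using t True by (simp add: add_increasing2)
      next
        case False
        have "t powr q \<le> (\<epsilon> + t) powr q" using t \<epsilon> q s by (intro powr_mono2) auto
        hence "t powr s / (\<epsilon> + t) powr q \<le> t powr s / t powr q" using \<epsilon> t by (intro divide_left_mono mult_pos_pos) auto
        also have "\<dots> = t powr (s - q)" by (simp add: powr_diff)
        finally show ?thesis using t False by (simp add: ennreal_leI)
      qed
    qed simp
  qed
  also have "\<dots> = ennreal (\<epsilon> powr (- q)) * (\<integral>\<^sup>+t. ennreal (t powr s) * indicator {0..\<epsilon>} t \<partial>lborel)
      + (\<integral>\<^sup>+t. ennreal (t powr (s - q)) * indicator {\<epsilon>..} t \<partial>lborel)"
    by (subst nn_integral_add) (simp_all add: nn_integral_cmult)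
  also have "(\<integral>\<^sup>+t. ennreal (t powr s) * indicator {0..\<epsilon>} t \<partial>lborel) = ennreal (\<epsilon> powr (s + 1) / (s + 1))"
    by (rule nn_integral_has_integral_lebesgue'[OF _ has_integral_powr_from_0]) (use s \<epsilon> in auto)
  also have "(\<integral>\<^sup>+t. ennreal (t powr (s - q)) * indicator {\<epsilon>..} t \<partial>lborel) = ennreal (- (\<epsilon> powr (s - q + 1)) / (s - q + 1))"
    by (rule nn_integral_has_integral_lebesgue'[OF _ has_integral_powr_to_inf]) (use q \<epsilon> in auto)
  also have "- (\<epsilon> powr (s - q + 1)) / (s - q + 1) = 1 / (q - s - 1) * \<epsilon> powr (s + 1 - q)"
  proof -
    have "s - q + 1 = - (q - s - 1)" "s + 1 - q = s - q + 1" by simp_all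
    thus ?thesis by (metis divide_divide_eq_right minus_divide_divide mult.commute times_divide_eq_right mult_1_right)
  qed
  also have "ennreal (\<epsilon> powr (- q)) * ennreal (\<epsilon> powr (s + 1) / (s + 1)) = ennreal (1 / (s + 1) * \<epsilon> powr (s + 1 - q))"
  proof -
    have "\<epsilon> powr (- q) * \<epsilon> powr (s + 1) = \<epsilon> powr (s + 1 - q)" by (simp add: powr_add[symmetric])
    thus ?thesis using s by (subst ennreal_mult[symmetric]) auto
  qed
  also have "ennreal (1 / (s + 1) * \<epsilon> powr (s + 1 - q)) + ennreal (1 / (q - s - 1) * \<epsilon> powr (s + 1 - q))
     = ennreal ((1 / (s + 1) + 1 / (q - s - 1)) * \<epsilon> powr (s + 1 - q))"
    using s q by (subst ennreal_plus[symmetric]) (auto simp: distrib_right)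
  finally show ?thesis .
qed

text \<open>The weight is radial and comes out of the spherical integral, so the estimate of
  spherical means of the test functions serves for both kinds of space.\<close>

lemma bergman_sqnorm_eq:
  fixes f :: "complex ^ 'n \<Rightarrow> complex"
  assumes f: "holomorphic_on_ball f"
  shows "(\<lambda>z. ennreal ((cmod (f z))\<^sup>2 * bergman_weight s z) * indicator unit_ball z) \<in> borel_measurable borel"
    and "bergman_sqnorm s f = (\<integral>\<^sup>+r. ennreal (indicator {0<..<1} r * (real (2 * CARD('n)) * r ^ (2 * CARD('n) - 1))) *
       (ennreal (Gamma (real CARD('n) + s + 1) / (Gamma (real CARD('n) + 1) * Gamma (s + 1)) * (1 - r\<^sup>2) powr s) *
         sphere_mean f r) \<partial>lborel)"
proof -
  define K where "K = Gamma (real CARD('n) + s + 1) / (Gamma (real CARD('n) + 1) * Gamma (s + 1))"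
  have [measurable]: "unit_ball \<in> sets (borel :: (complex^'n) measure)" by simp
  have [measurable]: "(\<lambda>z. ennreal ((cmod (f z))\<^sup>2) * indicator unit_ball z) \<in> borel_measurable borel"
    by (rule holomorphic_on_ball_measurable[OF f]) auto
  define h where "h = (\<lambda>z. ennreal ((cmod (f z))\<^sup>2 * bergman_weight s z) * indicator unit_ball z)"
  have w: "bergman_weight s z = K * (1 - (norm z)\<^sup>2) powr s" for z :: "complex ^ 'n" by (simp add: bergman_weight_def K_def)
  have h: "h z = (ennreal ((cmod (f z))\<^sup>2) * indicator unit_ball z) * ennreal (K * (1 - (norm z)\<^sup>2) powr s)" for z
    unfolding h_def w by (subst ennreal_mult') (auto simp: mult_ac)
  have [measurable]: "h \<in> borel_measurable borel" unfolding h[abs_def] by measurable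
  thus "(\<lambda>z. ennreal ((cmod (f z))\<^sup>2 * bergman_weight s z) * indicator unit_ball z) \<in> borel_measurable borel"
    unfolding h_def .
  have "bergman_sqnorm s f = (\<integral>\<^sup>+z. h z \<partial>nu)" by (simp add: bergman_sqnorm_def h_def)
  also have "\<dots> = (\<integral>\<^sup>+r. ennreal (indicator {0<..<1} r * (real (2 * CARD('n)) * r ^ (2 * CARD('n) - 1))) *
       (\<integral>\<^sup>+\<zeta>\<in>unit_sphere. h (r *\<^sub>R \<zeta>) \<partial>sigma_sphere) \<partial>lborel)"
    by (rule nn_integral_nu_polar_sphere) simp
  also have "\<dots> = (\<integral>\<^sup>+r. ennreal (indicator {0<..<1} r * (real (2 * CARD('n)) * r ^ (2 * CARD('n) - 1))) *
       (ennreal (K * (1 - r\<^sup>2) powr s) * sphere_mean f r) \<partial>lborel)"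
  proof (rule nn_integral_cong)
    fix r :: real
    show "ennreal (indicator {0<..<1} r * (real (2 * CARD('n)) * r ^ (2 * CARD('n) - 1))) *
       (\<integral>\<^sup>+\<zeta>\<in>unit_sphere. h (r *\<^sub>R \<zeta>) \<partial>sigma_sphere) =
      ennreal (indicator {0<..<1} r * (real (2 * CARD('n)) * r ^ (2 * CARD('n) - 1))) *
       (ennreal (K * (1 - r\<^sup>2) powr s) * sphere_mean f r)"
    proof (cases "r \<in> {0<..<1}")
      case True
      have "h (r *\<^sub>R \<zeta>) * indicator unit_sphere \<zeta> = ennreal (K * (1 - r\<^sup>2) powr s) * (ennreal ((cmod (f (r *\<^sub>R \<zeta>)))\<^sup>2) * indicator unit_sphere \<zeta>)" for \<zeta>
        using True by (auto simp: h indicator_def mult_ac)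
      hence "(\<integral>\<^sup>+\<zeta>\<in>unit_sphere. h (r *\<^sub>R \<zeta>) \<partial>sigma_sphere)
         = (\<integral>\<^sup>+\<zeta>. ennreal (K * (1 - r\<^sup>2) powr s) * (ennreal ((cmod (f (r *\<^sub>R \<zeta>)))\<^sup>2) * indicator unit_sphere \<zeta>) \<partial>sigma_sphere)"
        by (simp only:)
      also have "\<dots> = ennreal (K * (1 - r\<^sup>2) powr s) * sphere_mean f r"
        unfolding sphere_mean_def using True sphere_integrand_measurable[OF f, of r]
        by (intro nn_integral_cmult) auto
      finally show ?thesis by (simp only:)
    qed simp
  qed
  finally show "bergman_sqnorm s f = (\<integral>\<^sup>+r. ennreal (indicator {0<..<1} r * (real (2 * CARD('n)) * r ^ (2 * CARD('n) - 1))) *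
       (ennreal (Gamma (real CARD('n) + s + 1) / (Gamma (real CARD('n) + 1) * Gamma (s + 1)) * (1 - r\<^sup>2) powr s) *
         sphere_mean f r) \<partial>lborel)" unfolding K_def .
qed

text \<open>On the shell the weight is bounded below by a multiple of \<delta>^s, which turns
  \<delta>^(N+1) into \<delta>^(N+1+s). For the test functions, spherical means of order (\<epsilon>
  + 1 - r)^-(2p - N) are integrated against (1 - r)^s; the condition \<beta> < 2p is the convergence
  condition s + 1 < q for q = 2p - N.\<close>

lemma bergman_evaluation_test_space:
  assumes s: "s > -1"
  shows "evaluation_test_space (bergman_space s :: (complex ^ 'n \<Rightarrow> complex) set) (bergman_norm s) (real CARD('n) + 1 + s)"
proof
  fix f g :: "complex ^ 'n \<Rightarrow> complex" assume "f \<in> bergman_space s" "g \<in> bergman_space s"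
  hence f: "holomorphic_on_ball f" "bergman_sqnorm s f < \<infinity>" and g: "holomorphic_on_ball g" "bergman_sqnorm s g < \<infinity>"
    by (auto simp: bergman_space_def)
  note [measurable] = bergman_sqnorm_eq(1)[OF f(1), of s] bergman_sqnorm_eq(1)[OF g(1), of s]
  have w0: "bergman_weight s z \<ge> 0" for z :: "complex ^ 'n"
    unfolding bergman_weight_def using s by (intro mult_nonneg_nonneg divide_nonneg_nonneg) (auto intro!: less_imp_le Gamma_real_pos)
  have "bergman_sqnorm s (\<lambda>z. f z - g z) \<le> (\<integral>\<^sup>+z. 2 * (ennreal ((cmod (f z))\<^sup>2 * bergman_weight s z) * indicator unit_ball z)
        + 2 * (ennreal ((cmod (g z))\<^sup>2 * bergman_weight s z) * indicator unit_ball z) \<partial>nu)"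
    unfolding bergman_sqnorm_def
  proof (rule nn_integral_mono)
    fix z :: "complex ^ 'n"
    have "(cmod (f z - g z))\<^sup>2 * bergman_weight s z \<le> (2 * (cmod (f z))\<^sup>2 + 2 * (cmod (g z))\<^sup>2) * bergman_weight s z"
      by (intro mult_right_mono cmod_diff_sqr_le w0)
    also have "\<dots> = 2 * ((cmod (f z))\<^sup>2 * bergman_weight s z) + 2 * ((cmod (g z))\<^sup>2 * bergman_weight s z)" by (simp add: algebra_simps)
    finally have "ennreal ((cmod (f z - g z))\<^sup>2 * bergman_weight s z) \<le> ennreal (2 * ((cmod (f z))\<^sup>2 * bergman_weight s z) + 2 * ((cmod (g z))\<^sup>2 * bergman_weight s z))"
      by (rule ennreal_leI)
    also have "\<dots> = ennreal (2 * ((cmod (f z))\<^sup>2 * bergman_weight s z)) + ennreal (2 * ((cmod (g z))\<^sup>2 * bergman_weight s z))"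
      using w0[of z] by (intro ennreal_plus) auto
    also have "\<dots> = 2 * ennreal ((cmod (f z))\<^sup>2 * bergman_weight s z) + 2 * ennreal ((cmod (g z))\<^sup>2 * bergman_weight s z)"
      using w0[of z] ennreal_mult[of 2] by simp
    finally show "ennreal ((cmod (f z - g z))\<^sup>2 * bergman_weight s z) * indicator unit_ball z
       \<le> 2 * (ennreal ((cmod (f z))\<^sup>2 * bergman_weight s z) * indicator unit_ball z)
        + 2 * (ennreal ((cmod (g z))\<^sup>2 * bergman_weight s z) * indicator unit_ball z)"
      by (simp split: split_indicator)
  qed
  also have "\<dots> = 2 * bergman_sqnorm s f + 2 * bergman_sqnorm s g"
    unfolding bergman_sqnorm_def by (subst nn_integral_add) (simp_all add: nn_integral_cmult)
  also have "\<dots> < \<infinity>" using f(2) g(2) by (simp add: ennreal_mult_less_top)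
  finally show "(\<lambda>z. f z - g z) \<in> bergman_space s"
    using holomorphic_on_ball_diff[OF f(1) g(1)] by (simp add: bergman_space_def)
next
  obtain c where c: "c > 0" "\<And>(g :: complex ^ 'n \<Rightarrow> complex) w. holomorphic_on_ball g \<Longrightarrow> norm w < 1 \<Longrightarrow>
    ennreal (c * (1 - norm w) ^ Suc CARD('n) * (cmod (g w))\<^sup>2) \<le>
    (\<integral>\<^sup>+z. ennreal ((cmod (g z))\<^sup>2) *
       indicator {z. 1 - 5/4 * (1 - norm w) \<le> norm z \<and> norm z \<le> 1 - 7/16 * (1 - norm w)} z \<partial>nu)"
    using point_evaluation_annulus by blast
  define N where "N = CARD('n)"
  define K where "K = Gamma (real N + s + 1) / (Gamma (real N + 1) * Gamma (s + 1))"
  have K: "K > 0" unfolding K_def using s by (intro divide_pos_pos mult_pos_pos Gamma_real_pos) auto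
  \<comment> \<open>On the shell 7/16 \<delta> \<le> 1 - |z|^2 \<le> 5/2 \<delta>; which end bounds
    the power from below depends on the sign of s, hence the minimum.\<close>
  define k where "k = min ((7/16) powr s) ((5/2) powr s)"
  have k: "k > 0" by (simp add: k_def)
  define c' where "c' = c * (K * k)"
  have c': "c' > 0" using c K k by (simp add: c'_def)
  show "\<exists>C. \<forall>f\<in>bergman_space s. \<forall>w::complex^'n. norm w < 1 \<longrightarrow>
      cmod (f w) * (1 - norm w) powr ((real CARD('n) + 1 + s) / 2) \<le> C * bergman_norm s f"
  proof (intro exI ballI allI impI)
    fix f :: "complex ^ 'n \<Rightarrow> complex" and w :: "complex ^ 'n" assume "f \<in> bergman_space s" and w: "norm w < 1"
    hence f: "holomorphic_on_ball f" "bergman_sqnorm s f < \<infinity>" by (auto simp: bergman_space_def)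
    note [measurable] = bergman_sqnorm_eq(1)[OF f(1), of s]
    define \<delta> where "\<delta> = 1 - norm w"
    have \<delta>: "\<delta> > 0" "\<delta> \<le> 1" using w by (auto simp: \<delta>_def)
    define A where "A = {z :: complex ^ 'n. 1 - 5/4 * \<delta> \<le> norm z \<and> norm z \<le> 1 - 7/16 * \<delta>}"
    have [measurable]: "A \<in> sets borel" unfolding A_def by measurable
    have AB: "A \<subseteq> unit_ball" using \<delta> by (auto simp: A_def)
    have hm: "(\<lambda>z. ennreal ((cmod (f z))\<^sup>2) * indicator A z) \<in> borel_measurable borel"
      by (rule holomorphic_on_ball_measurable[OF f(1) _ AB]) simp
    have wt: "K * k * \<delta> powr s \<le> bergman_weight s z" if z: "z \<in> A" for z
    proof -
      define x where "x = 1 - (norm z)\<^sup>2"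
      have xe: "x = (1 - norm z) * (1 + norm z)" by (simp add: x_def power2_eq_square algebra_simps)
      have z1: "norm z \<le> 1" using z AB by auto
      have "7/16 * \<delta> * 1 \<le> (1 - norm z) * (1 + norm z)"
        using z z1 \<delta> by (intro mult_mono) (auto simp: A_def)
      hence x1: "7/16 * \<delta> \<le> x" by (simp add: xe)
      have "(1 - norm z) * (1 + norm z) \<le> (5/4 * \<delta>) * 2"
        using z z1 \<delta> by (intro mult_mono) (auto simp: A_def)
      hence x2: "x \<le> 5/2 * \<delta>" by (simp add: xe)
      have "k * \<delta> powr s \<le> x powr s"
      proof (cases "s \<ge> 0")
        case True
        have "k * \<delta> powr s \<le> (7/16) powr s * \<delta> powr s" by (intro mult_right_mono) (auto simp: k_def)
        also have "\<dots> = (7/16 * \<delta>) powr s" using \<delta> by (intro powr_mult[symmetric])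
        also have "\<dots> \<le> x powr s" using x1 \<delta> True by (intro powr_mono2) auto
        finally show ?thesis .
      next
        case False
        have "k * \<delta> powr s \<le> (5/2) powr s * \<delta> powr s" by (intro mult_right_mono) (auto simp: k_def)
        also have "\<dots> = (5/2 * \<delta>) powr s" using \<delta> by (intro powr_mult[symmetric])
        also have "\<dots> \<le> x powr s" using x1 x2 \<delta> False by (intro powr_mono2') auto
        finally show ?thesis .
      qed
      hence "K * (k * \<delta> powr s) \<le> K * x powr s" using K by (intro mult_left_mono) auto
      thus ?thesis by (simp add: bergman_weight_def K_def N_def x_def mult_ac)
    qed
    define b where "b = K * k * \<delta> powr s"
    have b: "b > 0" using K k \<delta> by (simp add: b_def)
    have "ennreal b * ennreal (c * \<delta> ^ Suc N * (cmod (f w))\<^sup>2) \<le> ennreal b * (\<integral>\<^sup>+z. ennreal ((cmod (f z))\<^sup>2) * indicator A z \<partial>nu)"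
      using c(2)[OF f(1) w] unfolding A_def \<delta>_def N_def by (intro mult_left_mono) auto
    also have "\<dots> = (\<integral>\<^sup>+z. ennreal b * (ennreal ((cmod (f z))\<^sup>2) * indicator A z) \<partial>nu)"
      using hm by (intro nn_integral_cmult[symmetric]) simp
    also have "\<dots> \<le> bergman_sqnorm s f"
      unfolding bergman_sqnorm_def
    proof (rule nn_integral_mono)
      fix z :: "complex ^ 'n"
      show "ennreal b * (ennreal ((cmod (f z))\<^sup>2) * indicator A z) \<le> ennreal ((cmod (f z))\<^sup>2 * bergman_weight s z) * indicator unit_ball z"
      proof (cases "z \<in> A")
        case True
        have "b * (cmod (f z))\<^sup>2 \<le> (cmod (f z))\<^sup>2 * bergman_weight s z"
          using wt[OF True] by (subst mult.commute) (auto simp: b_def intro!: mult_left_mono)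
        hence "ennreal b * ennreal ((cmod (f z))\<^sup>2) \<le> ennreal ((cmod (f z))\<^sup>2 * bergman_weight s z)"
          using b by (subst ennreal_mult[symmetric]) (auto intro: ennreal_leI)
        thus ?thesis using True AB by (auto simp: indicator_def)
      qed simp
    qed
    also have "ennreal b * ennreal (c * \<delta> ^ Suc N * (cmod (f w))\<^sup>2) = ennreal (c' * \<delta> powr (real N + 1 + s) * (cmod (f w))\<^sup>2)"
    proof -
      have "\<delta> powr (real N + 1 + s) = \<delta> ^ Suc N * \<delta> powr s"
        using \<delta> powr_realpow[of \<delta> "Suc N"] by (simp add: powr_add)
      thus ?thesis using b c \<delta> by (subst ennreal_mult[symmetric]) (auto simp: b_def c'_def mult_ac)
    qed
    finally have "ennreal (c' * \<delta> powr (real N + 1 + s) * (cmod (f w))\<^sup>2) \<le> bergman_sqnorm s f" .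
    from evaluation_bound_from_sqr[OF c' \<delta>(1) f(2) this]
    show "cmod (f w) * (1 - norm w) powr ((real CARD('n) + 1 + s) / 2) \<le> 1 / sqrt c' * bergman_norm s f"
      by (simp add: bergman_norm_def \<delta>_def N_def)
  qed
next
  fix p :: nat assume p: "real CARD('n) + 1 + s < 2 * real p"
  define N where "N = CARD('n)"
  have pN: "CARD('n) < 2 * p" using p s by linarith
  define K where "K = Gamma (real N + s + 1) / (Gamma (real N + 1) * Gamma (s + 1))"
  have K: "K > 0" unfolding K_def using s by (intro divide_pos_pos mult_pos_pos Gamma_real_pos) auto
  obtain C where C: "C \<ge> 0" "\<And>(\<eta> :: complex ^ 'n) \<beta> \<epsilon> r. norm \<eta> = 1 \<Longrightarrow> \<epsilon> > 0 \<Longrightarrow> 0 < r \<Longrightarrow> r < 1 \<Longrightarrow>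
    sphere_mean (test_function \<eta> \<beta> p \<epsilon>) r
      \<le> ennreal (\<epsilon> powr (2 * real p - \<beta>) * (C / (\<epsilon> + (1 - r)) ^ (2 * p - CARD('n))))"
    using sphere_mean_test_function[OF pN] by blast
  define q where "q = real (2 * p - N)"
  have qe: "q = 2 * real p - real N" using pN by (simp add: q_def N_def)
  have q: "q > s + 1" using p by (simp add: qe N_def)
  define D where "D = 2 * real N * K * 2 powr \<bar>s\<bar> * C"
  have D: "D \<ge> 0" using K C(1) by (simp add: D_def)
  define L where "L = 1 / (s + 1) + 1 / (q - s - 1)"
  have L: "L \<ge> 0" using s q by (simp add: L_def)
  show "\<exists>C. \<forall>\<eta> \<epsilon>. norm (\<eta> :: complex ^ 'n) = 1 \<longrightarrow> 0 < \<epsilon> \<longrightarrow>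
      test_function \<eta> (real CARD('n) + 1 + s) p \<epsilon> \<in> bergman_space s \<and> bergman_norm s (test_function \<eta> (real CARD('n) + 1 + s) p \<epsilon>) \<le> C"
  proof (intro exI allI impI)
    fix \<eta> :: "complex ^ 'n" and \<epsilon> :: real assume \<eta>: "norm \<eta> = 1" and \<epsilon>: "0 < \<epsilon>"
    define f where "f = test_function \<eta> (real CARD('n) + 1 + s) p \<epsilon>"
    have f: "holomorphic_on_ball f" unfolding f_def by (rule holomorphic_test_function[OF \<eta> \<epsilon>])
    define e where "e = \<epsilon> powr (q - s - 1)"
    have e0: "e \<ge> 0" by (simp add: e_def)
    define G where "G = (\<lambda>t. indicator {0<..} t * (t powr s / (\<epsilon> + t) powr q))"
    have G0: "G t \<ge> 0" for t by (simp add: G_def indicator_def)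
    have [measurable]: "G \<in> borel_measurable borel" unfolding G_def by measurable
    have "bergman_sqnorm s f = (\<integral>\<^sup>+r. ennreal (indicator {0<..<1} r * (real (2 * N) * r ^ (2 * N - 1))) *
       (ennreal (K * (1 - r\<^sup>2) powr s) * sphere_mean f r) \<partial>lborel)"
      unfolding bergman_sqnorm_eq(2)[OF f] N_def K_def ..
    also have "\<dots> \<le> (\<integral>\<^sup>+r. ennreal (D * e) * ennreal (G (1 + (-1) * r)) \<partial>lborel)"
    proof (rule nn_integral_mono)
      fix r :: real
      show "ennreal (indicator {0<..<1} r * (real (2 * N) * r ^ (2 * N - 1))) *
       (ennreal (K * (1 - r\<^sup>2) powr s) * sphere_mean f r) \<le> ennreal (D * e) * ennreal (G (1 + (-1) * r))"
      proof (cases "r \<in> {0<..<1}")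
        case True
        hence r: "0 < r" "r < 1" by auto
        have 1: "real (2 * N) * r ^ (2 * N - 1) \<le> 2 * real N" using r by (simp add: mult_left_le power_le_one)
        \<comment> \<open>The base lies between 1 and 2 while s may have either sign, hence the
          absolute value.\<close>
        have "(1 + r) powr s \<le> 2 powr \<bar>s\<bar>"
        proof -
          have "(1 + r) powr s \<le> (1 + r) powr \<bar>s\<bar>" using r by (intro powr_mono) auto
          also have "\<dots> \<le> 2 powr \<bar>s\<bar>" using r by (intro powr_mono2) auto
          finally show ?thesis .
        qed
        moreover have "1 - r\<^sup>2 = (1 - r) * (1 + r)" by (simp add: power2_eq_square algebra_simps)
        hence "(1 - r\<^sup>2) powr s = (1 - r) powr s * (1 + r) powr s" using r by (simp add: powr_mult)
        ultimately have 2: "(1 - r\<^sup>2) powr s \<le> (1 - r) powr s * 2 powr \<bar>s\<bar>" by (simp add: mult_left_mono)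
        have "2 * real p - (real CARD('n) + 1 + s) = q - s - 1" by (simp add: qe N_def)
        moreover have "(\<epsilon> + (1 - r)) ^ (2 * p - CARD('n)) = (\<epsilon> + (1 - r)) powr q"
          unfolding q_def N_def using \<epsilon> r by (subst powr_realpow) auto
        ultimately have 3: "sphere_mean f r \<le> ennreal (e * (C / (\<epsilon> + (1 - r)) powr q))"
          using C(2)[OF \<eta> \<epsilon> r, of "real CARD('n) + 1 + s"] by (simp only: f_def e_def)
        have "ennreal (real (2 * N) * r ^ (2 * N - 1)) * (ennreal (K * (1 - r\<^sup>2) powr s) * sphere_mean f r)
          \<le> ennreal (2 * real N) * (ennreal (K * ((1 - r) powr s * 2 powr \<bar>s\<bar>)) * ennreal (e * (C / (\<epsilon> + (1 - r)) powr q)))"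
          using K by (intro mult_mono 3 ennreal_leI mult_left_mono[OF 2] 1) auto
        also have "\<dots> = ennreal (2 * real N * (K * ((1 - r) powr s * 2 powr \<bar>s\<bar>) * (e * (C / (\<epsilon> + (1 - r)) powr q))))"
        proof -
          have "ennreal x * (ennreal y * ennreal z) = ennreal (x * (y * z))" if "x \<ge> 0" "y \<ge> 0" "z \<ge> 0" for x y z
            using that by (simp add: ennreal_mult)
          thus ?thesis using K C(1) e0 by simp
        qed
        also have "2 * real N * (K * ((1 - r) powr s * 2 powr \<bar>s\<bar>) * (e * (C / (\<epsilon> + (1 - r)) powr q)))
           = D * e * G (1 + (-1) * r)"
          using r by (simp add: D_def G_def)
        also have "ennreal \<dots> = ennreal (D * e) * ennreal (G (1 + (-1) * r))" using D e0 G0 by (intro ennreal_mult) auto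
        finally show ?thesis using True by simp
      qed simp
    qed
    also have "\<dots> = ennreal (D * e) * (\<integral>\<^sup>+r. ennreal (G (1 + (-1) * r)) \<partial>lborel)"
      by (rule nn_integral_cmult) simp
    \<comment> \<open>The reflection t = 1 - r; its affine form \<open>1 + (-1) * r\<close> was
      prepared for this substitution.\<close>
    also have "(\<integral>\<^sup>+r. ennreal (G (1 + (-1) * r)) \<partial>lborel) = (\<integral>\<^sup>+t. ennreal (G t) \<partial>lborel)"
      by (subst nn_integral_real_affine[of "\<lambda>t. ennreal (G t)" "-1" 1]) auto
    also have "ennreal (D * e) * (\<integral>\<^sup>+t. ennreal (G t) \<partial>lborel) \<le> ennreal (D * e) * ennreal (L * \<epsilon> powr (s + 1 - q))"
      unfolding G_def L_def by (intro mult_left_mono nn_integral_powr_quotient_le s q \<epsilon>) simp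
    also have "\<dots> = ennreal (D * L)"
    proof -
      have "e * \<epsilon> powr (s + 1 - q) = 1" unfolding e_def using \<epsilon> by (simp add: powr_add[symmetric])
      hence "D * e * (L * \<epsilon> powr (s + 1 - q)) = D * L" by (simp add: mult_ac)
      thus ?thesis using D L e0 by (subst ennreal_mult[symmetric]) auto
    qed
    finally have le: "bergman_sqnorm s f \<le> ennreal (D * L)" .
    hence "enn2real (bergman_sqnorm s f) \<le> D * L"
      using D L by (intro enn2real_leI) auto
    thus "test_function \<eta> (real CARD('n) + 1 + s) p \<epsilon> \<in> bergman_space s \<and> bergman_norm s (test_function \<eta> (real CARD('n) + 1 + s) p \<epsilon>) \<le> sqrt (D * L)"
      using f order_le_less_trans[OF le ennreal_less_top]
      unfolding f_def[symmetric] by (simp add: bergman_space_def bergman_norm_def)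
  qed
qed

section \<open>Compact combinations\<close>

text \<open>Clearing denominators, with one factor per distinct value of d, gives a polynomial with
  infinitely many zeros, hence zero. At x = -e every term with d l \<noteq> e contains the vanishing
  factor (e + x)^p, and the surviving terms share a nonzero factor.\<close>

lemma partial_fraction_coefficients_zero:
  fixes c :: "'i \<Rightarrow> complex" and d :: "'i \<Rightarrow> real"
  assumes L: "finite L" and d: "\<And>l. l \<in> L \<Longrightarrow> d l \<ge> 0" and p: "p > 0"
    and zero: "\<And>\<tau>. \<tau> > 0 \<Longrightarrow> (\<Sum>l\<in>L. c l * (1 / of_real (\<tau> + d l)) ^ p) = 0"
  shows "(\<Sum>l\<in>{l \<in> L. d l = e}. c l) = 0"
proof (cases "e \<in> d ` L")
  case False
  hence "{l \<in> L. d l = e} = {}" by auto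
  thus ?thesis by (simp only: sum.empty)
next
  case True
  define D where "D = d ` L"
  have D: "finite D" "e \<in> D" using L True by (auto simp: D_def)
  \<comment> \<open>The product runs over the set \<open>D\<close> of distinct values, so indices
    with the same pole carry the same product and their coefficients add up.\<close>
  define P where "P = (\<Sum>l\<in>L. smult (c l) (\<Prod>u\<in>D - {d l}. [:of_real u, 1:] ^ p))"
  have polyP: "poly P x = (\<Sum>l\<in>L. c l * (\<Prod>u\<in>D - {d l}. (of_real u + x) ^ p))" for x
    by (simp add: P_def poly_sum poly_prod)
  have "poly P (of_real \<tau>) = 0" if \<tau>: "\<tau> > 0" for \<tau>
  proof -
    have nz: "complex_of_real u + of_real \<tau> \<noteq> 0" if "u \<in> D" for u
    proof -
      have "u + \<tau> > 0" using d \<tau> that by (auto simp: D_def add_nonneg_pos)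
      thus ?thesis by (metis less_irrefl of_real_add of_real_eq_0_iff)
    qed
    have "c l * (\<Prod>u\<in>D - {d l}. (of_real u + of_real \<tau>) ^ p)
        = c l * (1 / of_real (\<tau> + d l)) ^ p * (\<Prod>u\<in>D. (of_real u + of_real \<tau>) ^ p)" if "l \<in> L" for l
    proof -
      have dl: "d l \<in> D" using that by (simp add: D_def)
      have "(\<Prod>u\<in>D. (complex_of_real u + of_real \<tau>) ^ p) = (of_real (d l) + of_real \<tau>) ^ p * (\<Prod>u\<in>D - {d l}. (of_real u + of_real \<tau>) ^ p)"
        using D(1) dl by (rule prod.remove)
      thus ?thesis using nz[OF dl] by (simp add: power_one_over add.commute)
    qed
    hence "poly P (of_real \<tau>) = (\<Sum>l\<in>L. c l * (1 / of_real (\<tau> + d l)) ^ p) * (\<Prod>u\<in>D. (of_real u + of_real \<tau>) ^ p)"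
      unfolding polyP sum_distrib_right by (intro sum.cong) auto
    thus ?thesis using zero[OF \<tau>] by simp
  qed
  hence "complex_of_real ` {0<..} \<subseteq> {x. poly P x = 0}" by auto
  moreover have "infinite (complex_of_real ` {0<..})"
    using finite_imageD[of complex_of_real "{0<..}"] infinite_Ioi[of "0::real"] by (auto simp: inj_on_def)
  ultimately have "infinite {x. poly P x = 0}" using infinite_super by blast
  hence "P = 0" using poly_roots_finite by blast
  hence "0 = poly P (- of_real e)" by simp
  also have "\<dots> = (\<Sum>l\<in>L. if d l = e then c l * (\<Prod>u\<in>D - {e}. (of_real u - of_real e) ^ p) else 0)"
    unfolding polyP
  proof (rule sum.cong)
    fix l assume "l \<in> L"
    show "c l * (\<Prod>u\<in>D - {d l}. (of_real u + - complex_of_real e) ^ p)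
       = (if d l = e then c l * (\<Prod>u\<in>D - {e}. (of_real u - of_real e) ^ p) else 0)"
    proof (cases "d l = e")
      case False
      hence "(\<Prod>u\<in>D - {d l}. (of_real u + - complex_of_real e) ^ p) = 0"
        using D p by (intro prod_zero) (auto intro!: bexI[of _ e])
      thus ?thesis using False by simp
    qed simp
  qed simp
  also have "\<dots> = (\<Sum>l\<in>{l \<in> L. d l = e}. c l) * (\<Prod>u\<in>D - {e}. (of_real u - of_real e) ^ p)"
    using L by (simp add: sum.If_cases sum_distrib_right Collect_conj_eq Int_commute)
  finally show ?thesis using D by (simp add: prod_zero_iff)
qed

text \<open>If d is infinite, the denominator is at least 1 - |\<phi>|, which outgrows 1 - r. If the
  radial limit is \<eta>, dividing by 1 - r exposes the Julia-Caratheodory quotient. If it is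
  another unit vector, the denominator has a nonzero limit, since unit vectors with Hermitian
  product 1 coincide. Finiteness of d is part of the condition because \<open>radial_limit\<close>
  may be unspecified without it.\<close>

lemma kernel_radial_limit:
  fixes \<phi> :: "complex ^ 'n \<Rightarrow> complex ^ 'n"
  assumes \<phi>: "analytic_self_map \<phi>" and \<zeta>: "norm \<zeta> = 1" and \<eta>: "norm \<eta> = 1" and \<tau>: "\<tau> > 0"
  shows "((\<lambda>r. of_real (1 - r) / (1 + of_real (\<tau> * (1 - r)) - hinner (\<phi> (r *\<^sub>R \<zeta>)) \<eta>)) \<longlongrightarrow>
    (if dil_coeff \<phi> \<zeta> \<noteq> \<infinity> \<and> radial_limit \<phi> \<zeta> = \<eta>
     then 1 / of_real (\<tau> + real_of_ereal (dil_coeff \<phi> \<zeta>)) else 0)) (at_left 1)"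
    (is "(?Z \<longlongrightarrow> _) _")
proof -
  define a where "a = (\<lambda>r. hinner (\<phi> (r *\<^sub>R \<zeta>)) \<eta>)"
  have evr: "eventually (\<lambda>r. r \<in> {0<..<1::real}) (at_left 1)"
    by (rule eventually_at_leftI[of 0]) auto
  show ?thesis
  proof (cases "dil_coeff \<phi> \<zeta> = \<infinity>")
    case True
    have "(?Z \<longlongrightarrow> 0) (at_left 1)"
    proof (rule tendstoI)
      fix e :: real assume e: "e > 0"
      have "ereal (1 / e) < dil_coeff \<phi> \<zeta>" using True by simp
      from dil_coeff_less_imp_eventually[OF this \<zeta>] evr
      show "\<forall>\<^sub>F r in at_left 1. dist (?Z r) 0 < e"
      proof eventually_elim
        case (elim r)
        define b where "b = 1 - norm (\<phi> (r *\<^sub>R \<zeta>))"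
        have r: "1 - r > 0" using elim by simp
        have "(1 - r) / e < b" using elim r by (simp add: b_def field_simps)
        moreover have "0 < (1 - r) / e" using e r by simp
        ultimately have b: "b > 0" "1 - r < e * b" using e by (linarith, simp add: field_simps)
        have "1 + \<tau> * (1 - r) \<le> cmod (1 + of_real (\<tau> * (1 - r)) - a r) + cmod (a r)"
        proof -
          have "cmod (of_real (1 + \<tau> * (1 - r))) \<le> cmod (of_real (1 + \<tau> * (1 - r)) - a r) + cmod (a r)"
            by (metis add.commute norm_triangle_sub)
          moreover have "0 \<le> 1 + \<tau> * (1 - r)" using \<tau> r by simp
          ultimately show ?thesis by (simp only: norm_of_real abs_of_nonneg) simp
        qed
        moreover have "cmod (a r) \<le> 1 - b" using cmod_hinner_le[of "\<phi> (r *\<^sub>R \<zeta>)" \<eta>] \<eta> by (simp add: a_def b_def)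
        moreover have "0 \<le> \<tau> * (1 - r)" using \<tau> r by simp
        ultimately have den: "b \<le> cmod (1 + of_real (\<tau> * (1 - r)) - a r)" by linarith
        have "cmod (?Z r) = (1 - r) / cmod (1 + of_real (\<tau> * (1 - r)) - a r)"
          using r by (simp only: norm_divide norm_of_real a_def abs_of_pos)
        also have "\<dots> \<le> (1 - r) / b" using r b den by (intro divide_left_mono mult_pos_pos) auto
        also have "\<dots> < e" using b by (simp add: divide_less_eq)
        finally show ?case by simp
      qed
    qed
    thus ?thesis using True by simp
  next
    case False
    then obtain d where d: "dil_coeff \<phi> \<zeta> = ereal d"
      using dil_coeff_nonneg[OF \<phi>, of \<zeta>] by (cases "dil_coeff \<phi> \<zeta>") auto
    have d0: "d \<ge> 0" using dil_coeff_nonneg[OF \<phi>, of \<zeta>] d by simp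
    obtain \<eta>' where \<eta>': "norm \<eta>' = 1" and lim: "((\<lambda>r. \<phi> (r *\<^sub>R \<zeta>)) \<longlongrightarrow> \<eta>') (at_left 1)"
      and q: "((\<lambda>r. (1 - hinner (\<phi> (r *\<^sub>R \<zeta>)) \<eta>') / of_real (1 - r)) \<longlongrightarrow> of_real d) (at_left 1)"
      using Julia_Caratheodory_radial[OF \<phi> \<zeta> d] by blast
    have rl: "radial_limit \<phi> \<zeta> = \<eta>'"
      unfolding radial_limit_def using lim by (intro tendsto_Lim) simp_all
    show ?thesis
    proof (cases "\<eta>' = \<eta>")
      case True
      have "of_real \<tau> + complex_of_real d \<noteq> 0"
      proof -
        have "\<tau> + d > 0" using \<tau> d0 by simp
        thus ?thesis by (metis less_irrefl of_real_add of_real_eq_0_iff)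
      qed
      hence "((\<lambda>r. 1 / (of_real \<tau> + (1 - a r) / of_real (1 - r))) \<longlongrightarrow> 1 / (of_real \<tau> + of_real d)) (at_left 1)"
        using q True unfolding a_def by (intro tendsto_intros) auto
      moreover have "\<forall>\<^sub>F r in at_left 1. 1 / (of_real \<tau> + (1 - a r) / of_real (1 - r)) = ?Z r"
        using evr
      proof eventually_elim
        case (elim r)
        define x where "x = complex_of_real (1 - r)"
        have x: "x \<noteq> 0" using elim by (auto simp: x_def simp del: of_real_diff)
        have "1 / (of_real \<tau> + (1 - a r) / x) = x / (1 + of_real \<tau> * x - a r)"
        proof -
          have "of_real \<tau> + (1 - a r) / x = (1 + of_real \<tau> * x - a r) / x" using x by (simp add: field_simps)
          thus ?thesis by simp
        qed
        thus ?case by (simp only: x_def a_def of_real_mult)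
      qed
      ultimately have "(?Z \<longlongrightarrow> 1 / (of_real \<tau> + of_real d)) (at_left 1)" by (rule Lim_transform_eventually)
      thus ?thesis using d rl True by simp
    next
      case ne: False
      have "hinner \<eta>' \<eta> \<noteq> 1"
      proof
        assume "hinner \<eta>' \<eta> = 1"
        hence "(norm (\<eta>' - \<eta>))\<^sup>2 = 0" using norm_diff_sqr_unit[OF \<eta>, of \<eta>'] \<eta>' by simp
        thus False using ne by simp
      qed
      hence "1 + complex_of_real (\<tau> * (1 - 1)) - hinner \<eta>' \<eta> \<noteq> 0" by simp
      hence "(?Z \<longlongrightarrow> of_real (1 - 1) / (1 + of_real (\<tau> * (1 - 1)) - hinner \<eta>' \<eta>)) (at_left 1)"
        by (intro tendsto_intros lim)
      thus ?thesis using rl ne by simp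
    qed
  qed
qed

text \<open>Compactness yields a limit g of a subsequence of images in \<open>nrm\<close>.
  Evaluation at fixed points, where the images tend to 0, identifies g as 0 on the ball. Evaluation
  at the moving points \<rho>_n \<zeta>, scaled by (1 - \<rho>_n)^(\<beta>/2), then tends to 0 along
  the subsequence, whereas the kernel limits make the same quantity converge to a multiple of the
  sum.\<close>

lemma (in evaluation_test_space) compact_combination_coefficients:
  fixes \<phi> :: "nat \<Rightarrow> complex ^ 'n \<Rightarrow> complex ^ 'n" and c :: "nat \<Rightarrow> complex"
  assumes \<phi>: "\<And>l. l \<in> {1..m} \<Longrightarrow> analytic_self_map (\<phi> l)"
    and compact: "compact_operator H nrm (\<lambda>f z. \<Sum>l=1..m. c l * comp_op (\<phi> l) f z)"
    and \<zeta>: "norm \<zeta> = 1" and \<eta>: "norm \<eta> = 1" and \<tau>: "\<tau> > 0" and p: "\<beta> < 2 * real p" "p > 0"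
  shows "(\<Sum>l\<in>{l \<in> {1..m}. dil_coeff (\<phi> l) \<zeta> \<noteq> \<infinity> \<and> radial_limit (\<phi> l) \<zeta> = \<eta>}.
    c l * (1 / of_real (\<tau> + real_of_ereal (dil_coeff (\<phi> l) \<zeta>))) ^ p) = 0"
proof -
  define T where "T = (\<lambda>f z. \<Sum>l=1..m. c l * comp_op (\<phi> l) f z)"
  obtain C where C: "\<And>f w. f \<in> H \<Longrightarrow> norm w < 1 \<Longrightarrow> cmod (f w) * (1 - norm w) powr (\<beta> / 2) \<le> C * nrm f"
    using point_evaluation by blast
  obtain C' where C': "\<And>\<eta> \<epsilon>. norm \<eta> = 1 \<Longrightarrow> 0 < \<epsilon> \<Longrightarrow>
      test_function \<eta> \<beta> p \<epsilon> \<in> H \<and> nrm (test_function \<eta> \<beta> p \<epsilon>) \<le> C'"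
    using test_function_bounded[OF p(1)] by blast
  \<comment> \<open>The double successor keeps the first radius, 1/2, positive.\<close>
  define \<rho> where "\<rho> = (\<lambda>n::nat. 1 - 1 / real (Suc (Suc n)))"
  have \<rho>: "0 < \<rho> n" "\<rho> n < 1" for n by (auto simp: \<rho>_def)
  have \<rho>lim: "filterlim \<rho> (at_left 1) sequentially"
    unfolding filterlim_at
  proof
    show "\<forall>\<^sub>F n in sequentially. \<rho> n \<in> {..<1} \<and> \<rho> n \<noteq> 1"
      using \<rho>(2) by (auto intro!: always_eventually simp: less_imp_neq)
    have "(\<lambda>n. 1 / real (Suc n)) \<longlonglongrightarrow> 0" using LIMSEQ_inverse_real_of_nat by (simp only: inverse_eq_divide)
    hence "(\<lambda>n. 1 / real (Suc (Suc n))) \<longlonglongrightarrow> 0" by (rule LIMSEQ_Suc)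
    from tendsto_diff[OF tendsto_const this, of 1] show "\<rho> \<longlonglongrightarrow> 1" by (simp add: \<rho>_def)
  qed
  \<comment> \<open>Tying \<epsilon> to the distance 1 - \<rho>_n of the evaluation point from the
    sphere is the scale at which each kernel quotient with finite d and radial limit \<eta> has a
    finite nonzero limit.\<close>
  define \<epsilon> where "\<epsilon> = (\<lambda>n. \<tau> * (1 - \<rho> n))"
  have \<epsilon>: "\<epsilon> n > 0" for n using \<tau> \<rho>(2)[of n] by (simp add: \<epsilon>_def)
  have "\<rho> \<longlonglongrightarrow> 1" using \<rho>lim by (simp add: filterlim_at)
  hence "\<epsilon> \<longlonglongrightarrow> \<tau> * (1 - 1)" unfolding \<epsilon>_def by (intro tendsto_intros)
  hence \<epsilon>lim: "\<epsilon> \<longlonglongrightarrow> 0" by simp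
  define F where "F = (\<lambda>n. test_function \<eta> \<beta> p (\<epsilon> n))"
  have FH: "F n \<in> H" "nrm (F n) \<le> C'" for n using C'[OF \<eta> \<epsilon>] by (auto simp: F_def)
  have T: "compact_operator H nrm T" using compact by (simp only: T_def)
  have TH: "T f \<in> H" if "f \<in> H" for f using T that unfolding compact_operator_def by blast
  have "(\<forall>n. F n \<in> H) \<and> (\<exists>M. \<forall>n. nrm (F n) \<le> M)" using FH by blast
  hence "\<exists>g\<in>H. \<exists>k :: nat \<Rightarrow> nat. strict_mono k \<and> (\<lambda>n. nrm (\<lambda>z. T (F (k n)) z - g z)) \<longlonglongrightarrow> 0"
    by (rule T[unfolded compact_operator_def, THEN conjunct2, rule_format])
  then obtain g k where g: "g \<in> H" and k: "strict_mono (k :: nat \<Rightarrow> nat)"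
    and lim: "(\<lambda>n. nrm (\<lambda>z. T (F (k n)) z - g z)) \<longlonglongrightarrow> 0"
    by blast
  have uH: "(\<lambda>z. T (F (k n)) z - g z) \<in> H" for n by (intro diff_mem TH FH g)
  have ev: "cmod (T (F (k n)) w - g w) * (1 - norm w) powr (\<beta> / 2) \<le> C * nrm (\<lambda>z. T (F (k n)) z - g z)"
    if "norm w < 1" for n w using C[OF uH that] by simp
  have Clim: "(\<lambda>n. C * nrm (\<lambda>z. T (F (k n)) z - g z)) \<longlonglongrightarrow> 0" using tendsto_mult_right_zero[OF lim] .
  have F0: "(\<lambda>n. F n x) \<longlonglongrightarrow> 0" if x: "norm x < 1" for x
  proof -
    have e0: "(\<lambda>n. \<epsilon> n powr (real p - \<beta> / 2)) \<longlonglongrightarrow> 0"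
      by (rule tendsto_zero_powrI[OF \<epsilon>lim tendsto_const]) (use p \<epsilon> in \<open>auto intro!: always_eventually less_imp_le\<close>)
    have nz: "1 + of_real 0 - hinner x \<eta> \<noteq> 0"
      using cmod_hinner_le[of x \<eta>] x \<eta> by auto
    have "(\<lambda>n. F n x) \<longlonglongrightarrow> of_real 0 / (1 + of_real 0 - hinner x \<eta>) ^ p"
      unfolding F_def test_function_def by (intro tendsto_intros e0 \<epsilon>lim power_not_zero nz)
    thus ?thesis by simp
  qed
  \<comment> \<open>Only on the ball: the values of \<open>g\<close> off it are arbitrary.\<close>
  have g0: "g z = 0" if z: "norm z < 1" for z
  proof -
    have "(\<lambda>n. T (F n) z) \<longlonglongrightarrow> (\<Sum>l=1..m. c l * 0)"
      unfolding T_def comp_op_def o_def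
      by (intro tendsto_intros F0 analytic_self_map_norm_less[OF \<phi>] z) auto
    hence "(\<lambda>n. T (F n) z) \<longlonglongrightarrow> 0" by simp
    hence T0: "(\<lambda>n. T (F (k n)) z) \<longlonglongrightarrow> 0" using LIMSEQ_subseq_LIMSEQ[OF _ k] by (fastforce simp: o_def)
    have pos: "(1 - norm z) powr (\<beta> / 2) > 0" using z by simp
    have "(\<lambda>n. cmod (T (F (k n)) z - g z) * (1 - norm z) powr (\<beta> / 2)) \<longlonglongrightarrow> 0"
      by (rule tendsto_sandwich[OF _ _ tendsto_const Clim]) (use ev[OF z] in \<open>auto intro!: always_eventually\<close>)
    moreover have "(\<lambda>n. cmod (T (F (k n)) z - g z) * (1 - norm z) powr (\<beta> / 2)) \<longlonglongrightarrow> cmod (0 - g z) * (1 - norm z) powr (\<beta> / 2)"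
      by (intro tendsto_intros T0)
    ultimately have "cmod (0 - g z) * (1 - norm z) powr (\<beta> / 2) = 0" using LIMSEQ_unique by blast
    thus ?thesis using pos by simp
  qed
  define X where "X = (\<lambda>n. T (F n) (\<rho> n *\<^sub>R \<zeta>) * of_real ((1 - \<rho> n) powr (\<beta> / 2)))"
  have w1: "norm (\<rho> n *\<^sub>R \<zeta>) < 1" "norm (\<rho> n *\<^sub>R \<zeta>) = \<rho> n" for n using \<rho>(1,2)[of n] \<zeta> by auto
  have "(\<lambda>n. cmod (X (k n))) \<longlonglongrightarrow> 0"
  proof (rule tendsto_sandwich[OF _ _ tendsto_const Clim])
    show "\<forall>\<^sub>F n in sequentially. cmod (X (k n)) \<le> C * nrm (\<lambda>z. T (F (k n)) z - g z)"
    proof (intro always_eventually allI)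
      fix n
      show "cmod (X (k n)) \<le> C * nrm (\<lambda>z. T (F (k n)) z - g z)"
        using ev[OF w1(1)[of "k n"], of n] g0[OF w1(1)[of "k n"]] unfolding w1(2) by (simp add: X_def norm_mult)
    qed
  qed simp
  hence X0: "(\<lambda>n. X (k n)) \<longlonglongrightarrow> 0" by (rule tendsto_norm_zero_cancel)
  define b where "b = (\<lambda>l. if dil_coeff (\<phi> l) \<zeta> \<noteq> \<infinity> \<and> radial_limit (\<phi> l) \<zeta> = \<eta>
     then 1 / complex_of_real (\<tau> + real_of_ereal (dil_coeff (\<phi> l) \<zeta>)) else 0)"
  define Z where "Z = (\<lambda>l r. of_real (1 - r) / (1 + of_real (\<tau> * (1 - r)) - hinner (\<phi> l (r *\<^sub>R \<zeta>)) \<eta>))"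
  have Zlim: "(\<lambda>n. Z l (\<rho> n)) \<longlonglongrightarrow> b l" if "l \<in> {1..m}" for l
    using filterlim_compose[OF kernel_radial_limit[OF \<phi>[OF that] \<zeta> \<eta> \<tau>] \<rho>lim] unfolding Z_def b_def .
  have Xeq: "X n = (\<Sum>l=1..m. c l * (of_real (\<tau> powr (real p - \<beta> / 2)) * Z l (\<rho> n) ^ p))" for n
  proof -
    have r: "1 - \<rho> n > 0" using \<rho>(2)[of n] by simp
    \<comment> \<open>The exponent p - \<beta>/2 of the normalisation and \<beta>/2 of the
      evaluation bound add up to p, one factor 1 - \<rho>_n for each factor of the kernel.\<close>
    have pw: "\<epsilon> n powr (real p - \<beta> / 2) * (1 - \<rho> n) powr (\<beta> / 2) = \<tau> powr (real p - \<beta> / 2) * (1 - \<rho> n) ^ p"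
    proof -
      have "\<epsilon> n powr (real p - \<beta> / 2) = \<tau> powr (real p - \<beta> / 2) * (1 - \<rho> n) powr (real p - \<beta> / 2)"
        unfolding \<epsilon>_def by (rule powr_mult)
      moreover have "(1 - \<rho> n) powr (real p - \<beta> / 2) * (1 - \<rho> n) powr (\<beta> / 2) = (1 - \<rho> n) ^ p"
        using r by (simp add: powr_add[symmetric] powr_realpow)
      ultimately show ?thesis by (simp add: mult.assoc)
    qed
    have "F n (\<phi> l (\<rho> n *\<^sub>R \<zeta>)) * of_real ((1 - \<rho> n) powr (\<beta> / 2)) = of_real (\<tau> powr (real p - \<beta> / 2)) * Z l (\<rho> n) ^ p" for l
    proof -
      have "F n (\<phi> l (\<rho> n *\<^sub>R \<zeta>)) * of_real ((1 - \<rho> n) powr (\<beta> / 2))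
        = of_real (\<epsilon> n powr (real p - \<beta> / 2) * (1 - \<rho> n) powr (\<beta> / 2)) / (1 + of_real (\<epsilon> n) - hinner (\<phi> l (\<rho> n *\<^sub>R \<zeta>)) \<eta>) ^ p"
        by (simp add: F_def test_function_def)
      also have "\<dots> = of_real (\<tau> powr (real p - \<beta> / 2)) * Z l (\<rho> n) ^ p"
        unfolding pw by (simp add: Z_def \<epsilon>_def power_divide)
      finally show ?thesis .
    qed
    thus ?thesis unfolding X_def T_def comp_op_def o_def sum_distrib_right by (simp add: mult.assoc)
  qed
  have "X \<longlonglongrightarrow> (\<Sum>l=1..m. c l * (of_real (\<tau> powr (real p - \<beta> / 2)) * b l ^ p))"
    unfolding Xeq[abs_def] by (intro tendsto_intros Zlim)
  hence "(\<lambda>n. X (k n)) \<longlonglongrightarrow> (\<Sum>l=1..m. c l * (of_real (\<tau> powr (real p - \<beta> / 2)) * b l ^ p))"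
    using LIMSEQ_subseq_LIMSEQ[OF _ k] by (fastforce simp: o_def)
  hence "0 = (\<Sum>l=1..m. c l * (of_real (\<tau> powr (real p - \<beta> / 2)) * b l ^ p))"
    using X0 LIMSEQ_unique by blast
  also have "\<dots> = of_real (\<tau> powr (real p - \<beta> / 2)) * (\<Sum>l=1..m. c l * b l ^ p)"
    by (simp add: sum_distrib_left mult_ac)
  finally have "(\<Sum>l=1..m. c l * b l ^ p) = 0" using \<tau> by simp
  \<comment> \<open>Indices with b l = 0 drop out because 0^p = 0 for p > 0.\<close>
  moreover have "(\<Sum>l=1..m. c l * b l ^ p) = (\<Sum>l\<in>{l \<in> {1..m}. dil_coeff (\<phi> l) \<zeta> \<noteq> \<infinity> \<and> radial_limit (\<phi> l) \<zeta> = \<eta>}. c l * b l ^ p)"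
    by (rule sum.mono_neutral_right) (use p(2) in \<open>auto simp: b_def\<close>)
  moreover have "\<dots> = (\<Sum>l\<in>{l \<in> {1..m}. dil_coeff (\<phi> l) \<zeta> \<noteq> \<infinity> \<and> radial_limit (\<phi> l) \<zeta> = \<eta>}.
    c l * (1 / of_real (\<tau> + real_of_ereal (dil_coeff (\<phi> l) \<zeta>))) ^ p)"
    by (rule sum.cong) (auto simp: b_def)
  ultimately show ?thesis by simp
qed

theorem corollary2p4:
  fixes H :: "(complex ^ 'n \<Rightarrow> complex) set"
    and nrm :: "(complex ^ 'n \<Rightarrow> complex) \<Rightarrow> real"
    and \<phi> :: "nat \<Rightarrow> complex ^ 'n \<Rightarrow> complex ^ 'n"
    and c :: "nat \<Rightarrow> complex"
    and m j :: nat
    and \<zeta> :: "complex ^ 'n"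
  assumes "(H = hardy_space \<and> nrm = hardy_norm) \<or>
           (\<exists>s>-1. H = bergman_space s \<and> nrm = bergman_norm s)"
    and "\<And>l. l \<in> {1..m} \<Longrightarrow> analytic_self_map (\<phi> l)"
    and "\<And>l. l \<in> {1..m} \<Longrightarrow> bounded_operator H nrm (comp_op (\<phi> l))"
    and "compact_operator H nrm (\<lambda>f z. \<Sum>l=1..m. c l * comp_op (\<phi> l) f z)"
    and "\<zeta> \<in> unit_sphere"
    and "j \<in> {1..m}"
    and "finite_angular_derivative (\<phi> j) \<zeta>"
  shows "(\<Sum>l \<in> {l \<in> {1..m}. radial_limit (\<phi> l) \<zeta> = radial_limit (\<phi> j) \<zeta> \<and>
                             dil_coeff (\<phi> l) \<zeta> = dil_coeff (\<phi> j) \<zeta>}. c l) = 0"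
proof -
  have \<zeta>: "norm \<zeta> = 1" using assms(5) by simp
  obtain \<beta> where "evaluation_test_space H nrm \<beta>"
    using assms(1) hardy_evaluation_test_space bergman_evaluation_test_space by blast
  then interpret evaluation_test_space H nrm \<beta> .
  \<comment> \<open>\<beta> is an abstract real at this point, so p > 0 is secured separately by
    taking a successor.\<close>
  obtain n :: nat where "\<beta> < real n" using reals_Archimedean2 by blast
  then obtain p :: nat where p: "\<beta> < 2 * real p" "p > 0"
    using that[of "Suc n"] by simp
  have fin: "dil_coeff (\<phi> j) \<zeta> \<noteq> \<infinity>"
    using finite_angular_derivative_imp_dil_coeff[OF assms(7) \<zeta>] by auto
  then obtain d where d: "dil_coeff (\<phi> j) \<zeta> = ereal d"
    using dil_coeff_nonneg[OF assms(2)[OF assms(6)], of \<zeta>] by (cases "dil_coeff (\<phi> j) \<zeta>") auto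
  define \<eta> where "\<eta> = radial_limit (\<phi> j) \<zeta>"
  have \<eta>: "norm \<eta> = 1"
  proof -
    obtain \<eta>' where "norm \<eta>' = 1" and "((\<lambda>r. \<phi> j (r *\<^sub>R \<zeta>)) \<longlongrightarrow> \<eta>') (at_left 1)"
      using Julia_Caratheodory_radial[OF assms(2)[OF assms(6)] \<zeta> d] by blast
    moreover from this(2) have "\<eta> = \<eta>'"
      unfolding \<eta>_def radial_limit_def by (intro tendsto_Lim) simp_all
    ultimately show ?thesis by simp
  qed
  define L where "L = {l \<in> {1..m}. dil_coeff (\<phi> l) \<zeta> \<noteq> \<infinity> \<and> radial_limit (\<phi> l) \<zeta> = \<eta>}"
  have nn: "0 \<le> dil_coeff (\<phi> l) \<zeta>" if "l \<in> L" for l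
    using that by (intro dil_coeff_nonneg assms(2)) (simp add: L_def)
  have "(\<Sum>l\<in>{l \<in> L. real_of_ereal (dil_coeff (\<phi> l) \<zeta>) = d}. c l) = 0"
  proof (rule partial_fraction_coefficients_zero)
    show "finite L" by (simp add: L_def)
    show "0 \<le> real_of_ereal (dil_coeff (\<phi> l) \<zeta>)" if "l \<in> L" for l
      using nn[OF that] by (rule real_of_ereal_pos)
    show "p > 0" by fact
    show "(\<Sum>l\<in>L. c l * (1 / of_real (\<tau> + real_of_ereal (dil_coeff (\<phi> l) \<zeta>))) ^ p) = 0" if "\<tau> > 0" for \<tau>
      unfolding L_def by (rule compact_combination_coefficients[OF assms(2,4) \<zeta> \<eta> that p])
  qed
  \<comment> \<open>\<open>real_of_ereal\<close> sends \<infinity> to 0, so returning to equality of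
    extended reals relies on the finiteness built into \<open>L\<close>.\<close>
  moreover have "real_of_ereal x = d \<longleftrightarrow> x = ereal d" if "0 \<le> x" "x \<noteq> \<infinity>" for x
    using that by (cases x) auto
  hence "{l \<in> L. real_of_ereal (dil_coeff (\<phi> l) \<zeta>) = d} =
      {l \<in> {1..m}. radial_limit (\<phi> l) \<zeta> = radial_limit (\<phi> j) \<zeta> \<and> dil_coeff (\<phi> l) \<zeta> = dil_coeff (\<phi> j) \<zeta>}"
    using nn d by (auto simp: L_def \<eta>_def)
  ultimately show ?thesis by simp
qed

end
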